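(* Let $G$ be a cograph with countably many vertices. The following are equivalent: (i) $sib(G)=1$; (ii) $sib_c(G)=1$; (iii) $G$ is a lexicographic sum, indexed by a finite graph, of graphs each of which is a clique or an independent set.
   Context: Graphs are undirected and loopless; a cograph is a graph with no induced subgraph isomorphic to the path $P_4$ on four vertices. $G$ embeds into $G'$ if $G$ is isomorphic to an induced subgraph of $G'$; $G,G'$ are equimorphic if each embeds into the other. $sib(G)$ is the number of isomorphism classes of graphs equimorphic to $G$. $sib_{conn}(G)$ is the number of isomorphism classes of connected graphs equimorphic to $G$. $sib_c(G):=sib_{conn}(G)$ if $G$ is connected and $sib_c(G):=sib_{conn}(G^c)$ if $G$ is disconnected, where $G^c$ is the complement of $G$. If $H$ is a graph on a vertex set $J$ and $(L_j)_{j\in J}$ are graphs, the lexicographic sum of the $L_j$ indexed by $H$ is the graph on the disjoint union of the vertex sets of the $L_j$ in which two vertices of the same $L_j$ are adjacent iff they are adjacent in $L_j$, and $x\in L_i$, $y\in L_j$ with $i\neq j$ are adjacent iff $\{i,j\}$ is an edge of $H$. Cliques and independent sets here may be infinite. *)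

theory Defs
  imports Main "HOL-Library.Countable_Set"
begin

type_synonym 'a graph = "'a set \<times> ('a \<Rightarrow> 'a \<Rightarrow> bool)"

definition verts :: "'a graph \<Rightarrow> 'a set" where "verts G = fst G"
definition adj :: "'a graph \<Rightarrow> 'a \<Rightarrow> 'a \<Rightarrow> bool" where "adj G = snd G"

definition is_graph :: "'a graph \<Rightarrow> bool" where
  "is_graph G \<longleftrightarrow>
     (\<forall>x y. adj G x y \<longrightarrow> adj G y x) \<and>
     (\<forall>x. \<not> adj G x x) \<and>
     (\<forall>x y. adj G x y \<longrightarrow> x \<in> verts G \<and> y \<in> verts G)"

definition cograph :: "'a graph \<Rightarrow> bool" where
  "cograph G \<longleftrightarrow> is_graph G \<and>
     \<not> (\<exists>a b c d. a \<in> verts G \<and> b \<in> verts G \<and> c \<in> verts G \<and> d \<in> verts G \<and>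
           distinct [a, b, c, d] \<and>
           adj G a b \<and> adj G b c \<and> adj G c d \<and>
           \<not> adj G a c \<and> \<not> adj G a d \<and> \<not> adj G b d)"

definition embeds :: "'a graph \<Rightarrow> 'b graph \<Rightarrow> bool" where
  "embeds G G' \<longleftrightarrow> (\<exists>f. inj_on f (verts G) \<and> f ` verts G \<subseteq> verts G' \<and>
      (\<forall>x\<in>verts G. \<forall>y\<in>verts G. adj G x y \<longleftrightarrow> adj G' (f x) (f y)))"

definition isomorphic :: "'a graph \<Rightarrow> 'b graph \<Rightarrow> bool" where
  "isomorphic G G' \<longleftrightarrow> (\<exists>f. bij_betw f (verts G) (verts G') \<and>
      (\<forall>x\<in>verts G. \<forall>y\<in>verts G. adj G x y \<longleftrightarrow> adj G' (f x) (f y)))"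

definition equimorphic :: "'a graph \<Rightarrow> 'b graph \<Rightarrow> bool" where
  "equimorphic G G' \<longleftrightarrow> embeds G G' \<and> embeds G' G"

definition connected_graph :: "'a graph \<Rightarrow> bool" where
  "connected_graph G \<longleftrightarrow> (\<forall>x\<in>verts G. \<forall>y\<in>verts G. (adj G)\<^sup>*\<^sup>* x y)"

definition complement :: "'a graph \<Rightarrow> 'a graph" where
  "complement G = (verts G, \<lambda>x y. x \<in> verts G \<and> y \<in> verts G \<and> x \<noteq> y \<and> \<not> adj G x y)"

definition iso_rel :: "('b graph \<times> 'b graph) set" where
  "iso_rel = {(H, H'). isomorphic H H'}"

text \<open>sib and sib_conn, for a countable graph G.  Every graph equimorphic to G
  embeds into G, hence is countable and isomorphic to a graph whose vertex set
  is a subset of nat; so it suffices to count isomorphism classes of graphs on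
  subsets of nat.  (card of an infinite set is 0 in Isabelle; only the value 1
  matters below.)\<close>
definition sib :: "'a graph \<Rightarrow> nat" where
  "sib G = card ({H :: nat graph. is_graph H \<and> equimorphic H G} // iso_rel)"

definition sib_conn :: "'a graph \<Rightarrow> nat" where
  "sib_conn G = card ({H :: nat graph. is_graph H \<and> connected_graph H \<and> equimorphic H G} // iso_rel)"

definition sib_c :: "'a graph \<Rightarrow> nat" where
  "sib_c G = (if connected_graph G then sib_conn G else sib_conn (complement G))"

definition is_clique :: "'a graph \<Rightarrow> bool" where
  "is_clique G \<longleftrightarrow> (\<forall>x\<in>verts G. \<forall>y\<in>verts G. x \<noteq> y \<longrightarrow> adj G x y)"

definition is_independent :: "'a graph \<Rightarrow> bool" where
  "is_independent G \<longleftrightarrow> (\<forall>x\<in>verts G. \<forall>y\<in>verts G. \<not> adj G x y)"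

definition lex_sum :: "'i graph \<Rightarrow> ('i \<Rightarrow> 'v graph) \<Rightarrow> ('i \<times> 'v) graph" where
  "lex_sum H L =
     ({(j, x). j \<in> verts H \<and> x \<in> verts (L j)},
      \<lambda>(i, x) (j, y). i \<in> verts H \<and> j \<in> verts H \<and> x \<in> verts (L i) \<and> y \<in> verts (L j) \<and>
         (if i = j then adj (L i) x y else adj H i j))"

end

theory Submission
  imports Defs "HOL-Library.Infinite_Set" "HOL-Library.Nat_Bijection"
begin

text \<open>
  Countable cographs are well-quasi-ordered by embedding.  To see this, decompose a set of vertices,
  seen from one of its vertices \<open>v\<close>, into the chain of nodes that branch off along the path from \<open>v\<close>
  upwards in the cotree.  The coarsest simulation compatible with these decompositions is a
  better-quasi-order, by two applications of the minimal bad array lemma (first for chains of nodes,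
  then for the graphs themselves), and on countable cographs a simulation can be turned into an embedding.

  Call a graph rigid if it, or its complement, is connected and all its induced subgraphs that are connected
  in the same sense and equimorphic to it are isomorphic to it.  By induction along the embedding order, rigid
  graphs have finitely many classes of twins.  If a rigid graph is disconnected in the opposite sense, then its
  components are rigid, strictly smaller, and only finitely many of them are nontrivial.  Otherwise the chain
  of nodes above a vertex has no greatest element, and the well-quasi-order yields two siblings connected
  in both senses: in one of them singleton nodes of a fixed colour occur arbitrarily high above every vertex,
  in the other one this fails.  So they are not isomorphic, and this case does not occur.

  Conversely, if there are finitely many classes of twins, then a self-embedding permutes these classes, hence
  preserves the finite ones, and every sibling is isomorphic to the graph.  A graph has finitely many classes
  of twins if and only if it is a finite lexicographic sum of cliques and independent sets.
\<close>

section \<open>Better-quasi-orders\<close>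

text \<open>Well-quasi-orders alone would not do: the nodes along a path of the cotree form an
  arbitrary countable chain, possibly dense, and infinite sequences over a well-quasi-order need not
  be well-quasi-ordered. The cotree may also be ill-founded in both directions, so there is no rank
  to induct on. Taking the greatest simulation as the quasi-order avoids both obstacles: it makes
  sense for arbitrary decompositions, and descendants equivalent to the whole are replaced by marks,
  so that only strictly smaller ones have to be compared. Minimal bad arrays need these to be
  well-founded, and this is itself derived from better-quasi-ordering. In the case connected in both
  senses, the sibling in which singleton nodes recur is easy to build; the other one shapes the
  proof. A singleton node can be doubled only by borrowing a vertex from a further copy of its
  surroundings. Hence the property carried through the induction is that some finite number of
  stacked copies of a context contains one copy without singleton nodes of the fixed colour.\<close>

text \<open>Arrays are locally constant maps on the infinite subsets of an infinite set of natural numbers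
  (instead of maps on barriers).\<close>

definition subs :: "nat set \<Rightarrow> nat set set" where
  "subs A = {X. infinite X \<and> X \<subseteq> A}"

definition least :: "nat set \<Rightarrow> nat" where
  "least X = (LEAST n. n \<in> X)"

lemma least_in: "x \<in> X \<Longrightarrow> least X \<in> X"
  unfolding least_def by (rule LeastI[where P="\<lambda>n. n \<in> X"])

lemma least_le: "x \<in> X \<Longrightarrow> least X \<le> x"
  unfolding least_def by (rule Least_le)

definition shift :: "nat set \<Rightarrow> nat set" where
  "shift X = X - {least X}"

text \<open>Continuity into a discrete space: each value is decided by a finite initial segment of
  the argument. The clause \<open>infinite A\<close> excludes the empty array, which would be
  vacuously bad.\<close>

definition loc_const :: "nat set \<Rightarrow> (nat set \<Rightarrow> 'q) \<Rightarrow> bool" where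
  "loc_const A f \<longleftrightarrow> infinite A \<and>
     (\<forall>X\<in>subs A. \<exists>k. \<forall>Y\<in>subs A. Y \<inter> {..<k} = X \<inter> {..<k} \<longrightarrow> f Y = f X)"

definition bad :: "('q \<Rightarrow> 'q \<Rightarrow> bool) \<Rightarrow> nat set \<Rightarrow> (nat set \<Rightarrow> 'q) \<Rightarrow> bool" where
  "bad le A f \<longleftrightarrow> loc_const A f \<and> (\<forall>X\<in>subs A. \<not> le (f X) (f (shift X)))"

definition bqo_on :: "'q set \<Rightarrow> ('q \<Rightarrow> 'q \<Rightarrow> bool) \<Rightarrow> bool" where
  "bqo_on S le \<longleftrightarrow> \<not> (\<exists>A f. bad le A f \<and> (\<forall>X\<in>subs A. f X \<in> S))"

lemma subs_mono: "B \<subseteq> A \<Longrightarrow> X \<in> subs B \<Longrightarrow> X \<in> subs A"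
  by (auto simp: subs_def)

lemma subs_subset: "X \<in> subs A \<Longrightarrow> X \<subseteq> A" and subs_infinite: "X \<in> subs A \<Longrightarrow> infinite X"
  by (auto simp: subs_def)

lemma self_subs: "infinite A \<Longrightarrow> A \<in> subs A"
  by (auto simp: subs_def)

lemma shift_subs: "X \<in> subs A \<Longrightarrow> shift X \<in> subs A"
  by (auto simp: subs_def shift_def)

lemma infinite_nonempty: "infinite (X :: nat set) \<Longrightarrow> \<exists>x. x \<in> X"
  by (metis finite.emptyI ex_in_conv)

lemma infinite_above: "infinite (X :: nat set) \<Longrightarrow> \<exists>x\<in>X. k \<le> x"
  by (meson infinite_nat_iff_unbounded_le)

lemma loc_const_mono:
  assumes "loc_const A f" "B \<in> subs A" shows "loc_const B f"
proof -
  have "X \<in> subs A" if "X \<in> subs B" for X using assms(2) that by (auto simp: subs_def)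
  then show ?thesis
    using assms unfolding loc_const_def by (meson subs_infinite)
qed

lemma bqo_on_subset: "bqo_on S le \<Longrightarrow> T \<subseteq> S \<Longrightarrow> bqo_on T le"
  unfolding bqo_on_def by blast

lemma loc_const_comp: "loc_const A f \<Longrightarrow> loc_const A (\<lambda>X. g (f X))"
  unfolding loc_const_def by metis

lemma agree_mono:
  assumes "Y \<inter> {..<k} = X \<inter> {..<k}" "l \<le> (k::nat)"
  shows "Y \<inter> {..<l} = X \<inter> {..<l}"
proof -
  have "Z \<inter> {..<l} = (Z \<inter> {..<k}) \<inter> {..<l}" for Z :: "nat set" using assms(2) by auto
  then show ?thesis using assms(1) by metis
qed

lemma loc_const_Pair:
  assumes f: "loc_const A f" and g: "loc_const A g"
  shows "loc_const A (\<lambda>X. (f X, g X))"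
  unfolding loc_const_def
proof (intro conjI ballI)
  show "infinite A" using f by (simp add: loc_const_def)
  fix X assume X: "X \<in> subs A"
  obtain k where k: "\<forall>Y\<in>subs A. Y \<inter> {..<k} = X \<inter> {..<k} \<longrightarrow> f Y = f X"
    using f X unfolding loc_const_def by blast
  obtain l where l: "\<forall>Y\<in>subs A. Y \<inter> {..<l} = X \<inter> {..<l} \<longrightarrow> g Y = g X"
    using g X unfolding loc_const_def by blast
  show "\<exists>k. \<forall>Y\<in>subs A. Y \<inter> {..<k} = X \<inter> {..<k} \<longrightarrow> (f Y, g Y) = (f X, g X)"
  proof (intro exI[of _ "max k l"] ballI impI)
    fix Y assume Y: "Y \<in> subs A" "Y \<inter> {..<max k l} = X \<inter> {..<max k l}"
    have "f Y = f X" using k Y agree_mono[OF Y(2), of k] by simp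
    moreover have "g Y = g X" using l Y agree_mono[OF Y(2), of l] by simp
    ultimately show "(f Y, g Y) = (f X, g X)" by simp
  qed
qed

lemma least_agree:
  assumes "Y \<inter> {..<k} = X \<inter> {..<(k::nat)}" "x \<in> X" "x < k"
  shows "least Y = least X"
proof -
  have "least X \<in> X" by (rule least_in[OF assms(2)])
  moreover have le: "least X \<le> x" by (rule least_le[OF assms(2)])
  moreover note assms(3)
  ultimately have a: "least X \<in> Y" using assms(1) by (auto dest: le_less_trans)
  have "least X \<le> y" if y: "y \<in> Y" for y
  proof -
    show ?thesis
    proof (cases "y < k")
      case True then have "y \<in> X" using assms y by auto
      then show ?thesis by (rule least_le)
    next
      case False then show ?thesis using le assms(3) by linarith
    qed
  qed
  then show ?thesis using least_in[OF a] least_le[OF a] by (metis le_antisym)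
qed

lemma loc_const_sh:
  assumes f: "loc_const A f" shows "loc_const A (\<lambda>X. f (shift X))"
  unfolding loc_const_def
proof (intro conjI ballI)
  show "infinite A" using f by (simp add: loc_const_def)
  fix X assume X: "X \<in> subs A"
  obtain k where k: "\<forall>Y\<in>subs A. Y \<inter> {..<k} = shift X \<inter> {..<k} \<longrightarrow> f Y = f (shift X)"
    using f shift_subs[OF X] unfolding loc_const_def by blast
  obtain x where x: "x \<in> X" using X subs_infinite infinite_nonempty by blast
  show "\<exists>k. \<forall>Y\<in>subs A. Y \<inter> {..<k} = X \<inter> {..<k} \<longrightarrow> f (shift Y) = f (shift X)"
  proof (intro exI[of _ "max k (Suc x)"] ballI impI)
    fix Y assume Y: "Y \<in> subs A" "Y \<inter> {..<max k (Suc x)} = X \<inter> {..<max k (Suc x)}"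
    have "least Y = least X"
      by (rule least_agree[OF Y(2) x]) simp
    then have "shift Y \<inter> {..<k} = shift X \<inter> {..<k}"
      using agree_mono[OF Y(2), of k] unfolding shift_def by auto
    then show "f (shift Y) = f (shift X)" using k shift_subs[OF Y(1)] by blast
  qed
qed

lemma loc_const_pair_sh: "loc_const A f \<Longrightarrow> loc_const A (\<lambda>X. g (f X) (f (shift X)))"
  using loc_const_comp[OF loc_const_Pair[OF _ loc_const_sh], of A f f "\<lambda>(x,y). g x y"] by simp

text \<open>Turns a sequence into an array that looks only at the least element. In this way a
  better-quasi-order is seen to have no bad sequences.\<close>

lemma loc_const_mn: "infinite A \<Longrightarrow> loc_const A (\<lambda>X. p (least X))"
  unfolding loc_const_def
proof (intro conjI ballI)
  fix X assume X: "X \<in> subs A"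
  obtain x where x: "x \<in> X" using X subs_infinite infinite_nonempty by blast
  show "\<exists>k. \<forall>Y\<in>subs A. Y \<inter> {..<k} = X \<inter> {..<k} \<longrightarrow> p (least Y) = p (least X)"
    by (intro exI[of _ "Suc x"] ballI impI) (metis least_agree x lessI)
qed

section \<open>Ramsey's theorem for locally constant colourings\<close>

text \<open>A basic neighbourhood of the Ellentuck topology: \<open>s\<close> is an initial segment
  and the remaining elements are drawn from \<open>B\<close>.\<close>

definition cylinder :: "nat set \<Rightarrow> nat set \<Rightarrow> nat set set" where
  "cylinder s B = {s \<union> Y |Y. infinite Y \<and> Y \<subseteq> B \<and> (\<forall>y\<in>Y. \<forall>x\<in>s. x < y)}"

lemma cylinder_mono: "B \<subseteq> A \<Longrightarrow> X \<in> cylinder s B \<Longrightarrow> X \<in> cylinder s A"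
  unfolding cylinder_def by blast

lemma cylinder_split:
  assumes X: "X \<in> cylinder s B"
  obtains n where "n \<in> B" "\<forall>x\<in>s. x < n" "X \<in> cylinder (insert n s) (B \<inter> {n<..})"
proof -
  obtain Y where Y: "X = s \<union> Y" "infinite Y" "Y \<subseteq> B" "\<forall>y\<in>Y. \<forall>x\<in>s. x < y"
    using X unfolding cylinder_def by blast
  define n where "n = least Y"
  have n: "n \<in> Y" "\<And>y. y \<in> Y \<Longrightarrow> n \<le> y"
    unfolding n_def using infinite_nonempty[OF Y(2)] by (auto intro: least_in least_le)
  have "X = insert n s \<union> (Y - {n})" using Y n by auto
  moreover have "infinite (Y - {n})" using Y by simp
  moreover have "Y - {n} \<subseteq> B \<inter> {n<..}" using Y n by (force simp: le_less)
  moreover have "\<forall>y\<in>Y-{n}. \<forall>x\<in>insert n s. x < y" using Y n by (auto simp: le_less)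
  ultimately have "X \<in> cylinder (insert n s) (B \<inter> {n<..})" unfolding cylinder_def by blast
  then show thesis using that n Y by blast
qed

text \<open>Fusion. Points \<open>n i\<close> and shrinking sets \<open>B i\<close> are chosen so
  that the colour is constant once the point following \<open>s\<close> is known to be
  \<open>n i\<close> and the rest lies in \<open>B i\<close>. The points sharing one of the two
  colours then form a set that works for \<open>s\<close>.\<close>

lemma const_step:
  assumes A: "infinite A" and fs: "finite s"
    and IH: "\<And>n A'. n \<in> A \<Longrightarrow> \<forall>x\<in>s. x < n \<Longrightarrow> A' \<in> subs A \<Longrightarrow>
               \<exists>B\<in>subs A'. \<exists>c. \<forall>X\<in>cylinder (insert n s) B. P X = c"
    and A0: "A0 \<in> subs A"
  shows "\<exists>B\<in>subs A0. \<exists>c. \<forall>X\<in>cylinder s B. P X = (c::bool)"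
proof -
  define Q where "Q = (\<lambda>(n, B, c). n \<in> A0 \<and> (\<forall>x\<in>s. x < n) \<and> B \<in> subs A0 \<and> (\<forall>b\<in>B. n < b) \<and>
      (\<forall>X\<in>cylinder (insert n s) B. P X = c))"
  have step: "\<exists>t'. Q t' \<and> fst t' \<in> D \<and> fst (snd t') \<subseteq> D" if D: "D \<in> subs A0" for D
  proof -
    obtain n where n: "n \<in> D" "\<forall>x\<in>s. x < n"
    proof -
      obtain n where "n \<in> D" "Suc (Max (insert 0 s)) \<le> n"
        using infinite_above[OF subs_infinite[OF D]] by blast
      then show thesis using that fs by (metis Max_ge Suc_le_lessD finite_insert insertI2 le_less_trans)
    qed
    have "D \<inter> {n<..} \<in> subs A"
    proof -
      have "D = (D \<inter> {n<..}) \<union> (D \<inter> {..n})" by auto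
      then have "infinite (D \<inter> {n<..})"
        using subs_infinite[OF D] by (metis finite_Int finite_UnI finite_atMost)
      then show ?thesis using subs_subset[OF D] subs_subset[OF A0] by (auto simp: subs_def)
    qed
    moreover have nA: "n \<in> A0" "n \<in> A" using n D A0 by (auto simp: subs_def)
    ultimately obtain B c where B: "B \<in> subs (D \<inter> {n<..})" and Bc: "\<forall>X\<in>cylinder (insert n s) B. P X = c"
      using IH[of n "D \<inter> {n<..}"] n(2) by blast
    have BD: "B \<subseteq> D" "B \<in> subs A0" "\<forall>b\<in>B. n < b" using B D by (auto simp: subs_def)
    have "Q (n, B, c)" unfolding Q_def using nA n(2) BD Bc by simp
    then show ?thesis using n BD by (intro exI[of _ "(n,B,c)"]) simp
  qed
  obtain h where h: "\<And>i. Q (h i)"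
      "\<And>i. fst (h (Suc i)) \<in> fst (snd (h i)) \<and> fst (snd (h (Suc i))) \<subseteq> fst (snd (h i))"
  proof -
    have "\<exists>t. Q t" using step[OF self_subs[OF subs_infinite[OF A0]]] by blast
    moreover have "\<exists>t'. Q t' \<and> fst t' \<in> fst (snd t) \<and> fst (snd t') \<subseteq> fst (snd t)" if "Q t" for t
      using step[of "fst (snd t)"] that unfolding Q_def by (cases t) auto
    ultimately show thesis
      using that dependent_nat_choice[where P="\<lambda>_. Q" and
        Q="\<lambda>_ t t'. fst t' \<in> fst (snd t) \<and> fst (snd t') \<subseteq> fst (snd t)"] by metis
  qed
  define n where "n = (\<lambda>i. fst (h i))"
  define B where "B = (\<lambda>i. fst (snd (h i)))"
  define c where "c = (\<lambda>i. snd (snd (h i)))"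
  have q: "n i \<in> A0" "\<forall>x\<in>s. x < n i" "\<forall>b\<in>B i. n i < b" "\<forall>X\<in>cylinder (insert (n i) s) (B i). P X = c i" for i
    using h(1)[of i] unfolding Q_def n_def B_def c_def by (auto split: prod.splits)
  have nB: "n (Suc i) \<in> B i" "B (Suc i) \<subseteq> B i" for i
    using h(2)[of i] unfolding n_def B_def by auto
  have Bmono: "i \<le> j \<Longrightarrow> B j \<subseteq> B i" for i j
    using nB(2) by (rule lift_Suc_antimono_le)
  have nBj: "i < j \<Longrightarrow> n j \<in> B i" for i j
  proof -
    assume "i < j"
    then obtain j' where "j = Suc j'" "i \<le> j'" by (cases j) auto
    then show "n j \<in> B i" using nB(1)[of j'] Bmono[of i j'] by auto
  qed
  then have nmono: "i < j \<Longrightarrow> n i < n j" for i j using q(3) by blast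
  then have injn: "inj n" by (metis injI linorder_neqE_nat less_irrefl)
  obtain d where d: "infinite {i. c i = d}"
    using finite_Collect_disjI[of "\<lambda>i. c i = True" "\<lambda>i. c i = False"] by fastforce
  define B' where "B' = n ` {i. c i = d}"
  have "B' \<in> subs A0"
    unfolding subs_def B'_def using d injn q(1) by (auto simp: finite_image_iff inj_on_subset)
  moreover have "P X = d" if X: "X \<in> cylinder s B'" for X
  proof -
    obtain m where m: "m \<in> B'" "X \<in> cylinder (insert m s) (B' \<inter> {m<..})"
      using cylinder_split[OF X] by metis
    then obtain i where i: "m = n i" "c i = d" unfolding B'_def by auto
    have "B' \<inter> {m<..} \<subseteq> B i"
    proof
      fix y assume "y \<in> B' \<inter> {m<..}"
      then obtain j where j: "y = n j" "n i < n j" unfolding B'_def i by auto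
      then have "i < j" using nmono by (metis less_asym linorder_neqE_nat)
      then show "y \<in> B i" using nBj j by simp
    qed
    then show ?thesis using q(4)[of i] m(2) i cylinder_mono by metis
  qed
  ultimately show ?thesis by blast
qed

text \<open>The argument of Nash-Williams: without a homogeneous set, \<open>const_step\<close>
  allows an undecided finite set to be extended for ever by undecided ones, and the infinite set so
  obtained contradicts local constancy at itself.\<close>

theorem ramsey_cont:
  assumes f: "loc_const A (P :: nat set \<Rightarrow> bool)"
  shows "\<exists>B\<in>subs A. \<exists>c. \<forall>X\<in>subs B. P X = c"
proof (rule ccontr)
  assume neg: "\<not> ?thesis"
  define H where "H = (\<lambda>s. \<forall>A'\<in>subs A. \<exists>B\<in>subs A'. \<exists>c. \<forall>X\<in>cylinder s B. P X = c)"
  have A: "infinite A" using f by (simp add: loc_const_def)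
  have cyl0: "cylinder {} B = subs B" for B unfolding cylinder_def subs_def by auto
  have H0: "\<not> H {}"
    using neg self_subs[OF A] unfolding H_def cyl0 by blast
  have ext: "\<exists>n. n \<in> A \<and> (\<forall>x\<in>s. x < n) \<and> \<not> H (insert n s)" if s: "finite s" "\<not> H s" for s
  proof (rule ccontr)
    assume n: "\<not> ?thesis"
    have "\<exists>B\<in>subs A0. \<exists>c. \<forall>X\<in>cylinder s B. P X = c" if "A0 \<in> subs A" for A0
      by (rule const_step[OF A s(1) _ that]) (use n in \<open>auto simp: H_def\<close>)
    then show False using s(2) unfolding H_def by blast
  qed
  have "\<exists>t. \<forall>i. (finite (t i) \<and> t i \<subseteq> A \<and> \<not> H (t i)) \<and>
          (\<exists>n. n \<in> A \<and> (\<forall>x\<in>t i. x < n) \<and> t (Suc i) = insert n (t i))"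
  proof (rule dependent_nat_choice)
    show "\<exists>x. finite x \<and> x \<subseteq> A \<and> \<not> H x" using H0 by blast
    show "\<exists>y. (finite y \<and> y \<subseteq> A \<and> \<not> H y) \<and> (\<exists>n. n \<in> A \<and> (\<forall>x\<in>s. x < n) \<and> y = insert n s)"
      if s: "finite s \<and> s \<subseteq> A \<and> \<not> H s" for s and i :: nat
    proof -
      obtain n where "n \<in> A" "\<forall>x\<in>s. x < n" "\<not> H (insert n s)" using ext[of s] s by blast
      then show ?thesis using s by (intro exI[of _ "insert n s"]) auto
    qed
  qed
  then obtain t where t0: "\<forall>i. (finite (t i) \<and> t i \<subseteq> A \<and> \<not> H (t i)) \<and>
          (\<exists>n. n \<in> A \<and> (\<forall>x\<in>t i. x < n) \<and> t (Suc i) = insert n (t i))" by (rule exE)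
  then have t: "t i \<subseteq> A" "\<not> H (t i)" for i by simp_all
  have "\<forall>i. \<exists>n. n \<in> A \<and> (\<forall>x\<in>t i. x < n) \<and> t (Suc i) = insert n (t i)"
    using t0 by simp
  then obtain n where n0: "\<forall>i. n i \<in> A \<and> (\<forall>x\<in>t i. x < n i) \<and> t (Suc i) = insert (n i) (t i)"
    by (rule choice[THEN exE])
  then have n: "n i \<in> A" "x \<in> t i \<Longrightarrow> x < n i" "t (Suc i) = insert (n i) (t i)" for i x
    by simp_all
  define X where "X = (\<Union>i. t i)"
  have tS: "t i \<subseteq> t (Suc i)" for i unfolding n(3) by auto
  have tmono: "i \<le> j \<Longrightarrow> t i \<subseteq> t j" for i j
    by (rule lift_Suc_mono_le[of t, OF tS])
  have nin: "n i \<in> t (Suc i)" for i unfolding n(3) by simp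
  have nlt: "i < j \<Longrightarrow> n i < n j" for i j
    using n(2)[of "n i" j] tmono[of "Suc i" j] nin[of i] by (meson Suc_leI subsetD)
  have late: "x \<in> t i \<or> n i \<le> x" if x: "x \<in> X" for x i
  proof -
    obtain j where j: "x \<in> t j" using x unfolding X_def by auto
    have "x \<in> t k \<Longrightarrow> x \<in> t i \<or> n i \<le> x" for k
    proof (induction k)
      case 0 then show ?case using tmono[of 0 i] by auto
    next
      case (Suc k)
      show ?case
      proof (cases "x = n k")
        case True
        show ?thesis
        proof (cases "i \<le> k")
          case True then show ?thesis using nlt[of i k] \<open>x = n k\<close> by (cases "i = k") auto
        next
          case False then show ?thesis using tmono[of "Suc k" i] Suc.prems by auto
        qed
      next
        case False then show ?thesis using Suc unfolding n(3) by simp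
      qed
    qed
    then show ?thesis using j by blast
  qed
  have ni: "i \<le> n i" for i
  proof (induction i)
    case (Suc i) then show ?case using nlt[of i "Suc i"] by simp
  qed simp
  have "infinite X"
    unfolding infinite_nat_iff_unbounded_le
  proof
    fix i show "\<exists>m\<ge>i. m \<in> X" using ni[of i] nin[of i] unfolding X_def by blast
  qed
  then have X: "X \<in> subs A" unfolding subs_def X_def using t(1) by auto
  then obtain k where k: "\<forall>Y\<in>subs A. Y \<inter> {..<k} = X \<inter> {..<k} \<longrightarrow> P Y = P X"
    using f unfolding loc_const_def by blast
  \<comment> \<open>Since \<open>i \<le> n i\<close>, all elements of \<open>X\<close> below
    \<open>k\<close> already lie in \<open>t (Suc k)\<close>. So every member of its cylinder agrees
    with \<open>X\<close> below \<open>k\<close> and has the colour of \<open>X\<close>.\<close>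
  have "H (t (Suc k))"
    unfolding H_def
  proof (intro ballI)
    fix A' assume A': "A' \<in> subs A"
    have "P Y = P X" if Y: "Y \<in> cylinder (t (Suc k)) A'" for Y
    proof -
      obtain Z where Z: "Y = t (Suc k) \<union> Z" "infinite Z" "Z \<subseteq> A'" "\<forall>y\<in>Z. \<forall>x\<in>t (Suc k). x < y"
        using Y unfolding cylinder_def by blast
      have "Y \<in> subs A" using Z t(1) A' unfolding subs_def by auto
      moreover have "y \<ge> k" if "y \<in> Z" for y
        using Z(4) that nin[of k] ni[of k] by (meson less_imp_le le_trans)
      then have "Y \<inter> {..<k} = t (Suc k) \<inter> {..<k}" using Z(1) by force
      moreover have "X \<inter> {..<k} = t (Suc k) \<inter> {..<k}"
      proof -
        have "x \<in> t (Suc k)" if "x \<in> X" "x < k" for x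
          using late[OF that(1), of "Suc k"] ni[of "Suc k"] that(2) by auto
        then show ?thesis unfolding X_def by blast
      qed
      ultimately show ?thesis using k by metis
    qed
    then show "\<exists>B\<in>subs A'. \<exists>c. \<forall>X\<in>cylinder (t (Suc k)) B. P X = c"
      using self_subs[of A'] A' subs_infinite by blast
  qed
  then show False using t(2) by blast
qed

section \<open>Minimal bad arrays\<close>

text \<open>The stem \<open>X \<inter> {..<m X}\<close> decides both \<open>f\<close> and
  \<open>m\<close>, so the stems form a front. Taking \<open>m X\<close> to be the successor of an
  element of \<open>X\<close> makes every stem end in such an element, which later identifies the
  stage of the construction that fixed it.\<close>

definition modulus_array :: "nat set \<Rightarrow> (nat set \<Rightarrow> 'q) \<Rightarrow> (nat set \<Rightarrow> nat) \<Rightarrow> bool" where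
  "modulus_array A f m \<longleftrightarrow> infinite A \<and> (\<forall>X\<in>subs A. m X \<in> Suc ` X \<and>
     (\<forall>Y\<in>subs A. Y \<inter> {..<m X} = X \<inter> {..<m X} \<longrightarrow> f Y = f X \<and> m Y = m X))"

definition next_elem :: "nat set \<Rightarrow> nat \<Rightarrow> nat" where
  "next_elem X l = least (X \<inter> {l..})"

lemma next_elem_in: "infinite X \<Longrightarrow> next_elem X l \<in> X \<and> l \<le> next_elem X l"
  unfolding next_elem_def using least_in[of _ "X \<inter> {l..}"] infinite_above[of X l] by fastforce

lemma next_elem_le: "x \<in> X \<Longrightarrow> l \<le> x \<Longrightarrow> next_elem X l \<le> x"
  unfolding next_elem_def by (rule least_le) simp

lemma next_elem_agree:
  assumes "infinite X" "Y \<inter> {..<Suc (next_elem X l)} = X \<inter> {..<Suc (next_elem X l)}"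
  shows "next_elem Y l = next_elem X l"
proof -
  have "(Y \<inter> {l..}) \<inter> {..<Suc (next_elem X l)} = (X \<inter> {l..}) \<inter> {..<Suc (next_elem X l)}"
    using assms(2) by blast
  moreover have "next_elem X l \<in> X \<inter> {l..}" using next_elem_in[OF assms(1)] by simp
  ultimately show ?thesis
    unfolding next_elem_def[of Y] next_elem_def[of X l, symmetric] 
    using least_agree[of "Y \<inter> {l..}" "Suc (next_elem X l)" "X \<inter> {l..}" "next_elem X l"] 
    by (simp add: next_elem_def)
qed

lemma modulus_array_cont: "modulus_array A f m \<Longrightarrow> loc_const A f"
  unfolding modulus_array_def loc_const_def by blast

text \<open>The least modulus is itself decided by the segment it cuts off. Rounding it up to the
  next element of the set keeps this property and makes the stem end in an element.\<close>

lemma loc_const_arr: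
  assumes f: "loc_const A f" shows "\<exists>m. modulus_array A f m"
proof -
  define P where "P = (\<lambda>X k. \<forall>Y\<in>subs A. Y \<inter> {..<k} = X \<inter> {..<k} \<longrightarrow> f Y = f X)"
  define m0 where "m0 = (\<lambda>X. LEAST k. P X k)"
  have inf: "infinite A" using f by (simp add: loc_const_def)
  have P: "P X (m0 X)" if X: "X \<in> subs A" for X
  proof -
    have "\<exists>k. P X k" using f X unfolding loc_const_def P_def by blast
    then show ?thesis unfolding m0_def by (rule LeastI_ex)
  qed
  have fY: "f Y = f X" if "X \<in> subs A" "Y \<in> subs A" "Y \<inter> {..<m0 X} = X \<inter> {..<m0 X}" for X Y
    using P[OF that(1)] that unfolding P_def by blast
  have le: "m0 Y \<le> m0 X" if X: "X \<in> subs A" "Y \<in> subs A" "Y \<inter> {..<m0 X} = X \<inter> {..<m0 X}" for X Y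
  proof -
    have "P Y (m0 X)" using P[OF X(1)] fY[OF X] X(3) unfolding P_def by metis
    then show ?thesis unfolding m0_def by (rule Least_le)
  qed
  have eq: "m0 Y = m0 X" if X: "X \<in> subs A" "Y \<in> subs A" "Y \<inter> {..<m0 X} = X \<inter> {..<m0 X}" for X Y
  proof (rule le_antisym[OF le[OF X]])
    have "X \<inter> {..<m0 Y} = Y \<inter> {..<m0 Y}"
      using agree_mono[OF X(3) le[OF X]] by simp
    then show "m0 X \<le> m0 Y" by (rule le[OF X(2,1)])
  qed
  define m where "m = (\<lambda>X. Suc (next_elem X (m0 X)))"
  have "modulus_array A f m"
    unfolding modulus_array_def
  proof (intro conjI ballI impI inf)
    fix X assume X: "X \<in> subs A"
    note nx = next_elem_in[OF subs_infinite[OF X], of "m0 X"]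
    show "m X \<in> Suc ` X" using nx unfolding m_def by blast
    fix Y assume Y: "Y \<in> subs A" "Y \<inter> {..<m X} = X \<inter> {..<m X}"
    have a: "Y \<inter> {..<m0 X} = X \<inter> {..<m0 X}"
      by (rule agree_mono[OF Y(2)]) (use nx in \<open>simp add: m_def\<close>)
    show "f Y = f X" using fY[OF X Y(1) a] .
    have "next_elem Y (m0 X) = next_elem X (m0 X)"
      by (rule next_elem_agree[OF subs_infinite[OF X]]) (use Y(2) in \<open>simp only: m_def\<close>)
    then show "m Y = m X" using eq[OF X Y(1) a] unfolding m_def by simp
  qed
  then show ?thesis by blast
qed

definition stems :: "(nat set \<Rightarrow> nat) \<Rightarrow> nat set \<Rightarrow> nat \<Rightarrow> nat set set" where
  "stems m B k = {X \<inter> {..<m X} |X. X \<in> subs B \<and> m X \<le> k}"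

lemma stems_subset: "stems m B k \<subseteq> Pow {..<k}"
  unfolding stems_def by auto

lemma finite_stems: "finite (stems m B k)"
  by (rule finite_subset[OF stems_subset]) simp

definition competitor :: "('q \<Rightarrow> 'q \<Rightarrow> bool) \<Rightarrow> nat \<Rightarrow> (nat set \<Rightarrow> 'q) \<Rightarrow> (nat set \<Rightarrow> nat) \<Rightarrow> nat set \<Rightarrow>
    (nat set \<Rightarrow> 'q) \<Rightarrow> (nat set \<Rightarrow> nat) \<Rightarrow> nat set \<Rightarrow> bool" where
  "competitor r k g m' B f m A \<longleftrightarrow> B \<subseteq> A \<and> B \<inter> {..<k} = A \<inter> {..<k} \<and>
     (\<forall>X\<in>subs B. g X = f X \<and> m' X = m X \<or> r (g X) (f X) \<and> k < m' X)"

lemma competitor_refl: "competitor r k f m A f m A"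
  unfolding competitor_def by simp

lemma competitor_trans:
  assumes r: "transp r" and 1: "competitor r k h m'' C g m' B" and 2: "competitor r k' g m' B f m A" and k: "k' \<le> k"
  shows "competitor r k' h m'' C f m A"
  unfolding competitor_def
proof (intro conjI ballI)
  show "C \<subseteq> A" using 1 2 unfolding competitor_def by blast
  have "C \<inter> {..<k'} = B \<inter> {..<k'}"
    by (rule agree_mono[OF _ k]) (use 1 in \<open>simp add: competitor_def\<close>)
  then show "C \<inter> {..<k'} = A \<inter> {..<k'}" using 2 by (simp add: competitor_def)
  fix X assume X: "X \<in> subs C"
  then have X': "X \<in> subs B" using 1 subs_mono unfolding competitor_def by blast
  have "h X = g X \<and> m'' X = m' X \<or> r (h X) (g X) \<and> k < m'' X" using 1 X unfolding competitor_def by blast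
  moreover have "g X = f X \<and> m' X = m X \<or> r (g X) (f X) \<and> k' < m' X" using 2 X' unfolding competitor_def by blast
  ultimately show "h X = f X \<and> m'' X = m X \<or> r (h X) (f X) \<and> k' < m'' X"
    using k transpD[OF r, of "h X" "g X" "f X"] by auto
qed

lemma stems_cmp:
  assumes "competitor r k g m' B f m A" shows "stems m' B k \<subseteq> stems m A k"
proof
  fix s assume "s \<in> stems m' B k"
  then obtain X where X: "s = X \<inter> {..<m' X}" "X \<in> subs B" "m' X \<le> k" unfolding stems_def by blast
  then have "m' X = m X" using assms unfolding competitor_def by fastforce
  moreover have "X \<in> subs A" using assms X subs_mono unfolding competitor_def by blast
  ultimately show "s \<in> stems m A k" using X unfolding stems_def by force
qed

locale minimal_bad =
  fixes le r :: "'q \<Rightarrow> 'q \<Rightarrow> bool"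
  assumes le_trans: "transp le" and r_trans: "transp r" and r_le: "r a b \<Longrightarrow> le a b" and wf_r: "wfP r"
begin

definition ok where "ok f m A \<longleftrightarrow> modulus_array A f m \<and> bad le A f"

text \<open>A competitor may alter an array only where it lowers the value and lengthens the stem beyond
  \<open>k\<close>; a stage of the construction destroys as many stems of length at most \<open>k\<close> as possible.\<close>

definition stage where
  "stage s s' \<longleftrightarrow> (case s of (f, m, A, k) \<Rightarrow> case s' of (g, m', B, k') \<Rightarrow>
     k' = Suc (next_elem A k) \<and> ok g m' B \<and> competitor r k' g m' B f m A \<and>
     (\<forall>h m'' C. ok h m'' C \<longrightarrow> competitor r k' h m'' C f m A \<longrightarrow> card (stems m' B k') \<le> card (stems m'' C k')))"

lemma stage_ex:
  assumes "ok f m A" shows "\<exists>g m' B k'. stage (f, m, A, k) (g, m', B, k')"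
proof -
  define k' where "k' = Suc (next_elem A k)"
  have "\<exists>t. (case t of (g, m', B) \<Rightarrow> ok g m' B \<and> competitor r k' g m' B f m A) \<and>
     (\<forall>t'. (case t' of (g, m', B) \<Rightarrow> ok g m' B \<and> competitor r k' g m' B f m A) \<longrightarrow>
        (case t of (g, m', B) \<Rightarrow> card (stems m' B k')) \<le> (case t' of (g, m', B) \<Rightarrow> card (stems m' B k')))"
    by (rule ex_has_least_nat[of _ "(f, m, A)"]) (use assms competitor_refl in auto)
  then show ?thesis unfolding stage_def k'_def by (simp split: prod.splits) blast
qed

text \<open>Each stage fixes one more element of the domain and can only destroy short stems, never
  create them. The domains converge to an infinite set \<open>I\<close>, and well-foundedness of
  \<open>r\<close> makes every value stabilise. A bad array strictly below the limit could be
  spliced in at some stage, where it would remove one more short stem than the minimal count of that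
  stage allows.\<close>

theorem minimal_bad_array:
  assumes "bad le A0 f0"
  shows "\<exists>B\<in>subs A0. \<exists>g. bad le B g \<and> (\<forall>X\<in>subs B. g X = f0 X \<or> r (g X) (f0 X)) \<and>
    \<not> (\<exists>C\<in>subs B. \<exists>h. bad le C h \<and> (\<forall>X\<in>subs C. r (h X) (g X)))"
proof -
  obtain m0 where m0: "ok f0 m0 A0"
    using assms loc_const_arr unfolding bad_def ok_def by blast
  define okS where "okS = (\<lambda>s. case s of (f, m, A, k::nat) \<Rightarrow> ok f m A)"
  have "\<exists>s. \<forall>n. okS (s n) \<and> (n = 0 \<longrightarrow> s n = (f0, m0, A0, 0)) \<and> stage (s n) (s (Suc n))"
  proof -
    have "\<exists>s. \<forall>n. (okS (s n) \<and> (n = 0 \<longrightarrow> s n = (f0, m0, A0, 0))) \<and> stage (s n) (s (Suc n))"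
    proof (rule dependent_nat_choice)
      show "\<exists>x. okS x \<and> ((0::nat) = 0 \<longrightarrow> x = (f0, m0, A0, 0))" using m0 unfolding okS_def by auto
      show "\<exists>y. (okS y \<and> (Suc n = 0 \<longrightarrow> y = (f0, m0, A0, 0))) \<and> stage x y"
        if okx: "okS x \<and> (n = 0 \<longrightarrow> x = (f0, m0, A0, 0))" for x n
      proof -
        obtain f m A k where x: "x = (f, m, A, k)" by (cases x)
        obtain g m' B k' where st: "stage x (g, m', B, k')"
          using stage_ex[of f m A k] okx unfolding x okS_def by auto
        then have "okS (g, m', B, k')" unfolding stage_def okS_def x by simp
        then show ?thesis using st by blast
      qed
    qed
    then show ?thesis by simp
  qed
  then obtain s where s: "\<forall>n. okS (s n) \<and> (n = 0 \<longrightarrow> s n = (f0, m0, A0, 0)) \<and> stage (s n) (s (Suc n))"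
    by (rule exE)
  define F where "F = (\<lambda>n. fst (s n))"
  define M where "M = (\<lambda>n. fst (snd (s n)))"
  define A where "A = (\<lambda>n. fst (snd (snd (s n))))"
  define K where "K = (\<lambda>n. snd (snd (snd (s n))))"
  have sn: "s n = (F n, M n, A n, K n)" for n unfolding F_def M_def A_def K_def by simp
  have ok: "ok (F n) (M n) (A n)" for n using s unfolding okS_def sn by simp
  then have arrn: "modulus_array (A n) (F n) (M n)" and badn: "bad le (A n) (F n)" for n
    unfolding ok_def by auto
  have infA: "infinite (A n)" for n using arrn unfolding modulus_array_def by blast
  have s0: "F 0 = f0" "M 0 = m0" "A 0 = A0" "K 0 = 0" using s sn[of 0] by simp_all
  have stg: "K (Suc n) = Suc (next_elem (A n) (K n)) \<and>
      competitor r (K (Suc n)) (F (Suc n)) (M (Suc n)) (A (Suc n)) (F n) (M n) (A n) \<and>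
      (\<forall>h m'' C. ok h m'' C \<longrightarrow> competitor r (K (Suc n)) h m'' C (F n) (M n) (A n) \<longrightarrow>
         card (stems (M (Suc n)) (A (Suc n)) (K (Suc n))) \<le> card (stems m'' C (K (Suc n))))" for n
  proof -
    have "stage (F n, M n, A n, K n) (F (Suc n), M (Suc n), A (Suc n), K (Suc n))"
      using s unfolding sn by blast
    then show ?thesis unfolding stage_def prod.case by blast
  qed
  have KS: "K (Suc n) = Suc (next_elem (A n) (K n))" for n using stg[of n] by blast
  have cmpS: "competitor r (K (Suc n)) (F (Suc n)) (M (Suc n)) (A (Suc n)) (F n) (M n) (A n)" for n
    using stg[of n] by blast
  have minS: "card (stems (M (Suc n)) (A (Suc n)) (K (Suc n))) \<le> card (stems m'' C (K (Suc n)))"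
    if "ok h m'' C" "competitor r (K (Suc n)) h m'' C (F n) (M n) (A n)" for n h m'' C
    using stg[of n] that by blast
  have Klt: "K n < K (Suc n)" for n unfolding KS using next_elem_in[OF infA] le_imp_less_Suc by blast
  have Kmono: "n \<le> l \<Longrightarrow> K n \<le> K l" for n l
    by (rule lift_Suc_mono_le[of K]) (use Klt less_imp_le in blast)
  have cmpn: "competitor r (K (Suc n)) (F (Suc n + l)) (M (Suc n + l)) (A (Suc n + l)) (F n) (M n) (A n)" for n l
  proof (induction l)
    case 0 then show ?case using cmpS[of n] by simp
  next
    case (Suc l)
    show ?case
      using competitor_trans[OF r_trans cmpS[of "Suc n + l"] Suc] Kmono[of "Suc n" "Suc (Suc n + l)"] by simp
  qed
  have cmpnl: "competitor r (K (Suc n)) (F l) (M l) (A l) (F n) (M n) (A n)" if "n \<le> l" for n l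
    using cmpn[of n "l - Suc n"] that competitor_refl by (cases "n = l") auto
  have Aanti: "n \<le> l \<Longrightarrow> A l \<subseteq> A n" for n l using cmpnl unfolding competitor_def by blast
  have Afix: "A l \<inter> {..<K (Suc n)} = A n \<inter> {..<K (Suc n)}" if "n \<le> l" for n l
    using cmpnl[OF that] unfolding competitor_def by blast
  define a where "a = (\<lambda>n. next_elem (A n) (K n))"
  define I where "I = (\<Inter>n. A n)"
  have aI: "a n \<in> I" for n
  proof -
    have "a n \<in> A n" unfolding a_def using next_elem_in[OF infA] by blast
    moreover have "a n < K (Suc n)" unfolding a_def KS by simp
    ultimately have "a n \<in> A l" for l
      using Afix[of n l] Aanti[of l n] by (cases "n \<le> l") auto
    then show ?thesis unfolding I_def by blast
  qed
  have KSa: "K (Suc n) = Suc (a n)" for n unfolding a_def KS ..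
  have Kn: "n \<le> K n" for n
  proof (induction n)
    case (Suc n) then show ?case using Klt[of n] by simp
  qed simp
  have infI: "infinite I"
    unfolding infinite_nat_iff_unbounded_le
  proof
    fix n show "\<exists>m\<ge>n. m \<in> I" using aI[of n] Kn[of "Suc n"] unfolding KSa by (metis Suc_le_mono)
  qed
  have Ia: "\<exists>n. x = a n" if x: "x \<in> I" for x
  proof -
    define n where "n = (LEAST n. x < K (Suc n))"
    have n: "x < K (Suc n)"
      unfolding n_def using Kn[of "Suc x"] by (intro LeastI[where P="\<lambda>n. x < K (Suc n)" and k=x]) simp
    have "K n \<le> x"
    proof (cases n)
      case (Suc l) then show ?thesis using not_less_Least[of l "\<lambda>n. x < K (Suc n)"] unfolding n_def by simp
    qed (simp add: s0)
    moreover have "x \<in> A n" using x unfolding I_def by blast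
    ultimately have "a n \<le> x" unfolding a_def by (simp add: next_elem_le)
    then have "x = a n" using n unfolding KSa by simp
    then show ?thesis by blast
  qed
  have IA: "I \<subseteq> A n" for n unfolding I_def by blast
  have subI: "X \<in> subs I \<Longrightarrow> X \<in> subs (A n)" for X n by (rule subs_mono[OF IA])
  have stp: "F (Suc n) X = F n X \<and> M (Suc n) X = M n X \<or> r (F (Suc n) X) (F n X) \<and> K (Suc n) < M (Suc n) X"
    if "X \<in> subs I" for n X
    using cmpS[of n] subI[OF that] unfolding competitor_def by blast
  \<comment> \<open>Every alteration at \<open>X\<close> strictly lowers the value in the
    well-founded \<open>r\<close>, so only finitely many stages alter it.\<close>
  have stable: "\<exists>N. \<forall>n\<ge>N. F n X = F N X \<and> M n X = M N X" if X: "X \<in> subs I" for X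
  proof (rule ccontr)
    assume neg: "\<not> ?thesis"
    have "\<exists>n\<ge>N. r (F (Suc n) X) (F n X)" for N
    proof (rule ccontr)
      assume "\<not> ?thesis"
      then have eq: "F (Suc n) X = F n X \<and> M (Suc n) X = M n X" if "N \<le> n" for n
        using stp[OF X, of n] that by blast
      have "F n X = F N X \<and> M n X = M N X" if "N \<le> n" for n
        using that by (induction rule: dec_induct) (use eq in auto)
      then show False using neg by blast
    qed
    note ch = this
    have rl: "F l X = F n X \<or> r (F l X) (F n X)" if "n \<le> l" for n l
      using that
    proof (induction rule: dec_induct)
      case (step l)
      then show ?case using stp[OF X, of l] transpD[OF r_trans, of "F (Suc l) X" "F l X" "F n X"] by auto
    qed simp
    have "\<exists>l. r (F l X) (F n X)" for n
    proof -
      obtain l where l: "n \<le> l" "r (F (Suc l) X) (F l X)" using ch by blast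
      then show ?thesis using rl[OF l(1)] transpD[OF r_trans l(2)] by auto
    qed
    then have "\<forall>n. \<exists>l. r (F l X) (F n X)" by blast
    then obtain q where q: "\<forall>n. r (F (q n) X) (F n X)" by (rule choice[THEN exE])
    have "\<exists>p. \<forall>i. (p (Suc i), p i) \<in> {(a, b). r a b}"
      by (rule exI[of _ "\<lambda>i. F ((q ^^ i) 0) X"]) (simp add: q)
    moreover have "wf {(a, b). r a b}" using wf_r by (simp add: wfp_def)
    ultimately show False unfolding wf_iff_no_infinite_down_chain by blast
  qed
  define N where "N = (\<lambda>X. SOME N. \<forall>n\<ge>N. F n X = F N X \<and> M n X = M N X)"
  have N: "F n X = F (N X) X" "M n X = M (N X) X" if "X \<in> subs I" "N X \<le> n" for n X
    using someI_ex[OF stable[OF that(1)]] that(2) unfolding N_def by blast+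
  define f where "f = (\<lambda>X. F (N X) X)"
  define m where "m = (\<lambda>X. M (N X) X)"
  have fm: "F n X = f X" "M n X = m X" if "X \<in> subs I" "N X \<le> n" for n X
    using N[OF that] unfolding f_def m_def by auto
  have cmpI: "competitor r (K (Suc n)) f m I (F n) (M n) (A n)" for n
    unfolding competitor_def
  proof (intro conjI ballI IA)
    have "x \<in> I" if "x \<in> A n" "x < K (Suc n)" for x
    proof -
      have "x \<in> A l" for l using that Afix[of n l] Aanti[of l n] by (cases "n \<le> l") auto
      then show ?thesis unfolding I_def by blast
    qed
    then show "I \<inter> {..<K (Suc n)} = A n \<inter> {..<K (Suc n)}" using IA[of n] by auto
    fix X assume X: "X \<in> subs I"
    define l where "l = max n (N X)"
    have "F l X = f X" "M l X = m X" using fm[OF X, of l] unfolding l_def by simp_all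
    moreover have "F l X = F n X \<and> M l X = M n X \<or> r (F l X) (F n X) \<and> K (Suc n) < M l X"
      using cmpnl[of n l] subI[OF X, of l] unfolding l_def competitor_def by simp
    ultimately show "f X = F n X \<and> m X = M n X \<or> r (f X) (F n X) \<and> K (Suc n) < m X" by simp
  qed
  have arrI: "modulus_array I f m"
    unfolding modulus_array_def
  proof (intro conjI ballI impI infI)
    fix X assume X: "X \<in> subs I"
    show "m X \<in> Suc ` X" using arrn[of "N X"] subI[OF X] unfolding modulus_array_def m_def by blast
    fix Y assume Y: "Y \<in> subs I" "Y \<inter> {..<m X} = X \<inter> {..<m X}"
    define l where "l = max (N X) (N Y)"
    have l: "F l X = f X" "M l X = m X" "F l Y = f Y" "M l Y = m Y"
      using fm[OF X, of l] fm[OF Y(1), of l] unfolding l_def by simp_all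
    have "F l Y = F l X \<and> M l Y = M l X"
      using arrn[of l] subI[OF X] subI[OF Y(1)] Y(2) unfolding modulus_array_def l(2)[symmetric] by blast
    then show "f Y = f X" "m Y = m X" using l by simp_all
  qed
  have badI: "bad le I f"
    unfolding bad_def
  proof (intro conjI ballI modulus_array_cont[OF arrI])
    fix X assume X: "X \<in> subs I"
    define l where "l = max (N X) (N (shift X))"
    have l: "F l X = f X" "F l (shift X) = f (shift X)"
      using fm(1)[OF X, of l] fm(1)[OF shift_subs[OF X], of l] unfolding l_def by simp_all
    show "\<not> le (f X) (f (shift X))"
      using badn[of l] subI[OF X] unfolding bad_def l[symmetric] by blast
  qed
  have minI: False if C: "C \<in> subs I" "bad le C h" "\<forall>X\<in>subs C. r (h X) (f X)" for C h
  proof -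
    obtain mh where mh: "modulus_array C h mh" using C(2) loc_const_arr unfolding bad_def by blast
    have infC: "infinite C" and CI: "C \<subseteq> I" using C(1) unfolding subs_def by auto
    obtain X0 where X0: "X0 \<in> subs C" "\<And>Y. Y \<in> subs C \<Longrightarrow> m X0 \<le> m Y"
      using ex_has_least_nat[of "\<lambda>X. X \<in> subs C" C m] self_subs[OF infC] by blast
    have X0I: "X0 \<in> subs I" using X0(1) subs_mono[OF CI] by blast
    obtain x0 where x0: "m X0 = Suc x0" "x0 \<in> X0" using arrI X0I unfolding modulus_array_def by blast
    obtain n where n: "x0 = a n" using Ia x0(2) subs_subset[OF X0I] by blast
    define k where "k = K (Suc n)"
    have k: "k = m X0" unfolding k_def KSa x0 n ..
    \<comment> \<open>Below \<open>k\<close> the set \<open>B\<close> keeps all of \<open>I\<close>,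
      as a competitor must. The smaller values \<open>h\<close> are used exactly on the subsets of
      \<open>C\<close>, and their moduli are pushed beyond \<open>k\<close>, so no short stem is
      created.\<close>
    define B where "B = (I \<inter> {..<k}) \<union> (C \<inter> {k..})"
    define g where "g = (\<lambda>X. if X \<subseteq> C then h X else f X)"
    define mg where "mg = (\<lambda>X. if X \<subseteq> C then Suc (next_elem X (max (mh X) k)) else m X)"
    have BI: "B \<subseteq> I" and CB: "C \<subseteq> B" unfolding B_def using CI by auto
    have infB: "infinite B" using infC CB finite_subset by blast
    have inC: "X \<subseteq> C" if "X \<in> subs B" "X \<inter> {..<k} \<subseteq> C" for X
    proof
      fix x assume "x \<in> X"
      then show "x \<in> C" using that unfolding subs_def B_def by (cases "x < k") auto
    qed
    have mgk: "k < mg X" if "X \<in> subs B" "X \<subseteq> C" for X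
      using next_elem_in[OF subs_infinite[OF that(1)], of "max (mh X) k"] that unfolding mg_def by simp
    have arrB: "modulus_array B g mg"
      unfolding modulus_array_def
    proof (intro conjI ballI impI infB)
      fix X assume X: "X \<in> subs B"
      then have XI: "X \<in> subs I" using subs_mono[OF BI] by blast
      show "mg X \<in> Suc ` X"
      proof (cases "X \<subseteq> C")
        case True then show ?thesis
          using next_elem_in[OF subs_infinite[OF X], of "max (mh X) k"] unfolding mg_def by simp
      next
        case False
        have "m X \<in> Suc ` X" using arrI XI unfolding modulus_array_def by blast
        then show ?thesis using False unfolding mg_def by simp
      qed
      fix Y assume Y: "Y \<in> subs B" "Y \<inter> {..<mg X} = X \<inter> {..<mg X}"
      then have YI: "Y \<in> subs I" using subs_mono[OF BI] by blast
      have "g Y = g X \<and> mg Y = mg X"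
      proof (cases "X \<subseteq> C")
        case True
        note nx = next_elem_in[OF subs_infinite[OF X], of "max (mh X) k"]
        have mgX: "mg X = Suc (next_elem X (max (mh X) k))" using True unfolding mg_def by simp
        have "Y \<inter> {..<k} = X \<inter> {..<k}" by (rule agree_mono[OF Y(2)]) (use mgk[OF X True] in simp)
        then have YC: "Y \<subseteq> C" using inC[OF Y(1)] True by blast
        have XC: "X \<in> subs C" "Y \<in> subs C" using True YC X Y unfolding subs_def by auto
        have "Y \<inter> {..<mh X} = X \<inter> {..<mh X}"
          by (rule agree_mono[OF Y(2)]) (use nx in \<open>simp add: mgX\<close>)
        then have "h Y = h X" "mh Y = mh X" using mh XC unfolding modulus_array_def by blast+
        moreover have "next_elem Y (max (mh X) k) = next_elem X (max (mh X) k)"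
          by (rule next_elem_agree[OF subs_infinite[OF X]]) (use Y(2) in \<open>simp only: mgX\<close>)
        ultimately show ?thesis using True YC unfolding g_def mg_def by simp
      next
        case False
        have ag: "Y \<inter> {..<m X} = X \<inter> {..<m X}" using Y(2) False unfolding mg_def by simp
        then have fY: "f Y = f X" "m Y = m X" using arrI XI YI unfolding modulus_array_def by blast+
        \<comment> \<open>Otherwise minimality of \<open>m X0\<close> among subsets of
          \<open>C\<close> gives \<open>k \<le> m X\<close>; then \<open>X\<close> agrees with
          \<open>Y\<close> below \<open>k\<close>, and as \<open>B\<close> and \<open>C\<close>
          coincide from \<open>k\<close> on, \<open>X\<close> would lie in \<open>C\<close>
          too.\<close>
        have "\<not> Y \<subseteq> C"
        proof
          assume YC: "Y \<subseteq> C"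
          then have "k \<le> m X" using X0(2)[of Y] Y(1) fY unfolding k subs_def by simp
          then have "X \<inter> {..<k} \<subseteq> C" using agree_mono[OF ag, of k] YC by blast
          then show False using inC[OF X] False by blast
        qed
        then show ?thesis using False fY unfolding g_def mg_def by simp
      qed
      then show "g Y = g X" "mg Y = mg X" by simp_all
    qed
    have "bad le B g"
      unfolding bad_def
    proof (intro conjI ballI modulus_array_cont[OF arrB])
      fix X assume X: "X \<in> subs B"
      then have XI: "X \<in> subs I" using subs_mono[OF BI] by blast
      have shX: "shift X \<subseteq> X" unfolding shift_def by blast
      show "\<not> le (g X) (g (shift X))"
      proof (cases "X \<subseteq> C")
        case True
        then have "X \<in> subs C" using X unfolding subs_def by simp
        then have "\<not> le (h X) (h (shift X))" using C(2) unfolding bad_def by blast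
        moreover have "shift X \<subseteq> C" using True shX by blast
        ultimately show ?thesis using True unfolding g_def by simp
      next
        case False
        \<comment> \<open>In the mixed case only the right-hand value has been lowered, and a
          comparison with the lowered value would imply one with the old value by
          transitivity.\<close>
        have nb: "\<not> le (f X) (f (shift X))" using badI XI unfolding bad_def by blast
        show ?thesis
        proof (cases "shift X \<subseteq> C")
          case True
          then have "shift X \<in> subs C" using shift_subs[OF X] unfolding subs_def by simp
          then have "le (h (shift X)) (f (shift X))" using C(3) r_le by blast
          then have "\<not> le (f X) (h (shift X))" using nb transpD[OF le_trans] by blast
          then show ?thesis using False True unfolding g_def by simp
        next
          case F2: False then show ?thesis using nb False unfolding g_def by simp
        qed
      qed
    qed
    then have okB: "ok g mg B" using arrB unfolding ok_def by blast
    have cmpB: "competitor r k g mg B f m I"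
      unfolding competitor_def
    proof (intro conjI ballI BI)
      show "B \<inter> {..<k} = I \<inter> {..<k}" unfolding B_def by auto
      fix X assume X: "X \<in> subs B"
      show "g X = f X \<and> mg X = m X \<or> r (g X) (f X) \<and> k < mg X"
      proof (cases "X \<subseteq> C")
        case True
        then have "X \<in> subs C" using X unfolding subs_def by simp
        then show ?thesis using C(3) mgk[OF X True] True unfolding g_def by simp
      next
        case False then show ?thesis unfolding g_def mg_def by simp
      qed
    qed
    have "competitor r k g mg B (F n) (M n) (A n)"
      using competitor_trans[OF r_trans cmpB cmpI[of n, folded k_def]] by simp
    then have c1: "card (stems (M (Suc n)) (A (Suc n)) k) \<le> card (stems mg B k)"
      using minS[OF okB] unfolding k_def by blast
    have cI: "competitor r k f m I (F (Suc n)) (M (Suc n)) (A (Suc n))"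
    proof -
      have c: "competitor r (K (Suc (Suc n))) f m I (F (Suc n)) (M (Suc n)) (A (Suc n))" by (rule cmpI)
      have kk: "k \<le> K (Suc (Suc n))" using Klt[of "Suc n"] unfolding k_def by simp
      show ?thesis by (rule competitor_trans[OF r_trans c competitor_refl kk])
    qed
    have sub: "stems mg B k \<subseteq> stems (M (Suc n)) (A (Suc n)) k"
      using stems_cmp[OF cmpB] stems_cmp[OF cI] by blast
    have in1: "X0 \<inter> {..<k} \<in> stems (M (Suc n)) (A (Suc n)) k"
      using stems_cmp[OF cI] X0I unfolding k stems_def by blast
    \<comment> \<open>This is the stem that disappears: it lies in \<open>C\<close>, so every member
      of \<open>subs B\<close> beginning with it is a subset of \<open>C\<close> and now has a
      modulus beyond \<open>k\<close>.\<close>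
    have "X0 \<inter> {..<k} \<notin> stems mg B k"
    proof
      assume "X0 \<inter> {..<k} \<in> stems mg B k"
      then obtain X where X: "X0 \<inter> {..<k} = X \<inter> {..<mg X}" "X \<in> subs B" "mg X \<le> k"
        unfolding stems_def by blast
      then have XC: "\<not> X \<subseteq> C" using mgk by fastforce
      then have mX: "mg X = m X" unfolding mg_def by simp
      have XI: "X \<in> subs I" using X(2) subs_mono[OF BI] by blast
      have "X0 \<inter> {..<m X} = (X0 \<inter> {..<k}) \<inter> {..<m X}" using X(3) unfolding mX by auto
      then have "X0 \<inter> {..<m X} = X \<inter> {..<m X}" unfolding X(1) mX by simp
      then have "m X0 = m X" using arrI XI X0I unfolding modulus_array_def by blast
      then have "X \<inter> {..<k} = X0 \<inter> {..<k}" using X(1) mX k by simp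
      then have "X \<inter> {..<k} \<subseteq> C" using subs_subset[OF X0(1)] by blast
      then show False using inC[OF X(2)] XC by blast
    qed
    then have "stems mg B k \<subset> stems (M (Suc n)) (A (Suc n)) k" using sub in1 by blast
    then have "card (stems mg B k) < card (stems (M (Suc n)) (A (Suc n)) k)"
      by (rule psubset_card_mono[OF finite_stems])
    then show False using c1 by simp
  qed
  have "I \<in> subs A0" using infI IA[of 0] s0 unfolding subs_def by simp
  moreover have "f X = f0 X \<or> r (f X) (f0 X)" if "X \<in> subs I" for X
    using cmpI[of 0] that unfolding competitor_def s0 by blast
  ultimately show ?thesis using badI minI by blast
qed

end

section \<open>Greatest simulations\<close>

text \<open>\<open>c x\<close> is the set of decompositions of \<open>x\<close>; \<open>ch p\<close> and \<open>lab p\<close> are the children and the labels occurring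
  in a decomposition \<open>p\<close>; \<open>L\<close> lifts a relation between children to decompositions; \<open>D\<close> is a relation of
  being a descendant.\<close>

locale coalg =
  fixes c :: "'x \<Rightarrow> 'f set" and L :: "('x \<Rightarrow> 'x \<Rightarrow> bool) \<Rightarrow> 'f \<Rightarrow> 'f \<Rightarrow> bool"
    and ch :: "'f \<Rightarrow> 'x set" and D :: "'x \<Rightarrow> 'x \<Rightarrow> bool" and lab :: "'f \<Rightarrow> 'q set"
  assumes L_mono: "L R p p' \<Longrightarrow> (\<And>a b. a \<in> ch p \<Longrightarrow> b \<in> ch p' \<Longrightarrow> R a b \<Longrightarrow> R' a b) \<Longrightarrow> L R' p p'"
    and L_comp: "L R p p' \<Longrightarrow> L R' p' p'' \<Longrightarrow> L (R OO R') p p''"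
    and D_refl: "D x x"
    and D_trans: "D x y \<Longrightarrow> D y z \<Longrightarrow> D x z"
    and D_ch: "p \<in> c x \<Longrightarrow> a \<in> ch p \<Longrightarrow> D a x"
    and D_c: "D z x \<Longrightarrow> p \<in> c z \<Longrightarrow> \<exists>p'\<in>c x. L (=) p p' \<and> lab p \<subseteq> lab p'"
begin

definition sim :: "('x \<Rightarrow> 'x \<Rightarrow> bool) \<Rightarrow> bool" where
  "sim R \<longleftrightarrow> (\<forall>x y. R x y \<longrightarrow> (\<forall>p\<in>c x. \<exists>p'\<in>c y. L R p p'))"

definition le :: "'x \<Rightarrow> 'x \<Rightarrow> bool" where
  "le x y \<longleftrightarrow> (\<exists>R. sim R \<and> R x y)"

lemma le_coinduct: "sim R \<Longrightarrow> R x y \<Longrightarrow> le x y"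
  unfolding le_def by blast

lemma le_step:
  assumes "le x y" "p \<in> c x"
  obtains p' where "p' \<in> c y" "L le p p'"
proof -
  obtain R where R: "sim R" "R x y" using assms unfolding le_def by blast
  then obtain p' where "p' \<in> c y" "L R p p'" using assms(2) unfolding sim_def by blast
  then show thesis using that L_mono le_coinduct[OF R(1)] by blast
qed

lemma D_le:
  assumes "D z x" shows "le z x"
proof (rule le_coinduct[of D])
  show "sim D" unfolding sim_def
  proof (intro allI impI ballI)
    fix x y p assume "D x y" "p \<in> c x"
    then obtain p' where "p' \<in> c y" "L (=) p p'" using D_c by blast
    then show "\<exists>p'\<in>c y. L D p p'" using L_mono D_refl by blast
  qed
qed fact

lemma le_refl: "le x x" using D_le D_refl by blast

lemma le_trans: "le x y \<Longrightarrow> le y z \<Longrightarrow> le x z"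
proof (rule le_coinduct[of "le OO le"])
  show "sim (le OO le)" unfolding sim_def
  proof (intro allI impI ballI)
    fix x y p assume "(le OO le) x y" and p: "p \<in> c x"
    then obtain z where z: "le x z" "le z y" by blast
    obtain p' where p': "p' \<in> c z" "L le p p'" using le_step[OF z(1) p] by blast
    obtain p'' where "p'' \<in> c y" "L le p' p''" using le_step[OF z(2) p'(1)] by blast
    then show "\<exists>p'\<in>c y. L (le OO le) p p'" using L_comp[OF p'(2)] by blast
  qed
qed blast

text \<open>Elements of \<open>M\<close> and \<open>N\<close> count as one anonymous mark that
  matches only itself. In use the marked children are those at least as large as the whole, or those
  that are not well-founded; only the others are compared by \<open>le\<close>.\<close>

definition marked_le :: "'x set \<Rightarrow> 'x set \<Rightarrow> 'x \<Rightarrow> 'x \<Rightarrow> bool" where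
  "marked_le M N a b \<longleftrightarrow> a \<in> M \<and> b \<in> N \<or> a \<notin> M \<and> b \<notin> N \<and> le a b"

definition marked_L :: "'f \<times> 'x set \<Rightarrow> 'f \<times> 'x set \<Rightarrow> bool" where
  "marked_L t t' \<longleftrightarrow> L (marked_le (snd t) (snd t')) (fst t) (fst t')"

definition Lab :: "'x \<Rightarrow> 'q set" where
  "Lab x = (\<Union>p\<in>c x. lab p)"

lemma Lab_mono: "D z x \<Longrightarrow> Lab z \<subseteq> Lab x"
  unfolding Lab_def using D_c by blast

definition lt :: "'x \<Rightarrow> 'x \<Rightarrow> bool" where
  "lt a x \<longleftrightarrow> D a x \<and> \<not> le x a"

lemma lt_trans: "lt a b \<Longrightarrow> lt b d \<Longrightarrow> lt a d"
  unfolding lt_def using D_trans D_le le_trans by blast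

lemma lt_D: "lt a b \<Longrightarrow> D b d \<Longrightarrow> lt a d"
  unfolding lt_def using D_trans D_le le_trans by blast

definition wf_below :: "'x \<Rightarrow> bool" where "wf_below = Wellfounded.accp lt"

lemma wf_below_lt: "wf_below x \<Longrightarrow> lt a x \<Longrightarrow> wf_below a"
  unfolding wf_below_def by (rule accp_downward)

lemma wf_below_I: "(\<And>a. lt a x \<Longrightarrow> wf_below a) \<Longrightarrow> wf_below x"
  unfolding wf_below_def by (rule accpI)

lemma wf_below_D: "wf_below x \<Longrightarrow> D z x \<Longrightarrow> wf_below z"
  by (meson wf_below_I wf_below_lt lt_D)

text \<open>Marks lose no information here. A child \<open>a\<close> of a decomposition of
  \<open>x\<close> with \<open>le x a\<close> is a descendant of \<open>x\<close> and therefore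
  equivalent to it; matching it with some \<open>b\<close> above \<open>y\<close> is the very claim
  \<open>le x y\<close>, which coinduction may assume.\<close>

lemma le_by_marks:
  assumes "\<forall>p\<in>c x. \<exists>p'\<in>c y. marked_L (p, {a. le x a}) (p', {b. le y b})"
  shows "le x y"
proof -
  define R where "R = (\<lambda>u v. le u v \<or> le u x \<and> le y v)"
  have "sim R" unfolding sim_def
  proof (intro allI impI ballI)
    fix u v p assume R: "R u v" and p: "p \<in> c u"
    show "\<exists>p'\<in>c v. L R p p'"
    proof (cases "le u v")
      case True
      then obtain p' where "p' \<in> c v" "L le p p'" using le_step p by blast
      then show ?thesis using L_mono[of le p p' R] unfolding R_def by blast
    next
      case False
      then have R: "le u x" "le y v" using R unfolding R_def by auto
      obtain p1 where p1: "p1 \<in> c x" "L le p p1" using le_step[OF R(1) p] by blast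
      obtain p2 where p2: "p2 \<in> c y" "L (marked_le {a. le x a} {b. le y b}) p1 p2"
        using assms p1(1) unfolding marked_L_def by fastforce
      define R2 where "R2 = (\<lambda>a b. marked_le {a. le x a} {b. le y b} a b \<and> a \<in> ch p1)"
      have p2': "L R2 p1 p2" using L_mono[OF p2(2), of R2] unfolding R2_def by blast
      obtain p3 where p3: "p3 \<in> c v" "L le p2 p3" using le_step[OF R(2) p2(1)] by blast
      have "L (le OO R2 OO le) p p3" using L_comp[OF p1(2) L_comp[OF p2' p3(2)]] .
      moreover have "R a b" if "(le OO R2 OO le) a b" for a b
      proof -
        obtain a1 b1 where ab: "le a a1" "R2 a1 b1" "le b1 b" using \<open>(le OO R2 OO le) a b\<close> by blast
        have "D a1 x" using ab(2) D_ch[OF p1(1)] unfolding R2_def by blast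
        then have "le a x" using D_le le_trans ab(1) by blast
        then show ?thesis using ab le_trans unfolding R2_def R_def marked_le_def by blast
      qed
      ultimately show ?thesis using L_mono[of _ p p3 R] p3(1) by blast
    qed
  qed
  moreover have "R x y" unfolding R_def using le_refl by blast
  ultimately show ?thesis by (rule le_coinduct)
qed

end

text \<open>The assumption \<open>local\<close> is a one-step lifting property: badness of
  decompositions must be caused by unmarked children or by labels. It mentions a single layer only,
  and the locale turns it into a statement about the greatest simulation.\<close>

locale coalg_bqo = coalg c L ch D lab
  for c :: "'x \<Rightarrow> 'f set" and L ch D and lab :: "'f \<Rightarrow> 'q set" +
  fixes leq :: "'q \<Rightarrow> 'q \<Rightarrow> bool"
  assumes local: "bad marked_L A P \<Longrightarrow>
     (\<And>X. X \<in> subs A \<Longrightarrow> bqo_on (ch (fst (P X)) - snd (P X)) le) \<Longrightarrow>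
     (\<exists>B\<in>subs A. \<exists>h. bad le B h \<and> (\<forall>X\<in>subs B. h X \<in> ch (fst (P X)) - snd (P X))) \<or>
     (\<exists>B\<in>subs A. \<exists>h. bad leq B h \<and> (\<forall>X\<in>subs B. h X \<in> lab (fst (P X))))"
begin

text \<open>In a minimal bad array below \<open>F\<close>, each failure of \<open>le\<close> is
  witnessed by a decomposition in which the children equivalent to the whole are marked. The
  unmarked ones are strictly smaller, so a bad array of them would contradict minimality;
  \<open>local\<close> leaves only a bad array of labels.\<close>

lemma bad_DF_labels:
  assumes F: "bad le A F" and wf_below: "\<And>X. X \<in> subs A \<Longrightarrow> wf_below (F X)"
    and lts: "\<And>X. X \<in> subs A \<Longrightarrow> bqo_on {a. lt a (F X)} le"
  shows "\<exists>B\<in>subs A. \<exists>h. bad leq B h \<and> (\<forall>X\<in>subs B. h X \<in> Lab (F X))"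
proof -
  interpret m: minimal_bad le "\<lambda>a b. lt a b \<and> wf_below b"
  proof
    show "transp le" using le_trans by (auto intro: transpI)
    show "transp (\<lambda>a b. lt a b \<and> wf_below b)" using lt_trans by (auto intro: transpI)
    show "lt a b \<and> wf_below b \<Longrightarrow> le a b" for a b using D_le unfolding lt_def by blast
    show "wfP (\<lambda>a b. lt a b \<and> wf_below b)"
    proof (rule accp_wfpI, rule allI)
      have acc: "Wellfounded.accp (\<lambda>a b. lt a b \<and> wf_below b) x" if "Wellfounded.accp lt x" for x
        using that
      proof (induction rule: accp.induct)
        case (accI x) then show ?case using accpI[of "\<lambda>a b. lt a b \<and> wf_below b" x] by blast
      qed
      fix x show "Wellfounded.accp (\<lambda>a b. lt a b \<and> wf_below b) x"
        by (rule accpI) (use acc wf_below_lt in \<open>auto simp: wf_below_def\<close>)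
    qed
  qed
  obtain B G where B: "B \<in> subs A" and G: "bad le B G"
    and GF: "\<forall>X\<in>subs B. G X = F X \<or> lt (G X) (F X) \<and> wf_below (F X)"
    and min: "\<not> (\<exists>C\<in>subs B. \<exists>h. bad le C h \<and> (\<forall>X\<in>subs C. lt (h X) (G X) \<and> wf_below (G X)))"
    using m.minimal_bad_array[OF F] by blast
  have BA: "X \<in> subs A" if "X \<in> subs B" for X using subs_mono[OF subs_subset[OF B] that] .
  have DG: "D (G X) (F X)" if "X \<in> subs B" for X using GF that D_refl unfolding lt_def by auto
  define sel where "sel = (\<lambda>x y. SOME p. p \<in> c x \<and> (\<forall>p'\<in>c y. \<not> marked_L (p, {a. le x a}) (p', {b. le y b})))"
  have sel: "sel x y \<in> c x" "p' \<in> c y \<Longrightarrow> \<not> marked_L (sel x y, {a. le x a}) (p', {b. le y b})"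
    if "\<not> le x y" for x y p'
  proof -
    have "\<exists>p. p \<in> c x \<and> (\<forall>p'\<in>c y. \<not> marked_L (p, {a. le x a}) (p', {b. le y b}))"
      using le_by_marks[of x y] that by blast
    from someI_ex[OF this] show "sel x y \<in> c x" "p' \<in> c y \<Longrightarrow> \<not> marked_L (sel x y, {a. le x a}) (p', {b. le y b})"
      unfolding sel_def by blast+
  qed
  define P where "P = (\<lambda>X. (sel (G X) (G (shift X)), {a. le (G X) a}))"
  have nle: "\<not> le (G X) (G (shift X))" if "X \<in> subs B" for X using G that unfolding bad_def by blast
  have cP: "fst (P X) \<in> c (G X)" if "X \<in> subs B" for X
    using sel(1)[OF nle[OF that]] unfolding P_def by simp
  have "bad marked_L B P"
    unfolding bad_def
  proof (intro conjI ballI)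
    show "loc_const B P" unfolding P_def
      using G loc_const_pair_sh[of B G "\<lambda>x y. (sel x y, {a. le x a})"] unfolding bad_def by blast
    fix X assume X: "X \<in> subs B"
    show "\<not> marked_L (P X) (P (shift X))"
      using sel(2)[OF nle[OF X]] cP[OF shift_subs[OF X]] unfolding P_def by simp
  qed
  moreover have chlt: "lt a (G X)" if "X \<in> subs B" "a \<in> ch (fst (P X)) - snd (P X)" for X a
    using that D_ch[OF cP[OF that(1)], of a] unfolding lt_def P_def by auto
  have "bqo_on (ch (fst (P X)) - snd (P X)) le" if X: "X \<in> subs B" for X
  proof (rule bqo_on_subset[OF lts[OF BA[OF X]]])
    show "ch (fst (P X)) - snd (P X) \<subseteq> {a. lt a (F X)}"
      using chlt[OF X] lt_D DG[OF X] by blast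
  qed
  ultimately consider
      (child) C h where "C \<in> subs B" "bad le C h" "\<forall>X\<in>subs C. h X \<in> ch (fst (P X)) - snd (P X)"
    | (label) C h where "C \<in> subs B" "bad leq C h" "\<forall>X\<in>subs C. h X \<in> lab (fst (P X))"
    using local[of B P] by blast
  then show ?thesis
  proof cases
    case child
    have "lt (h X) (G X) \<and> wf_below (G X)" if X: "X \<in> subs C" for X
    proof -
      have XB: "X \<in> subs B" using subs_mono[OF subs_subset[OF child(1)] X] .
      show ?thesis using chlt[OF XB] child(3) X wf_below_D[OF wf_below[OF BA[OF XB]] DG[OF XB]] by blast
    qed
    then show ?thesis using min child by blast
  next
    case label
    have "h X \<in> Lab (F X)" if X: "X \<in> subs C" for X
    proof -
      have XB: "X \<in> subs B" using subs_mono[OF subs_subset[OF label(1)] X] .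
      have "h X \<in> Lab (G X)" using label(3) X cP[OF XB] unfolding Lab_def by blast
      then show ?thesis using Lab_mono[OF DG[OF XB]] by blast
    qed
    moreover have "C \<in> subs A" using BA[OF label(1)] .
    ultimately show ?thesis using label(2) by blast
  qed
qed

lemma bqo_lt:
  assumes "wf_below x" "bqo_on (Lab x) leq" shows "bqo_on {a. lt a x} le"
  using assms unfolding wf_below_def
proof (induction rule: accp.induct)
  case (accI x)
  show ?case
    unfolding bqo_on_def
  proof
    assume "\<exists>A f. bad le A f \<and> (\<forall>X\<in>subs A. f X \<in> {a. lt a x})"
    then obtain A f where f: "bad le A f" "\<forall>X\<in>subs A. lt (f X) x" by blast
    have lab: "Lab (f X) \<subseteq> Lab x" if "X \<in> subs A" for X
      using f(2) that Lab_mono unfolding lt_def by blast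
    have "\<exists>B\<in>subs A. \<exists>h. bad leq B h \<and> (\<forall>X\<in>subs B. h X \<in> Lab (f X))"
    proof (rule bad_DF_labels[OF f(1)])
      fix X assume X: "X \<in> subs A"
      then have l: "lt (f X) x" using f(2) by blast
      then show "wf_below (f X)" using accI(1) unfolding wf_below_def by blast
      show "bqo_on {a. lt a (f X)} le"
        using accI(2)[OF l] bqo_on_subset[OF accI(3) lab[OF X]] by blast
    qed
    then obtain B h where B: "B \<in> subs A" "bad leq B h" "\<forall>X\<in>subs B. h X \<in> Lab (f X)" by blast
    have "\<forall>X\<in>subs B. h X \<in> Lab x"
      using B(3) lab subs_mono[OF subs_subset[OF B(1)]] by blast
    then show False using B(2) accI(3) unfolding bqo_on_def by blast
  qed
qed

lemma bqo_DF:
  assumes "bqo_on (Lab x) leq" shows "bqo_on {a. D a x \<and> wf_below a} le"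
  unfolding bqo_on_def
proof
  assume "\<exists>A f. bad le A f \<and> (\<forall>X\<in>subs A. f X \<in> {a. D a x \<and> wf_below a})"
  then obtain A f where f: "bad le A f" "\<forall>X\<in>subs A. D (f X) x \<and> wf_below (f X)" by blast
  have lab: "Lab (f X) \<subseteq> Lab x" if "X \<in> subs A" for X
    using f(2) that Lab_mono by blast
  have "\<exists>B\<in>subs A. \<exists>h. bad leq B h \<and> (\<forall>X\<in>subs B. h X \<in> Lab (f X))"
  proof (rule bad_DF_labels[OF f(1)])
    fix X assume X: "X \<in> subs A"
    show "wf_below (f X)" using f(2) X by blast
    then show "bqo_on {a. lt a (f X)} le"
      by (rule bqo_lt) (rule bqo_on_subset[OF assms lab[OF X]])
  qed
  then obtain B h where B: "B \<in> subs A" "bad leq B h" "\<forall>X\<in>subs B. h X \<in> Lab (f X)" by blast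
  have "\<forall>X\<in>subs B. h X \<in> Lab x"
    using B(3) lab subs_mono[OF subs_subset[OF B(1)]] by blast
  then show False using B(2) assms unfolding bqo_on_def by blast
qed

lemma marked_L_comp_eq:
  assumes "marked_L (p, N) (p', N)" "L (=) p' p''" shows "marked_L (p, N) (p'', N)"
  using L_comp[OF assms(1)[unfolded marked_L_def fst_conv snd_conv] assms(2)]
  unfolding marked_L_def fst_conv snd_conv by (rule L_mono) blast

lemma eq_comp_lm:
  assumes "L (=) p p'" "marked_L (p', N) (p'', N)" shows "marked_L (p, N) (p'', N)"
  using L_comp[OF assms(1) assms(2)[unfolded marked_L_def fst_conv snd_conv]]
  unfolding marked_L_def fst_conv snd_conv by (rule L_mono) blast

text \<open>If \<open>x\<close> had an infinite descending sequence, one could pass to a descendant \<open>y\<close> whose profile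
  (its decompositions, with the non-well-founded children replaced by a single mark) is minimal.
  All non-well-founded descendants of \<open>y\<close> would then be equivalent to \<open>y\<close>.\<close>

lemma all_DF:
  assumes lab: "bqo_on (Lab x) leq" shows "wf_below x"
proof (rule ccontr)
  assume nx: "\<not> wf_below x"
  define N where "N = {a. \<not> wf_below a}"
  define PP where "PP = (\<lambda>y z. \<forall>p\<in>c y. \<exists>p'\<in>c z. marked_L (p, N) (p', N))"
  have "\<exists>y. D y x \<and> \<not> wf_below y \<and> (\<forall>z. D z y \<longrightarrow> \<not> wf_below z \<longrightarrow> PP y z)"
  proof (rule ccontr)
    assume neg: "\<not> ?thesis"
    have "\<exists>s. \<forall>n. (D (s n) x \<and> \<not> wf_below (s n)) \<and> (D (s (Suc n)) (s n) \<and> \<not> PP (s n) (s (Suc n)))"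
    proof (rule dependent_nat_choice)
      show "\<exists>y. D y x \<and> \<not> wf_below y" using nx D_refl by blast
      show "\<exists>z. (D z x \<and> \<not> wf_below z) \<and> D z y \<and> \<not> PP y z" if "D y x \<and> \<not> wf_below y" for y and n :: nat
        using neg that D_trans by blast
    qed
    then obtain s where s: "\<forall>n. (D (s n) x \<and> \<not> wf_below (s n)) \<and> (D (s (Suc n)) (s n) \<and> \<not> PP (s n) (s (Suc n)))"
      by (rule exE)
    have "\<forall>n. \<exists>p. p \<in> c (s n) \<and> (\<forall>p'\<in>c (s (Suc n)). \<not> marked_L (p, N) (p', N))"
      using s unfolding PP_def by blast
    then obtain p where p: "\<forall>n. p n \<in> c (s n) \<and> (\<forall>p'\<in>c (s (Suc n)). \<not> marked_L (p n, N) (p', N))"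
      by (rule choice[THEN exE])
    have Ds: "D (s j) (s i)" if "i \<le> j" for i j
      using that
    proof (induction rule: dec_induct)
      case (step j) then show ?case using s D_trans by blast
    qed (rule D_refl)
    \<comment> \<open>Decompositions of \<open>s j\<close> reappear in every earlier member of the
      sequence. A match of \<open>p i\<close> with \<open>p j\<close> would therefore yield a match
      inside \<open>s (Suc i)\<close>, which the choice of \<open>p i\<close> excludes.\<close>
    have nlm: "\<not> marked_L (p i, N) (p j, N)" if "i < j" for i j
    proof
      assume a: "marked_L (p i, N) (p j, N)"
      have "D (s j) (s (Suc i))" using Ds that by simp
      then obtain p' where "p' \<in> c (s (Suc i))" "L (=) (p j) p'" using D_c p by blast
      then show False using marked_L_comp_eq[OF a] p by blast
    qed
    define P where "P = (\<lambda>X. (p (least X), N))"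
    have bad: "bad marked_L UNIV P"
      unfolding bad_def
    proof (intro conjI ballI)
      show "loc_const UNIV P" unfolding P_def using loc_const_mn[of UNIV "\<lambda>n. (p n, N)"] by simp
      fix X :: "nat set" assume X: "X \<in> subs UNIV"
      obtain y where "y \<in> shift X" using subs_infinite[OF shift_subs[OF X]] infinite_nonempty by blast
      then have "least (shift X) \<in> shift X" by (rule least_in)
      then have "least X < least (shift X)" using least_le unfolding shift_def by (metis DiffE le_neq_implies_less singletonI)
      then show "\<not> marked_L (P X) (P (shift X))" unfolding P_def using nlm by simp
    qed
    have chP: "ch (fst (P X)) - snd (P X) \<subseteq> {a. D a x \<and> wf_below a}" for X
      using p s D_ch D_trans unfolding P_def N_def by fastforce
    have labP: "lab (fst (P X)) \<subseteq> Lab x" for X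
    proof -
      have "lab (fst (P X)) \<subseteq> Lab (s (least X))" using p unfolding P_def Lab_def by auto
      then show ?thesis using Lab_mono s by blast
    qed
    note bq = bqo_DF[OF lab]
    have "(\<exists>B\<in>subs UNIV. \<exists>h. bad le B h \<and> (\<forall>X\<in>subs B. h X \<in> ch (fst (P X)) - snd (P X))) \<or>
     (\<exists>B\<in>subs UNIV. \<exists>h. bad leq B h \<and> (\<forall>X\<in>subs B. h X \<in> lab (fst (P X))))"
      by (rule local[OF bad]) (rule bqo_on_subset[OF bq chP])
    then show False using bq lab chP labP unfolding bqo_on_def by blast
  qed
  then obtain y where y: "D y x" "\<not> wf_below y" "\<And>z. D z y \<Longrightarrow> \<not> wf_below z \<Longrightarrow> PP y z" by blast
  \<comment> \<open>Minimality of the profile lets any two non-well-founded descendants of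
    \<open>y\<close> simulate each other: a decomposition of \<open>u\<close> is one of
    \<open>y\<close>, and that is matched in \<open>v\<close> up to marks, where marked children are
    again related by \<open>R\<close>.\<close>
  define R where "R = (\<lambda>u v. le u v \<or> (D u y \<and> D v y \<and> \<not> wf_below u \<and> \<not> wf_below v))"
  have "sim R" unfolding sim_def
  proof (intro allI impI ballI)
    fix u v p assume R: "R u v" and p: "p \<in> c u"
    show "\<exists>p'\<in>c v. L R p p'"
    proof (cases "le u v")
      case True
      then obtain p' where "p' \<in> c v" "L le p p'" using le_step p by blast
      then show ?thesis using L_mono[of le p p' R] unfolding R_def by blast
    next
      case False
      then have R: "D u y" "D v y" "\<not> wf_below u" "\<not> wf_below v" using R unfolding R_def by auto
      obtain p1 where p1: "p1 \<in> c y" "L (=) p p1" using D_c[OF R(1) p] by blast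
      obtain p2 where p2: "p2 \<in> c v" "marked_L (p1, N) (p2, N)" using y(3)[OF R(2,4)] p1(1) unfolding PP_def by blast
      have "L (marked_le N N) p p2" using eq_comp_lm[OF p1(2) p2(2)] unfolding marked_L_def by simp
      then have "L R p p2"
      proof (rule L_mono)
        fix a b assume ab: "a \<in> ch p" "b \<in> ch p2" "marked_le N N a b"
        have "D a y" "D b y" using D_ch[OF p ab(1)] D_ch[OF p2(1) ab(2)] R D_trans by blast+
        then show "R a b" using ab(3) unfolding marked_le_def R_def N_def by auto
      qed
      then show ?thesis using p2(1) by blast
    qed
  qed
  then have ley: "le y z" if "D z y" "\<not> wf_below z" for z
    using le_coinduct[of R y z] that y(2) D_refl unfolding R_def by blast
  have "wf_below y"
  proof (rule wf_below_I)
    fix a assume "lt a y" then show "wf_below a" using ley unfolding lt_def by blast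
  qed
  then show False using y(2) by blast
qed

theorem bad_labels:
  assumes F: "bad le A F" and lab: "\<And>X. X \<in> subs A \<Longrightarrow> bqo_on (Lab (F X)) leq"
  shows "\<exists>B\<in>subs A. \<exists>h. bad leq B h \<and> (\<forall>X\<in>subs B. h X \<in> Lab (F X))"
proof (rule bad_DF_labels[OF F])
  fix X assume "X \<in> subs A"
  note l = lab[OF this]
  show "wf_below (F X)" by (rule all_DF[OF l])
  then show "bqo_on {a. lt a (F X)} le" by (rule bqo_lt[OF _ l])
qed

end

section \<open>Vertex sets are better-quasi-ordered by simulation\<close>

text \<open>\<open>(v, K)\<close> is the set \<open>K\<close> as seen from the vertex \<open>v\<close>.\<close>

type_synonym 'a ctx = "'a \<times> 'a set"

text \<open>Seen from \<open>v\<close>, the set \<open>L\<close> branches off above \<open>K\<close>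
  in the cotree: a vertex of \<open>L\<close> cannot distinguish the vertices of \<open>K\<close>
  from \<open>v\<close>.\<close>

definition stacked :: "('a \<Rightarrow> 'a \<Rightarrow> bool) \<Rightarrow> 'a \<Rightarrow> 'a set \<Rightarrow> 'a set \<Rightarrow> bool" where
  "stacked E v K L \<longleftrightarrow> (\<forall>u\<in>K. \<forall>w\<in>L. u \<noteq> w \<and> (E u w \<longleftrightarrow> E v w))"

text \<open>A node \<open>A\<close> of colour \<open>e\<close> with a part of the chain below it and
  a part above it. The pieces may leave out vertices, so decompositions of a subset are
  decompositions of the whole set and inclusion is a simulation.\<close>

definition decomp :: "('a \<Rightarrow> 'a \<Rightarrow> bool) \<Rightarrow> 'a ctx \<Rightarrow> (bool \<times> 'a set \<times> 'a ctx \<times> 'a ctx) set" where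
  "decomp E k = {(e, A, k1, k2). fst k1 = fst k \<and> fst k2 = fst k \<and>
      A \<subseteq> snd k \<and> snd k1 \<subseteq> snd k \<and> snd k2 \<subseteq> snd k \<and> (\<forall>w\<in>A. E (fst k) w = e) \<and>
      stacked E (fst k) (snd k1) A \<and> stacked E (fst k) A (snd k2) \<and> stacked E (fst k) (snd k1) (snd k2)}"

lemma stacked_mono: "stacked E v K L \<Longrightarrow> K' \<subseteq> K \<Longrightarrow> L' \<subseteq> L \<Longrightarrow> stacked E v K' L'"
  unfolding stacked_def by blast

lemma decomp_mono: "fst k = fst k' \<Longrightarrow> snd k \<subseteq> snd k' \<Longrightarrow> decomp E k \<subseteq> decomp E k'"
  unfolding decomp_def by auto

lemma decompD:
  assumes "(e, A, k1, k2) \<in> decomp E k"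
  shows "fst k1 = fst k" "fst k2 = fst k" "A \<subseteq> snd k" "snd k1 \<subseteq> snd k" "snd k2 \<subseteq> snd k"
  using assms unfolding decomp_def by auto

text \<open>The second component collects the node sets marked at the upper level. Carrying it along
  unchanged lets a single order on chains handle every marked relation between nodes.\<close>

definition c1 :: "('a \<Rightarrow> 'a \<Rightarrow> bool) \<Rightarrow> 'a ctx \<times> 'a set set \<Rightarrow>
    ((bool \<times> 'a set \<times> bool) \<times> ('a ctx \<times> 'a set set) \<times> ('a ctx \<times> 'a set set)) set" where
  "c1 E x = (\<lambda>(e, A, k1, k2). ((e, A, A \<in> snd x), (k1, snd x), (k2, snd x))) ` decomp E (fst x)"

definition L1 where
  "L1 gle R p p' \<longleftrightarrow> (case p of ((e, A, m), a, b) \<Rightarrow> case p' of ((e', A', m'), a', b') \<Rightarrow>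
     e = e' \<and> m = m' \<and> (m \<or> gle A A') \<and> R a a' \<and> R b b')"

definition ch1 where "ch1 p = {fst (snd p), snd (snd p)}"

definition D1 :: "'a ctx \<times> 'a set set \<Rightarrow> 'a ctx \<times> 'a set set \<Rightarrow> bool" where
  "D1 y x \<longleftrightarrow> snd y = snd x \<and> fst (fst y) = fst (fst x) \<and> snd (fst y) \<subseteq> snd (fst x)"

definition lab1 where "lab1 p = (case fst p of (e, A, m) \<Rightarrow> if m then {} else {A})"

lemma coalg1:
  assumes "reflp gle" "transp gle"
  shows "coalg (c1 E) (L1 gle) ch1 D1 lab1"
proof
  show "L1 gle R' p p'" if "L1 gle R p p'" "\<And>a b. a \<in> ch1 p \<Longrightarrow> b \<in> ch1 p' \<Longrightarrow> R a b \<Longrightarrow> R' a b" for R R' p p'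
    using that unfolding L1_def ch1_def by (auto split: prod.splits)
  show "L1 gle (R OO R') p p''" if "L1 gle R p p'" "L1 gle R' p' p''" for R R' p p' p''
    using that transpD[OF assms(2)] unfolding L1_def
    by (simp split: prod.splits) blast
  show "D1 x x" for x unfolding D1_def by simp
  show "D1 x y \<Longrightarrow> D1 y z \<Longrightarrow> D1 x z" for x y z unfolding D1_def by auto
  show "D1 a x" if px: "p \<in> c1 E x" "a \<in> ch1 p" for p x a
  proof -
    obtain e A k1 k2 where "(e, A, k1, k2) \<in> decomp E (fst x)"
        "p = ((e, A, A \<in> snd x), (k1, snd x), (k2, snd x))"
      using px(1) unfolding c1_def by auto
    then show ?thesis using px(2) decompD[of e A k1 k2 E "fst x"] unfolding ch1_def D1_def by auto
  qed
  show "\<exists>p'\<in>c1 E x. L1 gle (=) p p' \<and> lab1 p \<subseteq> lab1 p'" if "D1 z x" "p \<in> c1 E z" for z x p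
  proof
    have "decomp E (fst z) \<subseteq> decomp E (fst x)" using that(1) decomp_mono unfolding D1_def by blast
    moreover have "snd z = snd x" using that(1) unfolding D1_def by blast
    ultimately have "c1 E z \<subseteq> c1 E x" unfolding c1_def by (simp add: image_mono)
    then show "p \<in> c1 E x" using that(2) by blast
    show "L1 gle (=) p p \<and> lab1 p \<subseteq> lab1 p"
      using reflpD[OF assms(1)] unfolding L1_def by (simp split: prod.splits)
  qed
qed

lemma ramsey_sub:
  assumes "loc_const A P" "B \<in> subs A"
  obtains C r where "C \<in> subs B" "\<And>X. X \<in> subs C \<Longrightarrow> P X = (r::bool)"
  using ramsey_cont[OF loc_const_mono[OF assms]] by blast

text \<open>Two decompositions can fail to match for finitely many reasons. Ramsey's theorem makes
  the colour, the marks and both comparisons of children constant on one infinite set; there a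
  single child, or else the node, is responsible throughout.\<close>

lemma coalg_bqo1:
  assumes "reflp gle" "transp gle"
  shows "coalg_bqo (c1 E) (L1 gle) ch1 D1 lab1 gle"
proof -
  interpret coalg "c1 E" "L1 gle" ch1 D1 lab1 by (rule coalg1[OF assms])
  show ?thesis
  proof
    fix A and P :: "nat set \<Rightarrow> ((bool \<times> 'a set \<times> bool) \<times> ('a ctx \<times> 'a set set) \<times> ('a ctx \<times> 'a set set)) \<times> ('a ctx \<times> 'a set set) set"
    assume P: "bad marked_L A P"
    define e where "e = (\<lambda>p :: ((bool \<times> 'a set \<times> bool) \<times> ('a ctx \<times> 'a set set) \<times> ('a ctx \<times> 'a set set)) \<times> ('a ctx \<times> 'a set set) set. fst (fst (fst p)))"
    define g where "g = (\<lambda>p :: ((bool \<times> 'a set \<times> bool) \<times> ('a ctx \<times> 'a set set) \<times> ('a ctx \<times> 'a set set)) \<times> ('a ctx \<times> 'a set set) set. fst (snd (fst (fst p))))"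
    define m where "m = (\<lambda>p :: ((bool \<times> 'a set \<times> bool) \<times> ('a ctx \<times> 'a set set) \<times> ('a ctx \<times> 'a set set)) \<times> ('a ctx \<times> 'a set set) set. snd (snd (fst (fst p))))"
    define a where "a = (\<lambda>p :: ((bool \<times> 'a set \<times> bool) \<times> ('a ctx \<times> 'a set set) \<times> ('a ctx \<times> 'a set set)) \<times> ('a ctx \<times> 'a set set) set. fst (snd (fst p)))"
    define b where "b = (\<lambda>p :: ((bool \<times> 'a set \<times> bool) \<times> ('a ctx \<times> 'a set set) \<times> ('a ctx \<times> 'a set set)) \<times> ('a ctx \<times> 'a set set) set. snd (snd (fst p)))"
    have lm_iff: "marked_L p p' \<longleftrightarrow> e p = e p' \<and> m p = m p' \<and> (m p \<or> gle (g p) (g p')) \<and>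
        marked_le (snd p) (snd p') (a p) (a p') \<and> marked_le (snd p) (snd p') (b p) (b p')" for p p'
      unfolding marked_L_def L1_def e_def m_def g_def a_def b_def by (simp split: prod.splits)
    have cP: "loc_const A P" using P unfolding bad_def by blast
    have nlm: "\<not> marked_L (P X) (P (shift X))" if "X \<in> subs A" for X using P that unfolding bad_def by blast
    have cb: "loc_const A (\<lambda>X. q (P X) (P (shift X)))" for q :: "_ \<Rightarrow> _ \<Rightarrow> bool" by (rule loc_const_pair_sh[OF cP])
    have cb1: "loc_const A (\<lambda>X. q (P X))" for q :: "_ \<Rightarrow> bool" by (rule loc_const_comp[OF cP])
    have infA: "infinite A" using cP unfolding loc_const_def by blast
    obtain B1 r1 where B1: "B1 \<in> subs A" "\<And>X. X \<in> subs B1 \<Longrightarrow> e (P X) = r1"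
      using ramsey_sub[OF cb1[of e] self_subs[OF infA]] by metis
    obtain B2 r2 where B2: "B2 \<in> subs B1" "\<And>X. X \<in> subs B2 \<Longrightarrow> m (P X) = r2"
      using ramsey_sub[OF cb1[of m] B1(1)] by metis
    have B2A: "B2 \<in> subs A" using subs_mono[OF subs_subset[OF B1(1)] B2(1)] .
    obtain B3 r3 where B3: "B3 \<in> subs B2" "\<And>X. X \<in> subs B3 \<Longrightarrow> (a (P X) \<in> snd (P X)) = r3"
      using ramsey_sub[OF cb1[of "\<lambda>p. a p \<in> snd p"] B2A] by metis
    have B3A: "B3 \<in> subs A" using subs_mono[OF subs_subset[OF B2A] B3(1)] .
    obtain B4 r4 where B4: "B4 \<in> subs B3" "\<And>X. X \<in> subs B4 \<Longrightarrow> (b (P X) \<in> snd (P X)) = r4"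
      using ramsey_sub[OF cb1[of "\<lambda>p. b p \<in> snd p"] B3A] by metis
    have B4A: "B4 \<in> subs A" using subs_mono[OF subs_subset[OF B3A] B4(1)] .
    obtain B5 r5 where B5: "B5 \<in> subs B4" "\<And>X. X \<in> subs B5 \<Longrightarrow> marked_le (snd (P X)) (snd (P (shift X))) (a (P X)) (a (P (shift X))) = r5"
      using ramsey_sub[OF cb[of "\<lambda>p p'. marked_le (snd p) (snd p') (a p) (a p')"] B4A] by metis
    have B5A: "B5 \<in> subs A" using subs_mono[OF subs_subset[OF B4A] B5(1)] .
    obtain C r6 where B6: "C \<in> subs B5" "\<And>X. X \<in> subs C \<Longrightarrow> marked_le (snd (P X)) (snd (P (shift X))) (b (P X)) (b (P (shift X))) = r6"
      using ramsey_sub[OF cb[of "\<lambda>p p'. marked_le (snd p) (snd p') (b p) (b p')"] B5A] by metis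
    have CA: "C \<in> subs A" using subs_mono[OF subs_subset[OF B5A] B6(1)] .
    have C5: "X \<in> subs B5" if "X \<in> subs C" for X using subs_mono[OF subs_subset[OF B6(1)] that] .
    have C4: "X \<in> subs B4" if "X \<in> subs C" for X using subs_mono[OF subs_subset[OF B5(1)] C5[OF that]] .
    have C3: "X \<in> subs B3" if "X \<in> subs C" for X using subs_mono[OF subs_subset[OF B4(1)] C4[OF that]] .
    have C2: "X \<in> subs B2" if "X \<in> subs C" for X using subs_mono[OF subs_subset[OF B3(1)] C3[OF that]] .
    have C1: "X \<in> subs B1" if "X \<in> subs C" for X using subs_mono[OF subs_subset[OF B2(1)] C2[OF that]] .
    have XA: "X \<in> subs A" if "X \<in> subs C" for X using subs_mono[OF subs_subset[OF CA] that] .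
    have contC: "loc_const C (\<lambda>X. q (P X))" for q :: "_ \<Rightarrow> 'z" by (rule loc_const_comp[OF loc_const_mono[OF cP CA]])
    have chs: "a p \<in> ch1 (fst p)" "b p \<in> ch1 (fst p)" for p unfolding a_def b_def ch1_def by auto
    show "(\<exists>B\<in>subs A. \<exists>h. bad le B h \<and> (\<forall>X\<in>subs B. h X \<in> ch1 (fst (P X)) - snd (P X))) \<or>
       (\<exists>B\<in>subs A. \<exists>h. bad gle B h \<and> (\<forall>X\<in>subs B. h X \<in> lab1 (fst (P X))))"
    proof (cases "r5 \<and> r6")
      case False
      then have "(\<exists>h. bad le C h \<and> (\<forall>X\<in>subs C. h X \<in> ch1 (fst (P X)) - snd (P X)))"
      proof -
        have "\<exists>q. (\<forall>p. q p \<in> ch1 (fst p)) \<and> (\<exists>r. \<forall>X\<in>subs C. (q (P X) \<in> snd (P X)) = r \<and>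
              \<not> marked_le (snd (P X)) (snd (P (shift X))) (q (P X)) (q (P (shift X))))"
        proof (cases r5)
          case F5: False
          show ?thesis
          proof (intro exI[of _ a] conjI exI[of _ r3] allI ballI)
            fix X assume X: "X \<in> subs C"
            show "(a (P X) \<in> snd (P X)) = r3" by (rule B3(2)[OF C3[OF X]])
            show "\<not> marked_le (snd (P X)) (snd (P (shift X))) (a (P X)) (a (P (shift X)))"
              using B5(2)[OF C5[OF X]] F5 by simp
          qed (rule chs)
        next
          case True
          show ?thesis
          proof (intro exI[of _ b] conjI exI[of _ r4] allI ballI)
            fix X assume X: "X \<in> subs C"
            show "(b (P X) \<in> snd (P X)) = r4" by (rule B4(2)[OF C4[OF X]])
            show "\<not> marked_le (snd (P X)) (snd (P (shift X))) (b (P X)) (b (P (shift X)))"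
              using B6(2)[OF X] True False by simp
          qed (rule chs)
        qed
        then obtain q r where q: "\<And>p. q p \<in> ch1 (fst p)" "\<And>X. X \<in> subs C \<Longrightarrow> (q (P X) \<in> snd (P X)) = r"
           "\<And>X. X \<in> subs C \<Longrightarrow> \<not> marked_le (snd (P X)) (snd (P (shift X))) (q (P X)) (q (P (shift X)))" by blast
        \<comment> \<open>Two marked children always match, so the child that fails to match is
          unmarked.\<close>
        have nr: "\<not> r"
          using q(2,3)[of C] q(2)[OF shift_subs, of C] self_subs[OF subs_infinite[OF CA]] unfolding marked_le_def by blast
        have "bad le C (\<lambda>X. q (P X))"
          unfolding bad_def
        proof (intro conjI ballI contC)
          fix X assume X: "X \<in> subs C"
          show "\<not> le (q (P X)) (q (P (shift X)))"
            using q(3)[OF X] q(2)[OF X] q(2)[OF shift_subs[OF X]] nr unfolding marked_le_def by blast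
        qed
        then show ?thesis using q(1,2) nr by blast
      qed
      then show ?thesis using CA by blast
    next
      case True
      have k: "\<not> (m (P X) \<or> gle (g (P X)) (g (P (shift X))))" if X: "X \<in> subs C" for X
        using nlm[OF XA[OF X]] B1(2)[OF C1[OF X]] B1(2)[OF C1[OF shift_subs[OF X]]]
          B2(2)[OF C2[OF X]] B2(2)[OF C2[OF shift_subs[OF X]]] B5(2)[OF C5[OF X]] B6(2)[OF X] True
        unfolding lm_iff by blast
      have "bad gle C (\<lambda>X. g (P X))"
        unfolding bad_def using contC[of g] k by blast
      moreover have "g (P X) \<in> lab1 (fst (P X))" if "X \<in> subs C" for X
        using k[OF that] unfolding g_def m_def lab1_def by (auto split: prod.splits)
      ultimately show ?thesis using CA by blast
    qed
  qed
qed

section \<open>Second level: vertex sets, decomposed after the choice of one of their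
  vertices\<close>

definition ctxsim :: "('a \<Rightarrow> 'a \<Rightarrow> bool) \<Rightarrow> ('a set \<Rightarrow> 'a set \<Rightarrow> bool) \<Rightarrow> ('a ctx \<Rightarrow> 'a ctx \<Rightarrow> bool) \<Rightarrow> bool" where
  "ctxsim E R T \<longleftrightarrow> (\<forall>k k'. T k k' \<longrightarrow> (\<forall>(e, A, k1, k2)\<in>decomp E k. \<exists>(e', A', k1', k2')\<in>decomp E k'.
      e = e' \<and> R A A' \<and> T k1 k1' \<and> T k2 k2'))"

definition L2 :: "('a \<Rightarrow> 'a \<Rightarrow> bool) \<Rightarrow> ('a set \<Rightarrow> 'a set \<Rightarrow> bool) \<Rightarrow> 'a ctx \<Rightarrow> 'a ctx \<Rightarrow> bool" where
  "L2 E R k k' \<longleftrightarrow> (\<exists>T. ctxsim E R T \<and> T k k')"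

definition ch2 where "ch2 E k = {A. \<exists>e k1 k2. (e, A, k1, k2) \<in> decomp E k}"

definition c2 :: "'a set \<Rightarrow> 'a ctx set" where "c2 A = (\<lambda>v. (v, A - {v})) ` A"

lemma ctxsimD:
  assumes "ctxsim E R T" "T k k'" "(e, A, k1, k2) \<in> decomp E k"
  obtains A' k1' k2' where "(e, A', k1', k2') \<in> decomp E k'" "R A A'" "T k1 k1'" "T k2 k2'"
  using assms unfolding ctxsim_def by blast

lemma ctxsimI:
  assumes "\<And>k k' e A k1 k2. T k k' \<Longrightarrow> (e, A, k1, k2) \<in> decomp E k \<Longrightarrow>
     \<exists>A' k1' k2'. (e, A', k1', k2') \<in> decomp E k' \<and> R A A' \<and> T k1 k1' \<and> T k2 k2'"
  shows "ctxsim E R T"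
  unfolding ctxsim_def using assms by fastforce

lemma coalg2: "coalg c2 (L2 E) (ch2 E) (\<subseteq>) (\<lambda>_. {} :: unit set)"
proof
  show "L2 E R' p p'" if L: "L2 E R p p'" and R: "\<And>a b. a \<in> ch2 E p \<Longrightarrow> b \<in> ch2 E p' \<Longrightarrow> R a b \<Longrightarrow> R' a b"
    for R R' p p'
  proof -
    obtain T where T: "ctxsim E R T" "T p p'" using L unfolding L2_def by blast
    define T' where "T' = (\<lambda>k k'. T k k' \<and> decomp E k \<subseteq> decomp E p \<and> decomp E k' \<subseteq> decomp E p')"
    have "ctxsim E R' T'"
    proof (rule ctxsimI)
      fix k k' e A k1 k2 assume a: "T' k k'" "(e, A, k1, k2) \<in> decomp E k"
      then obtain A' k1' k2' where *: "(e, A', k1', k2') \<in> decomp E k'" "R A A'" "T k1 k1'" "T k2 k2'"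
        using ctxsimD[OF T(1)] unfolding T'_def by metis
      have "R' A A'" using R[OF _ _ *(2)] a * unfolding ch2_def T'_def by blast
      moreover have "decomp E k1 \<subseteq> decomp E k" "decomp E k2 \<subseteq> decomp E k" "decomp E k1' \<subseteq> decomp E k'" "decomp E k2' \<subseteq> decomp E k'"
        using decomp_mono decompD[OF a(2)] decompD[OF *(1)] by metis+
      ultimately show "\<exists>A' k1' k2'. (e, A', k1', k2') \<in> decomp E k' \<and> R' A A' \<and> T' k1 k1' \<and> T' k2 k2'"
        using * a(1) unfolding T'_def by blast
    qed
    then show ?thesis using T(2) unfolding L2_def T'_def by blast
  qed
  show "L2 E (R OO R') p p''" if L: "L2 E R p p'" "L2 E R' p' p''" for R R' p p' p''
  proof -
    obtain T T' where T: "ctxsim E R T" "T p p'" "ctxsim E R' T'" "T' p' p''" using L unfolding L2_def by blast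
    have "ctxsim E (R OO R') (T OO T')"
    proof (rule ctxsimI)
      fix k k'' e A k1 k2 assume a: "(T OO T') k k''" "(e, A, k1, k2) \<in> decomp E k"
      then obtain k' where k': "T k k'" "T' k' k''" by blast
      obtain A' k1' k2' where *: "(e, A', k1', k2') \<in> decomp E k'" "R A A'" "T k1 k1'" "T k2 k2'"
        using ctxsimD[OF T(1) k'(1) a(2)] by metis
      obtain A'' k1'' k2'' where "(e, A'', k1'', k2'') \<in> decomp E k''" "R' A' A''" "T' k1' k1''" "T' k2' k2''"
        using ctxsimD[OF T(3) k'(2) *(1)] by metis
      then show "\<exists>A' k1' k2'. (e, A', k1', k2') \<in> decomp E k'' \<and> (R OO R') A A' \<and> (T OO T') k1 k1' \<and> (T OO T') k2 k2'"
        using * by blast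
    qed
    then show ?thesis using T unfolding L2_def by blast
  qed
  show "a \<subseteq> x" if "p \<in> c2 x" "a \<in> ch2 E p" for p x a
    using that unfolding c2_def ch2_def decomp_def by auto
  show "\<exists>p'\<in>c2 x. L2 E (=) p p' \<and> ({} :: unit set) \<subseteq> {}" if zx: "z \<subseteq> x" and p: "p \<in> c2 z" for z x p
  proof -
    obtain v where v: "p = (v, z - {v})" "v \<in> z" using p unfolding c2_def by blast
    define T where "T = (\<lambda>k k' :: 'a ctx. fst k = fst k' \<and> snd k \<subseteq> snd k')"
    have "ctxsim E (=) T"
    proof (rule ctxsimI)
      fix k k' e A k1 k2 assume "T k k'" "(e, A, k1, k2) \<in> decomp E k"
      then have "(e, A, k1, k2) \<in> decomp E k'" using decomp_mono unfolding T_def by blast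
      then show "\<exists>A' k1' k2'. (e, A', k1', k2') \<in> decomp E k' \<and> A = A' \<and> T k1 k1' \<and> T k2 k2'"
        unfolding T_def by blast
    qed
    moreover have "T p (v, x - {v})" using zx unfolding T_def v by auto
    ultimately have "L2 E (=) p (v, x - {v})" unfolding L2_def by blast
    then show ?thesis using v zx unfolding c2_def by blast
  qed
qed auto

definition le2 :: "('a \<Rightarrow> 'a \<Rightarrow> bool) \<Rightarrow> 'a set \<Rightarrow> 'a set \<Rightarrow> bool" where
  "le2 E = coalg.le c2 (L2 E)"

lemma le2_preorder: "reflp (le2 E)" "transp (le2 E)"
proof -
  interpret coalg c2 "L2 E" "ch2 E" "(\<subseteq>)" "\<lambda>_. {} :: unit set" by (rule coalg2)
  show "reflp (le2 E)" "transp (le2 E)"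
    unfolding le2_def using le_refl le_trans by (auto intro: reflpI transpI)
qed

definition le1 :: "('a \<Rightarrow> 'a \<Rightarrow> bool) \<Rightarrow> 'a ctx \<times> 'a set set \<Rightarrow> 'a ctx \<times> 'a set set \<Rightarrow> bool" where
  "le1 E = coalg.le (c1 E) (L1 (le2 E))"

lemma le1_step:
  assumes "le1 E (k, M) (k', M')" "(e, A, k1, k2) \<in> decomp E k"
  obtains A' k1' k2' where "(e, A', k1', k2') \<in> decomp E k'" "A \<in> M \<longleftrightarrow> A' \<in> M'" "A \<in> M \<or> le2 E A A'"
    "le1 E (k1, M) (k1', M')" "le1 E (k2, M) (k2', M')"
proof -
  interpret coalg "c1 E" "L1 (le2 E)" ch1 D1 lab1 by (rule coalg1[OF le2_preorder])
  have "((e, A, A \<in> M), (k1, M), (k2, M)) \<in> c1 E (k, M)" unfolding c1_def using assms(2) by force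
  then obtain p' where p': "p' \<in> c1 E (k', M')" "L1 (le2 E) le ((e, A, A \<in> M), (k1, M), (k2, M)) p'"
    using le_step assms(1) unfolding le1_def by blast
  then obtain e' A' k1' k2' where q: "(e', A', k1', k2') \<in> decomp E k'" "p' = ((e', A', A' \<in> M'), (k1', M'), (k2', M'))"
    unfolding c1_def by auto
  show thesis using that[of A' k1' k2'] p'(2) q(1) unfolding q(2) L1_def le1_def by auto
qed

text \<open>With the upper-level marks stored in its second component, the order on chains is itself
  a context simulation for the marked relation on nodes. So a bad array of marked decompositions of
  vertex sets is also bad for \<open>le1\<close>.\<close>

lemma le1_L2:
  assumes "le1 E (k, M) (k', M')"
    and "\<And>A A'. A \<in> M \<longleftrightarrow> A' \<in> M' \<Longrightarrow> A \<in> M \<or> le2 E A A' \<Longrightarrow> R A A'"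
  shows "L2 E R k k'"
proof -
  have "ctxsim E R (\<lambda>k k'. le1 E (k, M) (k', M'))"
  proof (rule ctxsimI)
    fix k k' e A k1 k2 assume "le1 E (k, M) (k', M')" "(e, A, k1, k2) \<in> decomp E k"
    then obtain A' k1' k2' where "(e, A', k1', k2') \<in> decomp E k'" "A \<in> M \<longleftrightarrow> A' \<in> M'" "A \<in> M \<or> le2 E A A'"
      "le1 E (k1, M) (k1', M')" "le1 E (k2, M) (k2', M')" by (rule le1_step)
    then show "\<exists>A' k1' k2'. (e, A', k1', k2') \<in> decomp E k' \<and> R A A' \<and> le1 E (k1, M) (k1', M') \<and> le1 E (k2, M) (k2', M')"
      using assms(2) by blast
  qed
  then show ?thesis unfolding L2_def using assms(1) by blast
qed

lemma bad_le1:
  assumes "bad (le1 E) A F"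
    "\<And>X. X \<in> subs A \<Longrightarrow> bqo_on (ch2 E (fst (F X)) - snd (F X)) (le2 E)"
  shows "\<exists>B\<in>subs A. \<exists>h. bad (le2 E) B h \<and> (\<forall>X\<in>subs B. h X \<in> ch2 E (fst (F X)) - snd (F X))"
proof -
  interpret coalg_bqo "c1 E" "L1 (le2 E)" ch1 D1 lab1 "le2 E" by (rule coalg_bqo1[OF le2_preorder])
  have Lab: "Lab x = ch2 E (fst x) - snd x" for x
    unfolding Lab_def c1_def lab1_def ch2_def by (auto split: if_splits) blast
  show ?thesis using bad_labels[of A F] assms unfolding Lab le1_def by blast
qed

text \<open>The upper level has no labels of its own, so from a bad array \<open>bad_labels\<close>
  would produce an element of the empty set.\<close>

theorem bqo_le2: "bqo_on UNIV (le2 E)"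
proof -
  interpret coalg c2 "L2 E" "ch2 E" "(\<subseteq>)" "\<lambda>_. {} :: unit set" by (rule coalg2)
  interpret coalg_bqo c2 "L2 E" "ch2 E" "(\<subseteq>)" "\<lambda>_. {} :: unit set" "\<lambda>_ _. True"
  proof
    fix A P assume P: "bad marked_L A P"
      and bq: "\<And>X. X \<in> subs A \<Longrightarrow> bqo_on (ch2 E (fst (P X)) - snd (P X)) le"
    have marked_L: "marked_L p p'" if "le1 E p p'" for p p'
      using le1_L2[of E "fst p" "snd p" "fst p'" "snd p'" "marked_le (snd p) (snd p')"] that
      unfolding marked_L_def marked_le_def le2_def by auto
    have "bad (le1 E) A P" using P marked_L unfolding bad_def by blast
    then show "(\<exists>B\<in>subs A. \<exists>h. bad le B h \<and> (\<forall>X\<in>subs B. h X \<in> ch2 E (fst (P X)) - snd (P X))) \<or>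
       (\<exists>B\<in>subs A. \<exists>h. bad (\<lambda>_ _. True) B h \<and> (\<forall>X\<in>subs B. h X \<in> ({} :: unit set)))"
      using bad_le1[of E A P] bq unfolding le2_def by blast
  qed
  show ?thesis
    unfolding bqo_on_def
  proof
    assume "\<exists>A f. bad (le2 E) A f \<and> (\<forall>X\<in>subs A. f X \<in> UNIV)"
    then obtain A f where f: "bad le A f" unfolding le2_def by blast
    have "bqo_on (Lab x) (\<lambda>_ _. True)" for x unfolding bqo_on_def bad_def loc_const_def using self_subs by blast
    then obtain B h where "B \<in> subs A" "\<forall>X\<in>subs B. h X \<in> Lab (f X)" using bad_labels[OF f] by blast
    then show False using self_subs[of B] subs_infinite unfolding Lab_def by blast
  qed
qed

lemma bqo_wqo:
  assumes "bqo_on UNIV R" shows "\<exists>i j. i < j \<and> R (s i) (s (j::nat))"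
proof (rule ccontr)
  assume neg: "\<not> ?thesis"
  have "bad R UNIV (\<lambda>X. s (least X))"
    unfolding bad_def
  proof (intro conjI ballI)
    show "loc_const UNIV (\<lambda>X. s (least X))" using loc_const_mn[of UNIV s] by simp
    fix X :: "nat set" assume X: "X \<in> subs UNIV"
    obtain y where "y \<in> shift X" using subs_infinite[OF shift_subs[OF X]] infinite_nonempty by blast
    then have "least (shift X) \<in> shift X" by (rule least_in)
    then have "least X < least (shift X)" using least_le unfolding shift_def by (metis DiffE le_neq_implies_less singletonI)
    then show "\<not> R (s (least X)) (s (least (shift X)))" using neg by blast
  qed
  then show False using assms unfolding bqo_on_def by blast
qed

lemma wqo_le2: "\<exists>i j. i < j \<and> le2 E (s i) (s (j::nat))"
  by (rule bqo_wqo[OF bqo_le2])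

text \<open>The pointed version of the well-quasi-order, obtained with an empty set of marks. It
  compares parts of one chain above a fixed vertex while respecting adjacency to that
  vertex.\<close>

lemma wqo_L2: "\<exists>i j. i < j \<and> L2 E (le2 E) (s i) (s (j::nat))"
proof -
  have "bqo_on UNIV (le1 E)"
    unfolding bqo_on_def
  proof
    assume "\<exists>A f. bad (le1 E) A f \<and> (\<forall>X\<in>subs A. f X \<in> UNIV)"
    then obtain A f where f: "bad (le1 E) A f" by blast
    have "\<exists>B\<in>subs A. \<exists>h. bad (le2 E) B h \<and> (\<forall>X\<in>subs B. h X \<in> ch2 E (fst (f X)) - snd (f X))"
      by (rule bad_le1[OF f]) (rule bqo_on_subset[OF bqo_le2], simp)
    then show False using bqo_le2[of E] unfolding bqo_on_def by blast
  qed
  then obtain i j where "i < j" "le1 E (s i, {}) (s j, {})" using bqo_wqo[of "le1 E" "\<lambda>i. (s i, {})"] by blast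
  then show ?thesis using le1_L2[of E "s i" "{}" "s j" "{}" "le2 E"] by blast
qed

section \<open>From simulations to embeddings\<close>

text \<open>Tail recursion yields the equation unconditionally. Whether the search ends depends on
  the vertex \<open>w\<close>; where it is used, this follows from the decrease of
  \<open>ms\<close>.\<close>

partial_function (tailrec) search ::
  "('s \<Rightarrow> 'w \<Rightarrow> bool) \<Rightarrow> ('s \<Rightarrow> 'w \<Rightarrow> 'r) \<Rightarrow> ('s \<Rightarrow> 'w \<Rightarrow> 's) \<Rightarrow> 's \<Rightarrow> 'w \<Rightarrow> 'r" where
  "search res out nx s w = (if res s w then out s w else search res out nx (nx s w) w)"

lemma le2_step:
  assumes "le2 E A A'" "u \<in> A"
  obtains u' where "u' \<in> A'" "L2 E (le2 E) (u, A - {u}) (u', A' - {u'})"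
proof -
  interpret coalg c2 "L2 E" "ch2 E" "(\<subseteq>)" "\<lambda>_. {} :: unit set" by (rule coalg2)
  have "(u, A - {u}) \<in> c2 A" using assms(2) unfolding c2_def by blast
  then obtain k where k: "k \<in> c2 A'" "L2 E (le2 E) (u, A - {u}) k"
    using le_step assms(1) unfolding le2_def by blast
  then show thesis using that unfolding c2_def by blast
qed

section \<open>The order of the nodes above a vertex\<close>

locale p4_free =
  fixes V :: "'a set" and E :: "'a \<Rightarrow> 'a \<Rightarrow> bool"
  assumes cntV: "countable V" and sym: "E x y \<Longrightarrow> E y x" and irr: "\<not> E x x"
    and p4: "\<lbrakk>a \<in> V; b \<in> V; c \<in> V; d \<in> V; E a b; E b c; E c d; \<not> E a c; \<not> E a d; \<not> E b d\<rbrakk> \<Longrightarrow> False"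
begin

lemma symE: "E x y = E y x" using sym by blast

text \<open>\<open>below S v u w\<close>: seen from \<open>v\<close>, the vertex \<open>u\<close> branches off below \<open>w\<close> in the cotree of \<open>S\<close>.\<close>

definition below :: "'a set \<Rightarrow> 'a \<Rightarrow> 'a \<Rightarrow> 'a \<Rightarrow> bool" where
  "below S v u w \<longleftrightarrow> (if E v u \<noteq> E v w then E u w = E v w
     else \<exists>t\<in>S - {v}. E v t \<noteq> E v u \<and> E u t = E v t \<and> E t w = E v w)"

text \<open>Colours alternate along a path of the cotree, so two vertices of equal colour at
  different nodes are separated by some \<open>t\<close> of the other colour. With such a
  \<open>t\<close>, a wrong value of \<open>E u w\<close> would complete an induced path on
  \<open>v\<close>, \<open>u\<close>, \<open>w\<close>, \<open>t\<close>.\<close>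

lemma below_E:
  assumes S: "S \<subseteq> V" "v \<in> V" "u \<in> S" "w \<in> S" and lt: "below S v u w"
  shows "E u w = E v w"
proof (cases "E v u = E v w")
  case True
  then obtain t where t: "t \<in> S" "E v t \<noteq> E v u" "E u t = E v t" "E t w = E v w"
    using lt unfolding below_def by auto
  have "t \<in> V" "u \<in> V" "w \<in> V" using t S by auto
  then show ?thesis using p4[of u v w t] p4[of v t u w] S t True symE by metis
qed (use lt in \<open>auto simp: below_def\<close>)

lemma below_neq: "below S v u w \<Longrightarrow> u \<noteq> w"
  unfolding below_def using symE by metis

text \<open>Four vertices of alternating colours lying cyclically below one another would produce an
  induced path. Asymmetry and negative transitivity of \<open>below\<close> both rest on
  this.\<close>

lemma no_cycle:
  assumes V: "v \<in> V" "u \<in> V" "w \<in> V" "t \<in> V" "s \<in> V"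
    and l: "E v u = e" "E v w = e" "E v t \<noteq> e" "E v s \<noteq> e"
    and c: "E u t = E v t" "E t w = E v w" "E w s = E v s" "E s u = E v u"
  shows False
proof -
  have uw: "E u w = e" using p4[of u v w t] p4[of v t u w] V l c symE by metis
  show False
  proof (cases e)
    case True
    then show False using p4[of t w u s] p4[of v u s t] V l c uw symE by metis
  next
    case False
    then show False using p4[of w s t u] p4[of s v t u] V l c uw symE by metis
  qed
qed

lemma below_asym:
  assumes S: "S \<subseteq> V" "v \<in> V" "u \<in> S" "w \<in> S" and lt: "below S v u w" "below S v w u"
  shows False
proof (cases "E v u = E v w")
  case True
  obtain t where t: "t \<in> S" "E v t \<noteq> E v u" "E u t = E v t" "E t w = E v w"
    using lt(1) True unfolding below_def by auto
  obtain s where s: "s \<in> S" "E v s \<noteq> E v w" "E w s = E v s" "E s u = E v u"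
    using lt(2) True unfolding below_def by auto
  show False by (rule no_cycle[of v u w t s "E v u"]) (use S t s True in auto)
qed (use lt symE in \<open>auto simp: below_def\<close>)

text \<open>Negative transitivity. Together with \<open>below_asym\<close> it makes
  \<open>below S v\<close> a strict weak order on \<open>S - {v}\<close>, and its incomparability
  classes are the nodes.\<close>

lemma below_cases:
  assumes S: "S \<subseteq> V" "v \<in> V" "u \<in> S - {v}" "w \<in> S - {v}" "z \<in> S - {v}" and lt: "below S v u w"
  shows "below S v u z \<or> below S v z w"
proof (cases "E v u = E v w")
  case False
  then have uw: "E u w = E v w" using lt unfolding below_def by simp
  show ?thesis
  proof (cases "E v z = E v w")
    case True
    show ?thesis
    proof (cases "E u z = E v z")
      case Fz: False
      then have "E z u = E v u" using False True symE[of u z] by blast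
      then have "below S v z w" using S(3) False True uw unfolding below_def by auto
      then show ?thesis ..
    qed (use False True in \<open>auto simp: below_def\<close>)
  next
    case F2: False
    show ?thesis
    proof (cases "E z w = E v w")
      case Fz: False
      then have "E w z = E v z" using F2 symE[of w z] by blast
      then have "below S v u z" using S(4) False F2 uw unfolding below_def by auto
      then show ?thesis ..
    qed (use F2 in \<open>auto simp: below_def\<close>)
  qed
next
  case True
  obtain t where t: "t \<in> S - {v}" "E v t \<noteq> E v u" "E u t = E v t" "E t w = E v w"
    using lt True unfolding below_def by auto
  show ?thesis
  proof (cases "E v z = E v u")
    case zu: True
    show ?thesis
    proof (cases "E t z = E v z")
      case True then show ?thesis using t zu unfolding below_def by auto
    next
      case False
      then have "E z t = E v t" using t zu symE by metis
      then show ?thesis using t zu True unfolding below_def by auto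
    qed
  next
    case zu: False
    show ?thesis
    proof (rule ccontr)
      assume "\<not> ?thesis"
      then have "E u z \<noteq> E v z" "E z w \<noteq> E v w" using zu True unfolding below_def by auto
      then have "E w z = E v z" "E z u = E v u" using zu True symE by metis+
      then show False by (intro no_cycle[of v u w t z "E v u"]) (use S t True zu in auto)
    qed
  qed
qed

lemma below_trans:
  assumes S: "S \<subseteq> V" "v \<in> V" "u \<in> S - {v}" "w \<in> S - {v}" "z \<in> S - {v}" and lt: "below S v u w" "below S v w z"
  shows "below S v u z"
  using below_cases[OF S lt(1)] below_asym[OF S(1,2) _ _ lt(2)] S by blast

definition same_node :: "'a set \<Rightarrow> 'a \<Rightarrow> 'a \<Rightarrow> 'a \<Rightarrow> bool" where
  "same_node S v u w \<longleftrightarrow> \<not> below S v u w \<and> \<not> below S v w u"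

lemma same_node_E: "same_node S v u w \<Longrightarrow> E v u = E v w"
  unfolding same_node_def below_def using symE[of u w] by (auto split: if_splits)

lemma same_node_refl: "same_node S v u u" unfolding same_node_def using below_neq by blast

lemma same_node_sym: "same_node S v u w \<Longrightarrow> same_node S v w u" unfolding same_node_def by blast

lemma same_node_trans:
  assumes S: "S \<subseteq> V" "v \<in> V" "u \<in> S - {v}" "w \<in> S - {v}" "z \<in> S - {v}" and e: "same_node S v u w" "same_node S v w z"
  shows "same_node S v u z"
  using below_cases[OF S(1,2,3,5,4)] below_cases[OF S(1,2,5,3,4)] e unfolding same_node_def by blast

lemma same_node_blw:
  assumes S: "S \<subseteq> V" "v \<in> V" "u \<in> S - {v}" "w \<in> S - {v}" "z \<in> S - {v}"
  shows "same_node S v u w \<Longrightarrow> below S v w z \<Longrightarrow> below S v u z" "same_node S v u w \<Longrightarrow> below S v z w \<Longrightarrow> below S v z u"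
  using below_cases[OF S(1,2,4,5,3)] below_cases[OF S(1,2,5,4,3)] unfolding same_node_def by blast+

definition lower where "lower S v K u = {w\<in>K. below S v w u}"
definition upper where "upper S v K u = {w\<in>K. below S v u w}"
definition node where "node S v K u = {w\<in>K. same_node S v w u}"

lemma node_dec:
  assumes S: "S \<subseteq> V" "v \<in> V" "K \<subseteq> S - {v}" "u \<in> K"
  shows "\<forall>w\<in>node S v K u. E v w = E v u" "stacked E v (lower S v K u) (node S v K u)"
    "stacked E v (node S v K u) (upper S v K u)" "stacked E v (lower S v K u) (upper S v K u)"
    "K = lower S v K u \<union> node S v K u \<union> upper S v K u"
proof -
  have KS: "x \<in> S - {v}" "x \<in> S" if "x \<in> K" for x using that S by auto
  show "\<forall>w\<in>node S v K u. E v w = E v u" unfolding node_def using same_node_E by blast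
  have *: "x \<noteq> y \<and> (E x y \<longleftrightarrow> E v y)" if "x \<in> K" "y \<in> K" "below S v x y" for x y
    using below_E[OF S(1,2) KS(2) KS(2)] below_neq that by blast
  show "stacked E v (lower S v K u) (node S v K u)"
    unfolding stacked_def
  proof (intro ballI)
    fix x y assume "x \<in> lower S v K u" "y \<in> node S v K u"
    then have "x \<in> K" "y \<in> K" "below S v x y"
      using same_node_blw(2)[OF S(1,2) KS(1) KS(1)[OF S(4)] KS(1), of y x] unfolding lower_def node_def by auto
    then show "x \<noteq> y \<and> (E x y \<longleftrightarrow> E v y)" using * by blast
  qed
  show "stacked E v (node S v K u) (upper S v K u)"
    unfolding stacked_def
  proof (intro ballI)
    fix x y assume "x \<in> node S v K u" "y \<in> upper S v K u"
    then have "x \<in> K" "y \<in> K" "below S v x y"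
      using same_node_blw(1)[OF S(1,2) KS(1) KS(1)[OF S(4)] KS(1), of x y] unfolding upper_def node_def by auto
    then show "x \<noteq> y \<and> (E x y \<longleftrightarrow> E v y)" using * by blast
  qed
  show "stacked E v (lower S v K u) (upper S v K u)"
    unfolding stacked_def
  proof (intro ballI)
    fix x y assume "x \<in> lower S v K u" "y \<in> upper S v K u"
    then have "x \<in> K" "y \<in> K" "below S v x y"
      using below_trans[OF S(1,2) KS(1) KS(1)[OF S(4)] KS(1), of x y] unfolding upper_def lower_def by auto
    then show "x \<noteq> y \<and> (E x y \<longleftrightarrow> E v y)" using * by blast
  qed
  show "K = lower S v K u \<union> node S v K u \<union> upper S v K u" unfolding lower_def node_def upper_def same_node_def by auto
qed

section \<open>Placing the nodes of a chain along an enumeration\<close>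

definition ix where "ix = to_nat_on V"

definition first_vertex where "first_vertex K = (SOME x. x \<in> K \<and> (\<forall>y\<in>K. ix x \<le> ix y))"

lemma first_vertex: "x \<in> K \<Longrightarrow> first_vertex K \<in> K" "x \<in> K \<Longrightarrow> ix (first_vertex K) \<le> ix x"
proof -
  assume "x \<in> K"
  then have "\<exists>x. x \<in> K \<and> (\<forall>y\<in>K. ix x \<le> ix y)" using ex_has_least_nat[of "\<lambda>x. x \<in> K" x ix] by blast
  from someI_ex[OF this] show "first_vertex K \<in> K" "ix (first_vertex K) \<le> ix x" unfolding first_vertex_def using \<open>x \<in> K\<close> by auto
qed

text \<open>The rank of \<open>x\<close> in \<open>K\<close> with respect to the enumeration of
  \<open>V\<close>. It is finite even for infinite \<open>K\<close>, and it drops whenever the first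
  vertex of \<open>K\<close> is removed, so it measures the search for a single vertex.\<close>

definition ms where "ms K x = card {z\<in>K. ix z \<le> ix x}"

lemma ms_less:
  assumes "K \<subseteq> V" "x \<in> K" "K' \<subseteq> K - {first_vertex K}" shows "ms K' x < ms K x"
  unfolding ms_def
proof (rule psubset_card_mono)
  have "inj_on ix V" unfolding ix_def using cntV by (rule inj_on_to_nat_on)
  then have "inj_on ix {z\<in>K. ix z \<le> ix x}" using assms(1) by (auto intro: inj_on_subset)
  then show "finite {z\<in>K. ix z \<le> ix x}"
    by (rule inj_on_finite[of _ _ "{..ix x}"]) auto
  show "{z\<in>K'. ix z \<le> ix x} \<subset> {z\<in>K. ix z \<le> ix x}" using assms first_vertex[OF assms(2)] by auto
qed

text \<open>A forth-only construction: cut at the first vertex of the enumeration, host its node,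
  and continue in the part below or above. Each vertex is reached after finitely many cuts, so all
  countable chains are covered, including dense ones.\<close>

lemma host:
  assumes v: "v \<in> V" and S: "S \<subseteq> V" and K0: "K0 \<subseteq> S - {v}" and T0: "T K0 K0'"
    and step: "\<And>K K' u. T K K' \<Longrightarrow> K \<subseteq> K0 \<Longrightarrow> u \<in> K \<Longrightarrow>
      \<exists>A' K1' K2'. A' \<subseteq> K' \<and> K1' \<subseteq> K' \<and> K2' \<subseteq> K' \<and> (\<forall>w\<in>A'. E v' w = E v u) \<and>
        stacked E v' K1' A' \<and> stacked E v' A' K2' \<and> stacked E v' K1' K2' \<and>
        R (node S v K u) A' \<and> T (lower S v K u) K1' \<and> T (upper S v K u) K2'"
  shows "\<exists>h. (\<forall>u\<in>K0. h u \<subseteq> K0' \<and> (\<forall>w\<in>h u. E v' w = E v u) \<and> R (node S v K0 u) (h u)) \<and>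
     (\<forall>u\<in>K0. \<forall>w\<in>K0. (below S v u w \<longrightarrow> stacked E v' (h u) (h w)) \<and> (same_node S v u w \<longrightarrow> h u = h w))"
proof -
  define ok where "ok = (\<lambda>K K' A' K1' K2'. A' \<subseteq> K' \<and> K1' \<subseteq> K' \<and> K2' \<subseteq> K' \<and> (\<forall>w\<in>A'. E v' w = E v (first_vertex K)) \<and>
        stacked E v' K1' A' \<and> stacked E v' A' K2' \<and> stacked E v' K1' K2' \<and>
        R (node S v K (first_vertex K)) A' \<and> T (lower S v K (first_vertex K)) K1' \<and> T (upper S v K (first_vertex K)) K2')"
  have "\<forall>K K'. \<exists>A' K1' K2'. T K K' \<and> K \<subseteq> K0 \<and> K \<noteq> {} \<longrightarrow> ok K K' A' K1' K2'"
  proof (intro allI)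
    fix K K' show "\<exists>A' K1' K2'. T K K' \<and> K \<subseteq> K0 \<and> K \<noteq> {} \<longrightarrow> ok K K' A' K1' K2'"
    proof (cases "T K K' \<and> K \<subseteq> K0 \<and> K \<noteq> {}")
      case True
      then have "first_vertex K \<in> K" using first_vertex(1) by auto
      then show ?thesis using step[of K K' "first_vertex K"] True unfolding ok_def by blast
    qed blast
  qed
  then obtain a k1 k2 where ok: "\<And>K K'. T K K' \<Longrightarrow> K \<subseteq> K0 \<Longrightarrow> K \<noteq> {} \<Longrightarrow> ok K K' (a K K') (k1 K K') (k2 K K')"
    by metis
  define res where "res = (\<lambda>(K, K' :: 'a set) w. same_node S v w (first_vertex K))"
  define out where "out = (\<lambda>(K, K') (w :: 'a). a K K')"
  define nx where "nx = (\<lambda>(K, K') w. if below S v w (first_vertex K) then (lower S v K (first_vertex K), k1 K K') else (upper S v K (first_vertex K), k2 K K'))"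
  define H where "H = (\<lambda>K K'. search res out nx (K, K'))"
  have H: "H K K' w = (if same_node S v w (first_vertex K) then a K K' else if below S v w (first_vertex K) then H (lower S v K (first_vertex K)) (k1 K K') w
       else H (upper S v K (first_vertex K)) (k2 K K') w)" for K K' w
    unfolding H_def by (subst search.simps) (simp add: res_def out_def nx_def)
  \<comment> \<open>The last clause says that \<open>K\<close> is a union of whole nodes of
    \<open>K0\<close>; hence a node computed inside \<open>K\<close> is a node of
    \<open>K0\<close>.\<close>
  define I where "I = (\<lambda>K K'. T K K' \<and> K \<subseteq> K0 \<and> (\<forall>x\<in>K. node S v K0 x \<subseteq> K))"
  have KS: "x \<in> S - {v}" if "x \<in> K0" for x using that K0 by blast
  have Ilo: "I (lower S v K (first_vertex K)) (k1 K K')" if I: "I K K'" and x: "x \<in> K" for K K' x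
  proof -
    have l: "first_vertex K \<in> K0" using first_vertex(1)[OF x] I unfolding I_def by blast
    have "node S v K0 y \<subseteq> lower S v K (first_vertex K)" if y: "y \<in> lower S v K (first_vertex K)" for y
    proof
      fix z assume z: "z \<in> node S v K0 y"
      have yK: "y \<in> K" "y \<in> K0" "z \<in> K" "z \<in> K0" "same_node S v z y" using y z I unfolding lower_def I_def node_def by auto
      then show "z \<in> lower S v K (first_vertex K)"
        using same_node_blw(1)[OF S v KS KS KS[OF l], of z y] y unfolding lower_def by blast
    qed
    then show ?thesis using ok[of K K'] I x unfolding I_def ok_def lower_def by blast
  qed
  have Iup: "I (upper S v K (first_vertex K)) (k2 K K')" if I: "I K K'" and x: "x \<in> K" for K K' x
  proof -
    have l: "first_vertex K \<in> K0" using first_vertex(1)[OF x] I unfolding I_def by blast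
    have "node S v K0 y \<subseteq> upper S v K (first_vertex K)" if y: "y \<in> upper S v K (first_vertex K)" for y
    proof
      fix z assume z: "z \<in> node S v K0 y"
      have yK: "y \<in> K" "y \<in> K0" "z \<in> K" "z \<in> K0" "same_node S v z y" using y z I unfolding upper_def I_def node_def by auto
      then show "z \<in> upper S v K (first_vertex K)"
        using same_node_blw(2)[OF S v KS KS KS[OF l], of z y] y unfolding upper_def by blast
    qed
    then show ?thesis using ok[of K K'] I x unfolding I_def ok_def upper_def by blast
  qed
  have lolst: "lower S v K (first_vertex K) \<subseteq> K - {first_vertex K}" "upper S v K (first_vertex K) \<subseteq> K - {first_vertex K}" for K
    unfolding lower_def upper_def using below_neq by blast+
  have KV: "K \<subseteq> V" if "I K K'" for K K' using that K0 S unfolding I_def by blast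
  have mslo: "ms (lower S v K (first_vertex K)) x < ms K x" "ms (upper S v K (first_vertex K)) x < ms K x" if "I K K'" "x \<in> K" for K K' x
    by (rule ms_less[OF KV[OF that(1)] that(2) lolst(1)], rule ms_less[OF KV[OF that(1)] that(2) lolst(2)])
  have okI: "ok K K' (a K K') (k1 K K') (k2 K K')" if "I K K'" "x \<in> K" for K K' x
  proof -
    have "T K K'" "K \<subseteq> K0" "K \<noteq> {}" using that unfolding I_def by auto
    then show ?thesis by (rule ok)
  qed
  have single: "H K K' x \<subseteq> K' \<and> (\<forall>w\<in>H K K' x. E v' w = E v x) \<and> R (node S v K0 x) (H K K' x)"
    if "I K K'" "x \<in> K" for K K' x
    using that
  proof (induction "ms K x" arbitrary: K K' rule: less_induct)
    case less
    define u where "u = first_vertex K"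
    have u: "u \<in> K" using first_vertex(1)[OF less.prems(2)] unfolding u_def .
    have oku: "ok K K' (a K K') (k1 K K') (k2 K K')" by (rule okI[OF less.prems(1,2)])
    consider "same_node S v x u" | "below S v x u" "\<not> same_node S v x u" | "below S v u x" "\<not> same_node S v x u" "\<not> below S v x u"
      unfolding same_node_def by blast
    then show ?case
    proof cases
      case 1
      have xK: "x \<in> K0" "u \<in> K0" using less.prems u unfolding I_def by auto
      have "node S v K u = node S v K0 x"
      proof (intro set_eqI iffI)
        fix z assume "z \<in> node S v K u"
        then have z: "z \<in> K" "z \<in> K0" "same_node S v z u" using less.prems unfolding node_def I_def by auto
        then show "z \<in> node S v K0 x"
          using same_node_trans[OF S v KS[OF z(2)] KS[OF xK(2)] KS[OF xK(1)]] same_node_sym[OF 1] unfolding node_def by blast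
      next
        fix z assume z0: "z \<in> node S v K0 x"
        then have z: "z \<in> K" "z \<in> K0" "same_node S v z x" using less.prems unfolding node_def I_def by auto
        then show "z \<in> node S v K u"
          using same_node_trans[OF S v KS[OF z(2)] KS[OF xK(1)] KS[OF xK(2)]] 1 unfolding node_def by blast
      qed
      moreover have "H K K' x = a K K'" using 1 unfolding u_def H[of K] by simp
      ultimately show ?thesis using oku same_node_E[OF 1] unfolding ok_def u_def by simp
    next
      case 2
      have Hx: "H K K' x = H (lower S v K u) (k1 K K') x" using 2 unfolding u_def H[of K] by simp
      have "x \<in> lower S v K u" using 2 less.prems unfolding lower_def by blast
      moreover have "I (lower S v K u) (k1 K K')" using Ilo less.prems unfolding u_def by blast
      moreover have "ms (lower S v K u) x < ms K x" using mslo(1)[OF less.prems(1,2)] unfolding u_def .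
      ultimately have "H K K' x \<subseteq> k1 K K' \<and> (\<forall>w\<in>H K K' x. E v' w = E v x) \<and> R (node S v K0 x) (H K K' x)"
        using less.hyps unfolding Hx by blast
      then show ?thesis using oku unfolding ok_def by blast
    next
      case 3
      have Hx: "H K K' x = H (upper S v K u) (k2 K K') x" using 3 unfolding u_def H[of K] by simp
      have "x \<in> upper S v K u" using 3 less.prems unfolding upper_def by blast
      moreover have "I (upper S v K u) (k2 K K')" using Iup less.prems unfolding u_def by blast
      moreover have "ms (upper S v K u) x < ms K x" using mslo(2)[OF less.prems(1,2)] unfolding u_def .
      ultimately have "H K K' x \<subseteq> k2 K K' \<and> (\<forall>w\<in>H K K' x. E v' w = E v x) \<and> R (node S v K0 x) (H K K' x)"
        using less.hyps unfolding Hx by blast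
      then show ?thesis using oku unfolding ok_def by blast
    qed
  qed
  have pair: "(below S v x y \<longrightarrow> stacked E v' (H K K' x) (H K K' y)) \<and> (same_node S v x y \<longrightarrow> H K K' x = H K K' y)"
    if "I K K'" "x \<in> K" "y \<in> K" for K K' x y
    using that
  proof (induction "ms K x" arbitrary: K K' rule: less_induct)
    case less
    define u where "u = first_vertex K"
    have u: "u \<in> K" using first_vertex(1)[OF less.prems(2)] unfolding u_def .
    have oku: "ok K K' (a K K') (k1 K K') (k2 K K')" by (rule okI[OF less.prems(1,2)])
    have sk: "stacked E v' (k1 K K') (a K K')" "stacked E v' (a K K') (k2 K K')" "stacked E v' (k1 K K') (k2 K K')"
      using oku unfolding ok_def by blast+
    have KS': "z \<in> S - {v}" if "z \<in> K" for z using that KS less.prems unfolding I_def by blast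
    note xyu = KS'[OF less.prems(2)] KS'[OF less.prems(3)] KS'[OF u]
    have Heq: "H K K' z = a K K'" if "same_node S v z u" for z using that unfolding u_def H[of K] by simp
    have Hlo: "H K K' z = H (lower S v K u) (k1 K K') z" if "below S v z u" for z
      using that unfolding u_def H[of K] same_node_def by simp
    have Hup: "H K K' z = H (upper S v K u) (k2 K K') z" if "below S v u z" "z \<in> K" for z
      using that below_asym[OF S v, of u z] KS' u unfolding u_def H[of K] same_node_def by auto
    have subl: "H K K' z \<subseteq> k1 K K'" if "below S v z u" "z \<in> K" for z
      using single[OF Ilo[OF less.prems(1,2)], of z] that Hlo unfolding u_def lower_def by auto
    have subu: "H K K' z \<subseteq> k2 K K'" if "below S v u z" "z \<in> K" for z
      using single[OF Iup[OF less.prems(1,2)], of z] that Hup unfolding u_def upper_def by auto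
    note ecl = same_node_blw[OF S v] note et = same_node_trans[OF S v] note lc = below_cases[OF S v] note la = below_asym[OF S v]
    consider (ee) "same_node S v x u" "same_node S v y u" | (el) "same_node S v x u" "below S v y u" | (eu) "same_node S v x u" "below S v u y"
      | (le) "below S v x u" "same_node S v y u" | (ll) "below S v x u" "below S v y u" | (lu) "below S v x u" "below S v u y"
      | (ue) "below S v u x" "same_node S v y u" | (ul) "below S v u x" "below S v y u" | (uu) "below S v u x" "below S v u y"
      unfolding same_node_def by blast
    then show ?case
    proof cases
      case ee
      then have "same_node S v x y" using et[OF xyu(1,3,2)] same_node_sym by blast
      then show ?thesis using Heq ee unfolding same_node_def by simp
    next
      case el
      then have "below S v y x" using ecl(2)[OF xyu(1,3,2)] by blast
      then show ?thesis using la[of x y] xyu unfolding same_node_def by blast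
    next
      case eu
      then have "below S v x y" using ecl(1)[OF xyu(1,3,2)] by blast
      moreover have "stacked E v' (H K K' x) (H K K' y)"
        using stacked_mono[OF sk(2) _ subu[OF eu(2)]] Heq[OF eu(1)] less.prems by simp
      ultimately show ?thesis unfolding same_node_def by blast
    next
      case le
      then have "below S v x y" using ecl(2)[OF xyu(2,3,1)] by blast
      moreover have "stacked E v' (H K K' x) (H K K' y)"
        using stacked_mono[OF sk(1) subl[OF le(1)]] Heq[OF le(2)] less.prems by simp
      ultimately show ?thesis unfolding same_node_def by blast
    next
      case ll
      have "ms (lower S v K u) x < ms K x" using mslo(1)[OF less.prems(1,2)] unfolding u_def .
      moreover have "I (lower S v K u) (k1 K K')" using Ilo less.prems unfolding u_def by blast
      moreover have "x \<in> lower S v K u" "y \<in> lower S v K u" using ll less.prems unfolding lower_def by auto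
      ultimately show ?thesis using less.hyps unfolding Hlo[OF ll(1)] Hlo[OF ll(2)] by blast
    next
      case lu
      then have "below S v x y" using below_trans[OF S v xyu(1,3,2)] by blast
      moreover have "stacked E v' (H K K' x) (H K K' y)"
        using stacked_mono[OF sk(3) subl[OF lu(1)] subu[OF lu(2)]] less.prems by blast
      ultimately show ?thesis unfolding same_node_def by blast
    next
      case ue
      then have "below S v y x" using ecl(1)[OF xyu(2,3,1)] by blast
      then show ?thesis using la[of x y] xyu unfolding same_node_def by blast
    next
      case ul
      then have "below S v y x" using below_trans[OF S v xyu(2,3,1)] by blast
      then show ?thesis using la[of x y] xyu unfolding same_node_def by blast
    next
      case uu
      have "ms (upper S v K u) x < ms K x" using mslo(2)[OF less.prems(1,2)] unfolding u_def .
      moreover have "I (upper S v K u) (k2 K K')" using Iup less.prems unfolding u_def by blast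
      moreover have "x \<in> upper S v K u" "y \<in> upper S v K u" using uu less.prems unfolding upper_def by auto
      ultimately show ?thesis using less.hyps unfolding Hup[OF uu(1) less.prems(2)] Hup[OF uu(2) less.prems(3)] by blast
    qed
  qed
  have I0: "I K0 K0'" using T0 unfolding I_def node_def by blast
  show ?thesis
  proof (rule exI[of _ "H K0 K0'"], intro conjI[OF ballI ballI[OF ballI]])
    fix u assume u: "u \<in> K0"
    show "H K0 K0' u \<subseteq> K0' \<and> (\<forall>w\<in>H K0 K0' u. E v' w = E v u) \<and> R (node S v K0 u) (H K0 K0' u)"
      by (rule single[OF I0 u])
    fix w assume w: "w \<in> K0"
    show "(below S v u w \<longrightarrow> stacked E v' (H K0 K0' u) (H K0 K0' w)) \<and> (same_node S v u w \<longrightarrow> H K0 K0' u = H K0 K0' w)"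
      by (rule pair[OF I0 u w])
  qed
qed

definition emb :: "'a set \<Rightarrow> 'a set \<Rightarrow> ('a \<Rightarrow> 'a) \<Rightarrow> bool" where
  "emb A B f \<longleftrightarrow> inj_on f A \<and> f ` A \<subseteq> B \<and> (\<forall>x\<in>A. \<forall>y\<in>A. E (f x) (f y) = E x y)"

definition pemb :: "'a \<Rightarrow> 'a \<Rightarrow> 'a set \<Rightarrow> 'a set \<Rightarrow> ('a \<Rightarrow> 'a) \<Rightarrow> bool" where
  "pemb v v' A B f \<longleftrightarrow> emb A B f \<and> (\<forall>x\<in>A. E v' (f x) = E v x)"

lemma L2_host:
  assumes v: "v \<in> V" and K: "K \<subseteq> V - {v}" and L: "L2 E R (v, K) (v', K')"
  shows "\<exists>h. (\<forall>u\<in>K. h u \<subseteq> K' \<and> (\<forall>w\<in>h u. E v' w = E v u) \<and> R (node V v K u) (h u)) \<and>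
     (\<forall>u\<in>K. \<forall>w\<in>K. (below V v u w \<longrightarrow> stacked E v' (h u) (h w)) \<and> (same_node V v u w \<longrightarrow> h u = h w))"
proof -
  obtain T where T: "ctxsim E R T" "T (v, K) (v', K')" using L unfolding L2_def by blast
  show ?thesis
  proof (rule host[OF v order_refl K, where T="\<lambda>K K'. T (v, K) (v', K')"])
    show "T (v, K) (v', K')" by fact
    fix L L' u assume L: "T (v, L) (v', L')" "L \<subseteq> K" "u \<in> L"
    have LV: "L \<subseteq> V - {v}" using L(2) K by blast
    note node = node_dec[OF order_refl v LV L(3)]
    have "lower V v L u \<subseteq> L" "node V v L u \<subseteq> L" "upper V v L u \<subseteq> L" unfolding lower_def node_def upper_def by auto
    then have "(E v u, node V v L u, (v, lower V v L u), (v, upper V v L u)) \<in> decomp E (v, L)"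
      unfolding decomp_def using node by simp
    from ctxsimD[OF T(1) L(1) this] obtain A' k1 k2 where
      *: "(E v u, A', k1, k2) \<in> decomp E (v', L')" "R (node V v L u) A'" "T (v, lower V v L u) k1" "T (v, upper V v L u) k2"
      by metis
    have "k1 = (v', snd k1)" "k2 = (v', snd k2)" using decompD[OF *(1)] by (simp_all add: prod_eq_iff)
    then show "\<exists>A' K1' K2'. A' \<subseteq> L' \<and> K1' \<subseteq> L' \<and> K2' \<subseteq> L' \<and> (\<forall>w\<in>A'. E v' w = E v u) \<and>
        stacked E v' K1' A' \<and> stacked E v' A' K2' \<and> stacked E v' K1' K2' \<and>
        R (node V v L u) A' \<and> T (v, lower V v L u) (v', K1') \<and> T (v, upper V v L u) (v', K2')"
      using * unfolding decomp_def by (intro exI[of _ A'] exI[of _ "snd k1"] exI[of _ "snd k2"]) auto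
  qed
qed

lemma le2_host:
  assumes AV: "A \<subseteq> V" and le: "le2 E A A'" and u: "u \<in> A"
  shows "\<exists>u' h. u' \<in> A' \<and> (\<forall>x\<in>A-{u}. h x \<subseteq> A' - {u'} \<and> (\<forall>w\<in>h x. E u' w = E u x) \<and> le2 E (node V u (A - {u}) x) (h x)) \<and>
     (\<forall>x\<in>A-{u}. \<forall>y\<in>A-{u}. (below V u x y \<longrightarrow> stacked E u' (h x) (h y)) \<and> (same_node V u x y \<longrightarrow> h x = h y))"
proof -
  obtain u' where u': "u' \<in> A'" "L2 E (le2 E) (u, A - {u}) (u', A' - {u'})" using le2_step[OF le u] .
  have "u \<in> V" "A - {u} \<subseteq> V - {u}" using u AV by auto
  from L2_host[OF this u'(2)] show ?thesis using u'(1) by blast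
qed

text \<open>The first vertex of \<open>A\<close> is sent to its match, and each node seen from that
  vertex is treated in the same way inside its host. Vertices of different nodes are placed
  correctly by stacking of the hosts, vertices of one node by recursion.\<close>

theorem le2_emb:
  assumes AV: "A0 \<subseteq> V" and le0: "le2 E A0 A0'"
  shows "\<exists>f. emb A0 A0' f"
proof -
  define I where "I = (\<lambda>A A'. A \<subseteq> V \<and> le2 E A A')"
  define ok where "ok = (\<lambda>A A' u u' h. u' \<in> A' \<and> (\<forall>x\<in>A-{u}. h x \<subseteq> A' - {u'} \<and> (\<forall>w\<in>h x. E u' w = E u x) \<and> le2 E (node V u (A - {u}) x) (h x)) \<and>
     (\<forall>x\<in>A-{u}. \<forall>y\<in>A-{u}. (below V u x y \<longrightarrow> stacked E u' (h x) (h y)) \<and> (same_node V u x y \<longrightarrow> h x = h y)))"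
  have "\<forall>A A'. \<exists>u' h. I A A' \<and> A \<noteq> {} \<longrightarrow> ok A A' (first_vertex A) u' h"
  proof (intro allI)
    fix A A' show "\<exists>u' h. I A A' \<and> A \<noteq> {} \<longrightarrow> ok A A' (first_vertex A) u' h"
    proof (cases "I A A' \<and> A \<noteq> {}")
      case True
      then have "first_vertex A \<in> A" "A \<subseteq> V" "le2 E A A'" using first_vertex(1) unfolding I_def by auto
      then show ?thesis using le2_host[of A A' "first_vertex A"] unfolding ok_def by blast
    qed blast
  qed
  then obtain b h where ok: "\<And>A A'. I A A' \<Longrightarrow> A \<noteq> {} \<Longrightarrow> ok A A' (first_vertex A) (b A A') (h A A')" by metis
  define res where "res = (\<lambda>(A, A' :: 'a set) w. w = first_vertex A)"
  define out where "out = (\<lambda>(A, A') (w :: 'a). b A A')"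
  define nx where "nx = (\<lambda>(A, A') w. (node V (first_vertex A) (A - {first_vertex A}) w, h A A' w))"
  define F where "F = (\<lambda>A A'. search res out nx (A, A'))"
  have F: "F A A' w = (if w = first_vertex A then b A A' else F (node V (first_vertex A) (A - {first_vertex A}) w) (h A A' w) w)" for A A' w
    unfolding F_def by (subst search.simps) (simp add: res_def out_def nx_def)
  have Inx: "I (node V (first_vertex A) (A - {first_vertex A}) w) (h A A' w)" "ms (node V (first_vertex A) (A - {first_vertex A}) w) w < ms A w"
    "w \<in> node V (first_vertex A) (A - {first_vertex A}) w"
    if "I A A'" "w \<in> A" "w \<noteq> first_vertex A" for A A' w
  proof -
    have n: "node V (first_vertex A) (A - {first_vertex A}) w \<subseteq> A - {first_vertex A}" unfolding node_def by blast
    then show "I (node V (first_vertex A) (A - {first_vertex A}) w) (h A A' w)" using ok[OF that(1)] that unfolding ok_def I_def by blast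
    show "ms (node V (first_vertex A) (A - {first_vertex A}) w) w < ms A w"
      by (rule ms_less[OF _ that(2) n]) (use that(1) in \<open>simp add: I_def\<close>)
    show "w \<in> node V (first_vertex A) (A - {first_vertex A}) w" using that same_node_refl unfolding node_def by blast
  qed
  have single: "F A A' x \<in> A'" if "I A A'" "x \<in> A" for A A' x
    using that
  proof (induction "ms A x" arbitrary: A A' rule: less_induct)
    case less
    have o: "ok A A' (first_vertex A) (b A A') (h A A')" using ok less.prems by blast
    show ?case
    proof (cases "x = first_vertex A")
      case True then show ?thesis using o unfolding ok_def F[of A] by simp
    next
      case False
      have "F A A' x \<in> h A A' x"
        using less.hyps Inx[OF less.prems False] False unfolding F[of A] by simp
      then show ?thesis using o less.prems False unfolding ok_def by blast
    qed
  qed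
  have inh: "F A A' x \<in> h A A' x" if "I A A'" "x \<in> A" "x \<noteq> first_vertex A" for A A' x
    using single[OF Inx(1,3)[OF that]] that unfolding F[of A] by simp
  have pair: "F A A' x \<noteq> F A A' y \<and> E (F A A' x) (F A A' y) = E x y" if "I A A'" "x \<in> A" "y \<in> A" "x \<noteq> y" for A A' x y
    using that
  proof (induction "ms A x" arbitrary: A A' rule: less_induct)
    case less
    define u where "u = first_vertex A"
    have o: "ok A A' u (b A A') (h A A')" using ok less.prems unfolding u_def by blast
    have uA: "u \<in> A" "A \<subseteq> V" "u \<in> V" using first_vertex(1)[OF less.prems(2)] less.prems(1) unfolding u_def I_def by auto
    have base: "F A A' z \<noteq> b A A' \<and> E (b A A') (F A A' z) = E u z" if "z \<in> A" "z \<noteq> u" for z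
      using o inh[OF less.prems(1), of z] that unfolding ok_def u_def by blast
    have Fu: "F A A' u = b A A'" unfolding u_def F[of A] by simp
    show ?case
    proof (cases "x = u \<or> y = u")
      case True
      then show ?thesis using base[of x] base[of y] Fu less.prems symE by metis
    next
      case False
      have xy: "x \<in> A - {u}" "y \<in> A - {u}" "x \<in> V - {u}" "y \<in> V - {u}" using False less.prems uA by auto
      have ih: "F A A' x \<in> h A A' x" "F A A' y \<in> h A A' y" using inh less.prems False unfolding u_def by auto
      have lab: "E (b A A') (F A A' x) = E u x" "E (b A A') (F A A' y) = E u y" using base xy by blast+
      have sk: "z \<noteq> w \<and> E z w = E (b A A') w" if "below V u p q" "p \<in> A - {u}" "q \<in> A - {u}" "z \<in> h A A' p" "w \<in> h A A' q" for p q z w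
        using o that unfolding ok_def stacked_def by blast
      consider "below V u x y" | "below V u y x" | "same_node V u x y" unfolding same_node_def by blast
      then show ?thesis
      proof cases
        case 1
        show ?thesis using sk[OF 1 xy(1,2) ih] lab below_E[OF order_refl uA(3) _ _ 1] xy by blast
      next
        case 2
        show ?thesis using sk[OF 2 xy(2,1) ih(2,1)] lab below_E[OF order_refl uA(3) _ _ 2] xy
            symE[of x y] symE[of "F A A' x" "F A A' y"] by auto
      next
        case 3
        have nde: "node V u (A - {u}) x = node V u (A - {u}) y"
        proof -
          have "same_node V u z x \<longleftrightarrow> same_node V u z y" if "z \<in> A - {u}" for z
          proof -
            have z: "z \<in> V - {u}" using that uA by blast
            show ?thesis using same_node_trans[OF order_refl uA(3) z xy(3,4)] same_node_trans[OF order_refl uA(3) z xy(4,3)] 3 same_node_sym by blast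
          qed
          then show ?thesis unfolding node_def by blast
        qed
        have he: "h A A' x = h A A' y" using o 3 xy unfolding ok_def by blast
        have Fx: "F A A' x = F (node V u (A - {u}) x) (h A A' x) x" "F A A' y = F (node V u (A - {u}) x) (h A A' x) y"
          using False unfolding u_def F[of A] by (simp_all add: nde[unfolded u_def] he)
        have "y \<in> node V u (A - {u}) x" using xy same_node_sym[OF 3] unfolding node_def by blast
        then show ?thesis
          using less.hyps[OF _ _ _ _ less.prems(4), of "node V u (A - {u}) x" "h A A' x"] Inx[OF less.prems(1,2)] False
          unfolding Fx u_def by blast
      qed
    qed
  qed
  have "I A0 A0'" using AV le0 unfolding I_def by blast
  then have "emb A0 A0' (F A0 A0')"
    unfolding emb_def
  proof (intro conjI ballI)
    show "inj_on (F A0 A0') A0" using pair[OF \<open>I A0 A0'\<close>] by (meson inj_onI)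
    show "F A0 A0' ` A0 \<subseteq> A0'" using single[OF \<open>I A0 A0'\<close>] by blast
    fix x y assume "x \<in> A0" "y \<in> A0"
    then show "E (F A0 A0' x) (F A0 A0' y) = E x y" using pair[OF \<open>I A0 A0'\<close>, of x y] irr by (cases "x = y") auto
  qed
  then show ?thesis by blast
qed

theorem L2_pemb:
  assumes v: "v \<in> V" and K: "K \<subseteq> V - {v}" and L: "L2 E (le2 E) (v, K) (v', K')"
  shows "\<exists>f. pemb v v' K K' f"
proof -
  from L2_host[OF v K L] obtain h where
    h1: "\<forall>u\<in>K. h u \<subseteq> K' \<and> (\<forall>w\<in>h u. E v' w = E v u) \<and> le2 E (node V v K u) (h u)" and
    h2: "\<forall>u\<in>K. \<forall>w\<in>K. (below V v u w \<longrightarrow> stacked E v' (h u) (h w)) \<and> (same_node V v u w \<longrightarrow> h u = h w)"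
    by (elim exE conjE)
  have h: "u \<in> K \<Longrightarrow> h u \<subseteq> K' \<and> (\<forall>w\<in>h u. E v' w = E v u) \<and> le2 E (node V v K u) (h u)"
     "u \<in> K \<Longrightarrow> w \<in> K \<Longrightarrow> below V v u w \<Longrightarrow> stacked E v' (h u) (h w)"
     "u \<in> K \<Longrightarrow> w \<in> K \<Longrightarrow> same_node V v u w \<Longrightarrow> h u = h w" for u w
    using h1 h2 by simp_all
  define g where "g = (\<lambda>N B. SOME f. emb N B f)"
  have g: "emb (node V v K u) (h u) (g (node V v K u) (h u))" if "u \<in> K" for u
  proof -
    have "node V v K u \<subseteq> V" using K unfolding node_def by blast
    then have "\<exists>f. emb (node V v K u) (h u) f" using le2_emb[of "node V v K u" "h u"] h(1)[OF that] by blast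
    from someI_ex[OF this] show ?thesis unfolding g_def .
  qed
  define f where "f = (\<lambda>u. g (node V v K u) (h u) u)"
  have KV: "u \<in> V - {v}" if "u \<in> K" for u using that K by blast
  have fh: "f u \<in> h u" if "u \<in> K" for u
    using g[OF that] that same_node_refl unfolding emb_def f_def node_def by auto
  have ndeq: "node V v K u = node V v K w" if uwK: "same_node V v u w" "u \<in> K" "w \<in> K" for u w
  proof -
    have "same_node V v z u \<longleftrightarrow> same_node V v z w" if z: "z \<in> K" for z
      using same_node_trans[OF order_refl v KV[OF z] KV[OF uwK(2)] KV[OF uwK(3)]]
        same_node_trans[OF order_refl v KV[OF z] KV[OF uwK(3)] KV[OF uwK(2)]] uwK(1) same_node_sym by blast
    then show ?thesis unfolding node_def by blast
  qed
  have pair: "f u \<noteq> f w \<and> E (f u) (f w) = E u w" if uw: "u \<in> K" "w \<in> K" "u \<noteq> w" for u w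
  proof -
    consider "below V v u w" | "below V v w u" | "same_node V v u w" unfolding same_node_def by blast
    then show ?thesis
    proof cases
      case 1
      have "f u \<noteq> f w \<and> E (f u) (f w) = E v' (f w)"
        using h(2)[OF uw(1,2) 1] fh[OF uw(1)] fh[OF uw(2)] unfolding stacked_def by blast
      moreover have "E v' (f w) = E v w" using h(1)[OF uw(2)] fh[OF uw(2)] by blast
      moreover have "E u w = E v w" using below_E[OF order_refl v _ _ 1] KV uw by blast
      ultimately show ?thesis by simp
    next
      case 2
      have "f w \<noteq> f u \<and> E (f w) (f u) = E v' (f u)"
        using h(2)[OF uw(2,1) 2] fh[OF uw(1)] fh[OF uw(2)] unfolding stacked_def by blast
      moreover have "E v' (f u) = E v u" using h(1)[OF uw(1)] fh[OF uw(1)] by blast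
      moreover have "E w u = E v u" using below_E[OF order_refl v _ _ 2] KV uw by blast
      ultimately show ?thesis using symE[of u w] symE[of "f u" "f w"] by auto
    next
      case 3
      have "f w = g (node V v K u) (h u) w" unfolding f_def using ndeq[OF 3 uw(1,2)] h(3)[OF uw(1,2) 3] by simp
      moreover have "w \<in> node V v K u" "u \<in> node V v K u" using uw same_node_sym[OF 3] same_node_refl unfolding node_def by auto
      ultimately show ?thesis using g[OF uw(1)] uw(3) unfolding emb_def f_def inj_on_def by metis
    qed
  qed
  have "pemb v v' K K' f"
    unfolding pemb_def emb_def
  proof (intro conjI ballI)
    show "inj_on f K" using pair by (meson inj_onI)
    show "f ` K \<subseteq> K'" using fh h(1) by blast
    show "E (f x) (f y) = E x y" if "x \<in> K" "y \<in> K" for x y using pair that irr by (cases "x = y") auto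
    show "E v' (f x) = E v x" if "x \<in> K" for x using fh h(1) that by blast
  qed
  then show ?thesis by blast
qed

theorem wqo_emb:
  assumes "\<And>i::nat. s i \<subseteq> V" shows "\<exists>i j f. i < j \<and> emb (s i) (s j) f"
  using wqo_le2[of E s] le2_emb[OF assms] by blast

theorem wqo_pemb:
  assumes "v \<in> V" "\<And>i::nat. s i \<subseteq> V - {v}" shows "\<exists>i j f. i < j \<and> pemb v v (s i) (s j) f"
  using wqo_L2[of E "\<lambda>i. (v, s i)"] L2_pemb[OF assms] by blast

end

section \<open>Thick copies\<close>

text \<open>Infinitely many indices whose element is below no later one would form a bad sequence.
  Beyond the last such index, transitivity carries every element arbitrarily far.\<close>

lemma wqo_tail:
  assumes wqo: "\<And>t::nat \<Rightarrow> 'b. (\<And>i. t i \<in> S) \<Longrightarrow> \<exists>i j. i < j \<and> R (t i) (t j)"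
    and tr: "\<And>x y z. R x y \<Longrightarrow> R y z \<Longrightarrow> R x z" and s: "\<And>i::nat. s i \<in> S"
  shows "\<exists>N. \<forall>n\<ge>N. \<forall>l. \<exists>m>l. R (s n) (s m)"
proof -
  define T where "T = {n. \<forall>m>n. \<not> R (s n) (s m)}"
  have "finite T"
  proof (rule ccontr)
    assume inf: "infinite T"
    have "\<exists>i j. i < j \<and> R (s (enumerate T i)) (s (enumerate T j))" by (rule wqo) (rule s)
    then obtain i j where ij: "i < j" "R (s (enumerate T i)) (s (enumerate T j))" by blast
    then have "enumerate T i < enumerate T j" using enumerate_mono inf by blast
    moreover have "enumerate T i \<in> T" using enumerate_in_set[OF inf] .
    ultimately show False using ij(2) unfolding T_def by blast
  qed
  then obtain N where N: "\<And>n. n \<in> T \<Longrightarrow> n < N" using finite_nat_set_iff_bounded by metis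
  have ex: "\<exists>m>n. R (s n) (s m)" if "N \<le> n" for n
    using N[of n] that unfolding T_def by auto
  have "\<exists>m>l. R (s n) (s m)" if n: "N \<le> n" for n l
  proof (induction l)
    case 0
    obtain m where "n < m" "R (s n) (s m)" using ex[OF n] by blast
    then show ?case by (intro exI[of _ m]) simp
  next
    case (Suc l)
    then obtain m where m: "l < m" "R (s n) (s m)" by blast
    obtain m0 where m0: "n < m0" "R (s n) (s m0)" using ex[OF n] by blast
    show ?case
    proof (cases "N \<le> m")
      case True
      then obtain m' where "m < m'" "R (s m) (s m')" using ex by blast
      then show ?thesis using m tr[OF m(2)] by (intro exI[of _ m']) simp
    next
      case False
      then have "Suc l < m0" using m n m0 by simp
      then show ?thesis using m0 by blast
    qed
  qed
  then show ?thesis by blast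
qed

text \<open>Each step passes the current point and one more point of an enumeration of
  \<open>L\<close>. The relation \<open>Q\<close> prescribes what the gap between consecutive points
  has to contain, and it must survive widening the gap.\<close>

lemma cofinal_seq:
  assumes cnt: "countable L" and ne: "a \<in> L"
    and tr: "\<And>x y z. x \<in> L \<Longrightarrow> y \<in> L \<Longrightarrow> z \<in> L \<Longrightarrow> o' x y \<Longrightarrow> o' y z \<Longrightarrow> o' x z"
    and neg: "\<And>x y z. x \<in> L \<Longrightarrow> y \<in> L \<Longrightarrow> z \<in> L \<Longrightarrow> o' x y \<Longrightarrow> o' x z \<or> o' z y"
    and nomax: "\<And>p. p \<in> L \<Longrightarrow> \<exists>w\<in>L. o' p w \<and> Q p w"
    and Qup: "\<And>p w w'. p \<in> L \<Longrightarrow> w \<in> L \<Longrightarrow> w' \<in> L \<Longrightarrow> Q p w \<Longrightarrow> o' w w' \<Longrightarrow> Q p w'"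
  shows "\<exists>u::nat \<Rightarrow> 'b. (\<forall>n. u n \<in> L \<and> o' (u n) (u (Suc n)) \<and> Q (u n) (u (Suc n))) \<and> (\<forall>x\<in>L. \<exists>n. o' x (u n))"
proof -
  define e where "e = from_nat_into L"
  have e: "e n \<in> L" for n unfolding e_def using ne by (metis empty_iff from_nat_into)
  have step: "\<exists>w. w \<in> L \<and> o' p w \<and> o' q w \<and> Q p w" if pq: "p \<in> L" "q \<in> L" for p q
  proof -
    obtain w where w: "w \<in> L" "o' p w" "Q p w" using nomax pq by blast
    show ?thesis
    proof (cases "o' q w")
      case False
      obtain w' where w': "w' \<in> L" "o' q w'" using nomax pq by blast
      have "o' w w'" using neg[OF pq(2) w'(1) w(1) w'(2)] False by blast
      then show ?thesis using tr[OF pq(1) w(1) w'(1) w(2)] Qup[OF pq(1) w(1) w'(1) w(3)] w' by blast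
    qed (use w in blast)
  qed
  have "\<exists>u. \<forall>n. u n \<in> L \<and> (u (Suc n) \<in> L \<and> o' (u n) (u (Suc n)) \<and> o' (e n) (u (Suc n)) \<and> Q (u n) (u (Suc n)))"
    by (rule dependent_nat_choice) (use ne step e in blast)+
  then obtain u where u: "\<forall>n. u n \<in> L \<and> (u (Suc n) \<in> L \<and> o' (u n) (u (Suc n)) \<and> o' (e n) (u (Suc n)) \<and> Q (u n) (u (Suc n)))"
    by (rule exE)
  have "\<exists>n. o' x (u n)" if x: "x \<in> L" for x
  proof -
    obtain n where "x = e n" unfolding e_def using from_nat_into_surj[OF cnt x] by metis
    then show ?thesis using u by blast
  qed
  then show ?thesis using u by blast
qed

section \<open>Contexts stacked above a fixed vertex\<close>

locale base = p4_free +
  fixes X :: "'a set" and v :: 'a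
  assumes XV: "X \<subseteq> V" and vX: "v \<in> X"
begin

lemma vV: "v \<in> V" using XV vX by blast

definition pointed_le :: "'a set \<Rightarrow> 'a set \<Rightarrow> bool" where "pointed_le K K' \<longleftrightarrow> (\<exists>f. pemb v v K K' f)"

abbreviation st where "st \<equiv> stacked E v"

lemma pointed_le_sub: "K \<subseteq> K' \<Longrightarrow> pointed_le K K'"
  unfolding pointed_le_def by (rule exI[of _ id]) (auto simp: pemb_def emb_def)

lemma stacked_UN1: "(\<And>i. i \<in> I \<Longrightarrow> st (A i) B) \<Longrightarrow> st (\<Union>i\<in>I. A i) B"
  unfolding stacked_def by blast

lemma stacked_UN2: "(\<And>i. i \<in> I \<Longrightarrow> st B (A i)) \<Longrightarrow> st B (\<Union>i\<in>I. A i)"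
  unfolding stacked_def by blast

lemma pointed_le_trans: "pointed_le K K' \<Longrightarrow> pointed_le K' K'' \<Longrightarrow> pointed_le K K''"
proof -
  assume "pointed_le K K'" "pointed_le K' K''"
  then obtain f g where f: "pemb v v K K' f" and g: "pemb v v K' K'' g" unfolding pointed_le_def by blast
  have sub: "f ` K \<subseteq> K'" using f unfolding pemb_def emb_def by blast
  have "pemb v v K K'' (g \<circ> f)"
    unfolding pemb_def emb_def
  proof (intro conjI ballI)
    show "inj_on (g \<circ> f) K" using f g sub unfolding pemb_def emb_def by (meson comp_inj_on inj_on_subset)
    show "(g \<circ> f) ` K \<subseteq> K''" using f g unfolding pemb_def emb_def by fastforce
    show "E ((g \<circ> f) x) ((g \<circ> f) y) = E x y" if "x \<in> K" "y \<in> K" for x y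
      using f g sub that unfolding pemb_def emb_def by (simp add: image_subset_iff)
    show "E v ((g \<circ> f) x) = E v x" if "x \<in> K" for x
      using f g sub that unfolding pemb_def emb_def by (simp add: image_subset_iff)
  qed
  then show ?thesis unfolding pointed_le_def by blast
qed

lemma pemb_stk:
  assumes f: "pemb v v K K' f" and T: "T1 \<subseteq> K" "T2 \<subseteq> K" "st T1 T2"
  shows "st (f ` T1) (f ` T2)"
  unfolding stacked_def
proof (intro ballI)
  fix u w assume "u \<in> f ` T1" "w \<in> f ` T2"
  then obtain x y where xy: "x \<in> T1" "y \<in> T2" "u = f x" "w = f y" by blast
  then have "x \<noteq> y" "E x y = E v y" "x \<in> K" "y \<in> K" using T unfolding stacked_def by auto
  then show "u \<noteq> w \<and> E u w = E v w" using f xy unfolding pemb_def emb_def inj_on_def by metis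
qed

lemma pemb_image: "pemb v v K K' f \<Longrightarrow> T \<subseteq> K \<Longrightarrow> pointed_le T (f ` T) \<and> f ` T \<subseteq> K'"
  unfolding pointed_le_def pemb_def emb_def
  by (intro conjI exI[of _ f]) (auto simp: subset_iff intro: inj_on_subset)

lemma glue:
  assumes K: "K \<subseteq> (\<Union>i\<in>I. Y i)" and pl: "\<And>i. i \<in> I \<Longrightarrow> pointed_le (Y i) (F i)"
    and sk: "\<And>i j. i \<in> I \<Longrightarrow> j \<in> I \<Longrightarrow> i \<noteq> j \<Longrightarrow> st (Y i) (Y j) \<and> st (F i) (F j) \<or> st (Y j) (Y i) \<and> st (F j) (F i)"
  shows "pointed_le K (\<Union>i\<in>I. F i)"
proof -
  have "\<forall>i. \<exists>g. i \<in> I \<longrightarrow> pemb v v (Y i) (F i) g" using pl unfolding pointed_le_def by blast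
  then obtain g where g: "\<And>i. i \<in> I \<Longrightarrow> pemb v v (Y i) (F i) (g i)" by metis
  define p where "p = (\<lambda>x. SOME i. i \<in> I \<and> x \<in> Y i)"
  have p: "p x \<in> I" "x \<in> Y (p x)" if "x \<in> K" for x
  proof -
    have "\<exists>i. i \<in> I \<and> x \<in> Y i" using K that by blast
    from someI_ex[OF this] show "p x \<in> I" "x \<in> Y (p x)" unfolding p_def by auto
  qed
  define f where "f = (\<lambda>x. g (p x) x)"
  have fF: "f x \<in> F (p x)" "E v (f x) = E v x" if "x \<in> K" for x
    using g[OF p(1)[OF that]] p(2)[OF that] unfolding f_def pemb_def emb_def by auto
  have pair: "f x \<noteq> f y \<and> E (f x) (f y) = E x y" if xy: "x \<in> K" "y \<in> K" "x \<noteq> y" for x y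
  proof (cases "p x = p y")
    case True
    then show ?thesis using g[OF p(1)[OF xy(1)]] p(2)[OF xy(1)] p(2)[OF xy(2)] xy(3)
      unfolding f_def pemb_def emb_def inj_on_def by metis
  next
    case False
    from sk[OF p(1)[OF xy(1)] p(1)[OF xy(2)] False] show ?thesis
    proof
      assume "st (Y (p x)) (Y (p y)) \<and> st (F (p x)) (F (p y))"
      then have "E x y = E v y" "f x \<noteq> f y" "E (f x) (f y) = E v (f y)"
        using p(2)[OF xy(1)] p(2)[OF xy(2)] fF(1)[OF xy(1)] fF(1)[OF xy(2)] unfolding stacked_def by blast+
      then show ?thesis using fF(2)[OF xy(2)] by simp
    next
      assume "st (Y (p y)) (Y (p x)) \<and> st (F (p y)) (F (p x))"
      then have "E y x = E v x" "f y \<noteq> f x" "E (f y) (f x) = E v (f x)"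
        using p(2)[OF xy(1)] p(2)[OF xy(2)] fF(1)[OF xy(1)] fF(1)[OF xy(2)] unfolding stacked_def by blast+
      then show ?thesis using fF(2)[OF xy(1)] symE[of x y] symE[of "f x" "f y"] by auto
    qed
  qed
  have "pemb v v K (\<Union>i\<in>I. F i) f"
    unfolding pemb_def emb_def
  proof (intro conjI ballI)
    show "inj_on f K" using pair by (meson inj_onI)
    show "f ` K \<subseteq> (\<Union>i\<in>I. F i)" using fF(1) p(1) by blast
    show "E (f x) (f y) = E x y" if "x \<in> K" "y \<in> K" for x y using pair that irr by (cases "x = y") auto
    show "E v (f x) = E v x" if "x \<in> K" for x using fF(2) that .
  qed
  then show ?thesis unfolding pointed_le_def by blast
qed

text \<open>In a set with this property no vertex forms, on its own, a node whose vertices are not adjacent to \<open>v\<close>.\<close>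

definition thick :: "'a set \<Rightarrow> bool" where
  "thick F \<longleftrightarrow> (\<forall>y\<in>F. \<not> E v y \<longrightarrow> (\<exists>u\<in>F. u \<noteq> y \<and> \<not> E v u \<and> (\<forall>t\<in>F. E v t \<longrightarrow> E t u = E t y)))"

text \<open>No vertex of one piece separates two vertices of another piece that have the same
  adjacency to \<open>v\<close>, so a companion found inside a piece remains one in the
  union.\<close>

lemma thick_UN:
  assumes d: "\<And>i. i \<in> I \<Longrightarrow> thick (F i)"
    and sk: "\<And>i j. i \<in> I \<Longrightarrow> j \<in> I \<Longrightarrow> i \<noteq> j \<Longrightarrow> st (F i) (F j) \<or> st (F j) (F i)"
  shows "thick (\<Union>i\<in>I. F i)"
  unfolding thick_def
proof (intro ballI impI)
  fix y assume "y \<in> (\<Union>i\<in>I. F i)" "\<not> E v y"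
  then obtain i where i: "i \<in> I" "y \<in> F i" by blast
  then obtain u where u: "u \<in> F i" "u \<noteq> y" "\<not> E v u" "\<And>t. t \<in> F i \<Longrightarrow> E v t \<Longrightarrow> E t u = E t y"
    using d \<open>\<not> E v y\<close> unfolding thick_def by blast
  have "E t u = E t y" if t: "t \<in> (\<Union>i\<in>I. F i)" "E v t" for t
  proof -
    obtain j where j: "j \<in> I" "t \<in> F j" using t by blast
    show ?thesis
    proof (cases "i = j")
      case False
      from sk[OF i(1) j(1) False] show ?thesis
      proof
        assume "st (F i) (F j)"
        then have "E u t = E v t" "E y t = E v t" using u i j unfolding stacked_def by auto
        then show ?thesis using symE by metis
      next
        assume "st (F j) (F i)"
        then show ?thesis using u i j \<open>\<not> E v y\<close> unfolding stacked_def by auto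
      qed
    qed (use u j t in auto)
  qed
  then show "\<exists>u\<in>\<Union>i\<in>I. F i. u \<noteq> y \<and> \<not> E v u \<and> (\<forall>t\<in>\<Union>i\<in>I. F i. E v t \<longrightarrow> E t u = E t y)"
    using u i by blast
qed

lemma thick_Un: "thick F \<Longrightarrow> thick G \<Longrightarrow> st F G \<Longrightarrow> thick (F \<union> G)"
  using thick_UN[of "{False, True}" "\<lambda>b. if b then G else F"] by (auto simp: Un_commute)

lemma thick_image:
  assumes f: "pemb v v K K' f" and F: "F \<subseteq> K" "thick F" shows "thick (f ` F)"
  unfolding thick_def
proof (intro ballI impI)
  fix y assume "y \<in> f ` F" "\<not> E v y"
  then obtain x where x: "x \<in> F" "y = f x" "\<not> E v x" using f F(1) unfolding pemb_def by auto
  then obtain u where u: "u \<in> F" "u \<noteq> x" "\<not> E v u" "\<forall>t\<in>F. E v t \<longrightarrow> E t u = E t x"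
    using F(2) unfolding thick_def by blast
  have e: "\<And>a b. a \<in> F \<Longrightarrow> b \<in> F \<Longrightarrow> E (f a) (f b) = E a b" "\<And>a. a \<in> F \<Longrightarrow> E v (f a) = E v a"
    using f F(1) unfolding pemb_def emb_def by (simp_all add: subset_iff)
  have "inj_on f K" using f unfolding pemb_def emb_def by blast
  then have "f u \<noteq> y" using inj_onD[of f K u x] F(1) u(1,2) x(1,2) by blast
  then show "\<exists>u\<in>f ` F. u \<noteq> y \<and> \<not> E v u \<and> (\<forall>t\<in>f ` F. E v t \<longrightarrow> E t u = E t y)"
    using u x e by (intro bexI[of _ "f u"]) auto
qed

fun stacked_copies :: "nat \<Rightarrow> 'a set \<Rightarrow> 'a set \<Rightarrow> bool" where
  "stacked_copies 0 K K' \<longleftrightarrow> True"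
| "stacked_copies (Suc n) K K' \<longleftrightarrow> (\<exists>T1 T2. T1 \<subseteq> K' \<and> T2 \<subseteq> K' \<and> st T1 T2 \<and> pointed_le K T1 \<and> stacked_copies n K T2)"

text \<open>A singleton node not adjacent to \<open>v\<close> contains no thick copy of itself.
  Allowing some fixed number of stacked copies makes the property hold for nodes, and under stacking
  of contexts these numbers add up.\<close>

definition good :: "'a set \<Rightarrow> bool" where
  "good K \<longleftrightarrow> (\<exists>n. \<forall>K'. stacked_copies n K K' \<longrightarrow> (\<exists>F\<subseteq>K'. pointed_le K F \<and> thick F))"

lemma stacked_copies_ple: "stacked_copies n K K' \<Longrightarrow> pointed_le L K \<Longrightarrow> stacked_copies n L K'"
proof (induction n arbitrary: K')
  case (Suc n)
  then obtain T1 T2 where T: "T1 \<subseteq> K'" "T2 \<subseteq> K'" "st T1 T2" "pointed_le K T1" "stacked_copies n K T2" by auto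
  have "pointed_le L T1" using pointed_le_trans Suc.prems(2) T(4) by blast
  then show ?case using T Suc.IH[OF T(5) Suc.prems(2)] by auto
qed simp

lemma stacked_copies_split: "stacked_copies (n + m) K K' \<Longrightarrow> \<exists>T1 T2. T1 \<subseteq> K' \<and> T2 \<subseteq> K' \<and> st T1 T2 \<and> stacked_copies n K T1 \<and> stacked_copies m K T2"
proof (induction n arbitrary: K')
  case 0
  then show ?case by (intro exI[of _ "{}"] exI[of _ K']) (auto simp: stacked_def)
next
  case (Suc n)
  then obtain T1 T2 where T: "T1 \<subseteq> K'" "T2 \<subseteq> K'" "st T1 T2" "pointed_le K T1" "stacked_copies (n + m) K T2" by auto
  obtain U1 U2 where U: "U1 \<subseteq> T2" "U2 \<subseteq> T2" "st U1 U2" "stacked_copies n K U1" "stacked_copies m K U2"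
    using Suc.IH[OF T(5)] by blast
  have "st (T1 \<union> U1) U2" using U T(3) unfolding stacked_def by blast
  moreover have "stacked_copies (Suc n) K (T1 \<union> U1)"
    using T U stacked_mono[OF T(3) order_refl U(1)] by auto
  ultimately show ?case using T U by (intro exI[of _ "T1 \<union> U1"] exI[of _ U2]) auto
qed

lemma good_Un:
  assumes g: "good K1" "good K2" and s: "st K1 K2" shows "good (K1 \<union> K2)"
proof -
  obtain n where n: "\<And>K'. stacked_copies n K1 K' \<Longrightarrow> \<exists>F\<subseteq>K'. pointed_le K1 F \<and> thick F" using g(1) unfolding good_def by blast
  obtain m where m: "\<And>K'. stacked_copies m K2 K' \<Longrightarrow> \<exists>F\<subseteq>K'. pointed_le K2 F \<and> thick F" using g(2) unfolding good_def by blast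
  have "\<exists>F\<subseteq>K'. pointed_le (K1 \<union> K2) F \<and> thick F" if K': "stacked_copies (n + m) (K1 \<union> K2) K'" for K'
  proof -
    obtain T1 T2 where T: "T1 \<subseteq> K'" "T2 \<subseteq> K'" "st T1 T2" "stacked_copies n (K1 \<union> K2) T1" "stacked_copies m (K1 \<union> K2) T2"
      using stacked_copies_split[OF K'] by blast
    have "stacked_copies n K1 T1" by (rule stacked_copies_ple[OF T(4)]) (rule pointed_le_sub, simp)
    moreover have "stacked_copies m K2 T2" by (rule stacked_copies_ple[OF T(5)]) (rule pointed_le_sub, simp)
    ultimately obtain F1 F2 where F: "F1 \<subseteq> T1" "pointed_le K1 F1" "thick F1" "F2 \<subseteq> T2" "pointed_le K2 F2" "thick F2"
      using n[of T1] m[of T2] by blast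
    have sF: "st F1 F2" using stacked_mono[OF T(3) F(1,4)] .
    have "pointed_le (K1 \<union> K2) (\<Union>b\<in>{False, True}. if b then F2 else F1)"
      by (rule glue[where Y="\<lambda>b. if b then K2 else K1"]) (use F sF s in auto)
    then have "pointed_le (K1 \<union> K2) (F1 \<union> F2)" by (simp add: Un_commute)
    then show ?thesis using thick_Un[OF F(3,6) sF] F T by (intro exI[of _ "F1 \<union> F2"]) auto
  qed
  then show ?thesis unfolding good_def by blast
qed

lemma good_empty: "good {}"
  unfolding good_def by (rule exI[of _ 0]) (auto intro!: exI[of _ "{}"] simp: thick_def pointed_le_def pemb_def emb_def)

lemma node_thick:
  assumes N: "x \<in> N" "\<And>w. w \<in> N \<Longrightarrow> E v w = e" and p: "pointed_le N T1" "pointed_le N T2" and s: "st T1 T2"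
  shows "\<exists>F\<subseteq>T1 \<union> T2. pointed_le N F \<and> thick F \<and> (\<forall>w\<in>F. E v w = e)"
proof -
  obtain f g where f: "pemb v v N T1 f" and g: "pemb v v N T2 g" using p unfolding pointed_le_def by blast
  have fe: "E v (f w) = e" "f w \<in> T1" "E v (g w) = e" "g w \<in> T2" if "w \<in> N" for w
    using f g N(2) that unfolding pemb_def emb_def by auto
  \<comment> \<open>One vertex borrowed from the second copy is enough to give every vertex a
    companion, even if the node consists of a single vertex. All vertices share one colour, so
    nothing inside \<open>F\<close> separates them when that colour is \<open>False\<close>.\<close>
  define F where "F = f ` N \<union> {g x}"
  have "pointed_le N F" using f unfolding F_def pointed_le_def pemb_def emb_def by blast
  moreover have FT: "F \<subseteq> T1 \<union> T2" "\<forall>w\<in>F. E v w = e" unfolding F_def using fe N(1) by auto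
  moreover have "thick F"
  proof (cases e)
    case False
    have "g x \<noteq> f w" if "w \<in> N" for w using s fe N(1) that unfolding stacked_def by metis
    note ne = this
    have "\<exists>u\<in>F. u \<noteq> y" if "y \<in> F" for y
    proof (cases "y = g x")
      case True then show ?thesis using ne[OF N(1)] N(1) unfolding F_def by (intro bexI[of _ "f x"]) auto
    next
      case False then show ?thesis unfolding F_def by (intro bexI[of _ "g x"]) auto
    qed
    then show ?thesis using FT(2) False unfolding thick_def by metis
  qed (use FT in \<open>auto simp: thick_def\<close>)
  ultimately show ?thesis by blast
qed

lemma good_node:
  assumes "\<And>w. w \<in> N \<Longrightarrow> E v w = e" shows "good N"
proof (cases "N = {}")
  case False
  then obtain x where x: "x \<in> N" by blast
  have "\<exists>F\<subseteq>K'. pointed_le N F \<and> thick F" if K': "stacked_copies 2 N K'" for K'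
  proof -
    have "stacked_copies (Suc (Suc 0)) N K'" using K' by (simp add: numeral_2_eq_2)
    then obtain T1 T2 T3 where T: "T1 \<subseteq> K'" "T2 \<subseteq> K'" "st T1 T2" "pointed_le N T1" "T3 \<subseteq> T2" "pointed_le N T3" by auto
    have s13: "st T1 T3" by (rule stacked_mono[OF T(3) order_refl T(5)])
    obtain F where F: "F \<subseteq> T1 \<union> T3" "pointed_le N F" "thick F" using node_thick[OF x assms T(4,6) s13] by blast
    have "F \<subseteq> K'" using F(1) T by blast
    then show ?thesis using F by blast
  qed
  then show ?thesis unfolding good_def by blast
qed (simp add: good_empty)

abbreviation bl where "bl \<equiv> below X v"

lemma bl_stk:
  assumes "K1 \<subseteq> X - {v}" "K2 \<subseteq> X - {v}" "\<And>u w. u \<in> K1 \<Longrightarrow> w \<in> K2 \<Longrightarrow> bl u w"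
  shows "st K1 K2"
  unfolding stacked_def
proof (intro ballI)
  fix u w assume uw: "u \<in> K1" "w \<in> K2"
  then have b: "bl u w" by (rule assms(3))
  then show "u \<noteq> w \<and> E u w = E v w" using below_E[OF XV vV _ _ b] below_neq[OF b] uw assms by blast
qed

text \<open>As \<open>Y n\<close> embeds into \<open>Y m\<close> for arbitrarily large
  \<open>m\<close>, a long enough interval of indices holds the number of stacked copies that
  \<open>good\<close> requires. Disjoint consecutive intervals keep the resulting thick copies in
  order.\<close>

lemma blocks:
  fixes Y :: "nat \<Rightarrow> 'a set"
  assumes g: "\<And>n. good (Y n)" and rec: "\<And>n l. \<exists>m>l. pointed_le (Y n) (Y m)"
    and s: "\<And>i j. i < j \<Longrightarrow> if b then st (Y i) (Y j) else st (Y j) (Y i)"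
  shows "\<exists>F l. (\<forall>n. F n \<subseteq> (\<Union>m\<in>{l n<..l (Suc n)}. Y m) \<and> pointed_le (Y n) (F n) \<and> thick (F n)) \<and>
     (\<forall>n. n \<le> l n \<and> l n < l (Suc n)) \<and>
     (\<forall>i j. i < j \<longrightarrow> (if b then st (F i) (F j) else st (F j) (F i)))"
proof -
  define B where "B = (\<lambda>l l'. \<Union>m\<in>{l<..l'::nat}. Y m)"
  have BY: "Y m \<subseteq> B l l'" if "l < m" "m \<le> l'" for m l l'
    unfolding B_def by (rule UN_upper) (use that in simp)
  have BB: "B m m' \<subseteq> B l l'" if "l \<le> m" "m' \<le> l'" for m m' l l'
    unfolding B_def by (rule UN_mono) (use that in auto)
  have host: "\<exists>l'>l. stacked_copies k (Y n) (B l l')" for k n l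
  proof (induction k arbitrary: l)
    case 0 then show ?case by (auto intro: exI[of _ "Suc l"])
  next
    case (Suc k)
    show ?case
    proof (cases b)
      case True
      obtain m where m: "m > l" "pointed_le (Y n) (Y m)" using rec by blast
      obtain l' where l': "l' > m" "stacked_copies k (Y n) (B m l')" using Suc by blast
      have "st (Y m) (B m l')" unfolding B_def by (rule stacked_UN2) (use s[of m] True in auto)
      moreover have "Y m \<subseteq> B l l'" "B m l' \<subseteq> B l l'" using BY BB m(1) l'(1) by simp_all
      ultimately have "stacked_copies (Suc k) (Y n) (B l l')" using m(2) l'(2) by auto
      then show ?thesis using m l' by (meson less_trans)
    next
      case False
      obtain l' where l': "l' > l" "stacked_copies k (Y n) (B l l')" using Suc by blast
      obtain m where m: "m > l'" "pointed_le (Y n) (Y m)" using rec by blast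
      have "st (Y m) (B l l')" unfolding B_def by (rule stacked_UN2) (use s[of _ m] False m in auto)
      moreover have "Y m \<subseteq> B l m" "B l l' \<subseteq> B l m" using BY BB m(1) l'(1) by simp_all
      ultimately have "stacked_copies (Suc k) (Y n) (B l m)" using m(2) l'(2) by auto
      then show ?thesis using m l' by (meson less_trans)
    qed
  qed
  have "\<exists>l' F. l' > l \<and> F \<subseteq> B l l' \<and> pointed_le (Y n) F \<and> thick F" for n l
  proof -
    obtain k where k: "\<And>K'. stacked_copies k (Y n) K' \<Longrightarrow> \<exists>F\<subseteq>K'. pointed_le (Y n) F \<and> thick F" using g[of n] unfolding good_def by blast
    obtain l' where "l' > l" "stacked_copies k (Y n) (B l l')" using host by blast
    then show ?thesis using k by blast
  qed
  note ex = this
  have "\<exists>l. \<forall>n. True \<and> (l n < l (Suc n) \<and> (\<exists>F. F \<subseteq> B (l n) (l (Suc n)) \<and> pointed_le (Y n) F \<and> thick F))"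
    by (rule dependent_nat_choice) (use ex in blast)+
  then obtain l where l0: "\<forall>n. True \<and> (l n < l (Suc n) \<and> (\<exists>F. F \<subseteq> B (l n) (l (Suc n)) \<and> pointed_le (Y n) F \<and> thick F))"
    by (rule exE)
  then have l: "l n < l (Suc n)" for n by blast
  have "\<forall>n. \<exists>F. F \<subseteq> B (l n) (l (Suc n)) \<and> pointed_le (Y n) F \<and> thick F" using l0 by blast
  then obtain F where "\<forall>n. F n \<subseteq> B (l n) (l (Suc n)) \<and> pointed_le (Y n) (F n) \<and> thick (F n)" by (rule choice[THEN exE])
  then have F: "F n \<subseteq> B (l n) (l (Suc n)) \<and> pointed_le (Y n) (F n) \<and> thick (F n)" for n by blast
  have lmono: "i \<le> j \<Longrightarrow> l i \<le> l j" for i j by (rule lift_Suc_mono_le[of l]) (use l less_imp_le in blast)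
  have ln: "n \<le> l n" for n
  proof (induction n)
    case (Suc n) then show ?case using l[of n] by simp
  qed simp
  have "if b then st (F i) (F j) else st (F j) (F i)" if "i < j" for i j
  proof -
    have le: "l (Suc i) \<le> l j" using lmono that by simp
    have "if b then st (B (l i) (l (Suc i))) (B (l j) (l (Suc j))) else st (B (l j) (l (Suc j))) (B (l i) (l (Suc i)))"
    proof (cases b)
      case True
      have "st (B (l i) (l (Suc i))) (B (l j) (l (Suc j)))"
        unfolding B_def
      proof (intro stacked_UN1 stacked_UN2)
        fix p r assume "p \<in> {l i<..l (Suc i)}" "r \<in> {l j<..l (Suc j)}"
        then show "st (Y p) (Y r)" using s[of p r] le True by auto
      qed
      then show ?thesis using True by simp
    next
      case False
      have "st (B (l j) (l (Suc j))) (B (l i) (l (Suc i)))"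
        unfolding B_def
      proof (intro stacked_UN1 stacked_UN2)
        fix p r assume "p \<in> {l i<..l (Suc i)}" "r \<in> {l j<..l (Suc j)}"
        then show "st (Y r) (Y p)" using s[of p r] le False by auto
      qed
      then show ?thesis using False by simp
    qed
    then show ?thesis using stacked_mono[of E v _ _ "F i" "F j"] stacked_mono[of E v _ _ "F j" "F i"] F[of i] F[of j]
      by (auto split: if_splits)
  qed
  then show ?thesis using F l ln unfolding B_def by (intro exI[of _ F] exI[of _ l] conjI allI impI) simp_all
qed

lemma good_blocks:
  fixes Y :: "nat \<Rightarrow> 'a set"
  assumes g: "\<And>n. good (Y n)" and rec: "\<And>n l. \<exists>m>l. pointed_le (Y n) (Y m)"
    and s: "\<And>i j. i < j \<Longrightarrow> if b then st (Y i) (Y j) else st (Y j) (Y i)"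
  shows "good (\<Union>n. Y n)"
proof -
  have "\<exists>F l. (\<forall>n. F n \<subseteq> (\<Union>m\<in>{l n<..l (Suc n)}. Y m) \<and> pointed_le (Y n) (F n) \<and> thick (F n)) \<and>
     (\<forall>n. n \<le> l n \<and> l n < l (Suc n)) \<and>
     (\<forall>i j. i < j \<longrightarrow> (if b then st (F i) (F j) else st (F j) (F i)))"
    by (rule blocks[OF g rec]) (rule s)
  then obtain F l where F0: "\<forall>n. F n \<subseteq> (\<Union>m\<in>{l n<..l (Suc n)}. Y m) \<and> pointed_le (Y n) (F n) \<and> thick (F n)"
     and Fs0: "\<forall>i j. i < j \<longrightarrow> (if b then st (F i) (F j) else st (F j) (F i))"
    by (elim exE conjE)
  have F: "F n \<subseteq> (\<Union>m\<in>{l n<..l (Suc n)}. Y m)" "pointed_le (Y n) (F n)" "thick (F n)" for n using F0 by simp_all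
  have Fs: "i < j \<Longrightarrow> (if b then st (F i) (F j) else st (F j) (F i))" for i j using Fs0 by simp
  have p: "pointed_le (\<Union>n. Y n) (\<Union>n. F n)"
  proof (rule glue[where I=UNIV and Y=Y])
    show "st (Y i) (Y j) \<and> st (F i) (F j) \<or> st (Y j) (Y i) \<and> st (F j) (F i)" if "i \<noteq> j" for i j
      using s[of i j] s[of j i] Fs[of i j] Fs[of j i] that by (cases "i < j"; cases b) auto
  qed (use F in auto)
  have t: "thick (\<Union>n. F n)"
  proof (rule thick_UN)
    show "st (F i) (F j) \<or> st (F j) (F i)" if "i \<noteq> j" for i j
      using Fs[of i j] Fs[of j i] that by (cases "i < j"; cases b) auto
  qed (use F in auto)
  have FY: "(\<Union>n. F n) \<subseteq> (\<Union>n. Y n)" using F(1) by blast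
  have "\<exists>G\<subseteq>K'. pointed_le (\<Union>n. Y n) G \<and> thick G" if K': "stacked_copies 1 (\<Union>n. Y n) K'" for K'
  proof -
    obtain T f where T: "T \<subseteq> K'" "pemb v v (\<Union>n. Y n) T f"
      using K' unfolding One_nat_def stacked_copies.simps pointed_le_def by blast
    note im = pemb_image[OF T(2) FY]
    have "pointed_le (\<Union>n. Y n) (f ` (\<Union>n. F n))" by (rule pointed_le_trans[OF p conjunct1[OF im]])
    moreover have "f ` (\<Union>n. F n) \<subseteq> K'" by (rule order_trans[OF conjunct2[OF im] T(1)])
    ultimately show ?thesis using thick_image[OF T(2) FY t] by (intro exI[of _ "f ` (\<Union>n. F n)"]) simp
  qed
  then show ?thesis unfolding good_def by blast
qed

lemma bl_cases: "u \<in> X - {v} \<Longrightarrow> w \<in> X - {v} \<Longrightarrow> z \<in> X - {v} \<Longrightarrow> bl u w \<Longrightarrow> bl u z \<or> bl z w"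
  by (rule below_cases[OF XV vV])
lemma bl_trans: "u \<in> X - {v} \<Longrightarrow> w \<in> X - {v} \<Longrightarrow> z \<in> X - {v} \<Longrightarrow> bl u w \<Longrightarrow> bl w z \<Longrightarrow> bl u z"
  by (rule below_trans[OF XV vV])
lemma bl_asym: "u \<in> X - {v} \<Longrightarrow> w \<in> X - {v} \<Longrightarrow> bl u w \<Longrightarrow> \<not> bl w u"
  using below_asym[OF XV vV] by blast

lemma wqo_ple: "(\<And>i. t i \<in> Pow (X - {v})) \<Longrightarrow> \<exists>i j. i < j \<and> pointed_le (t i) (t (j::nat))"
  using wqo_pemb[OF vV, of t] XV unfolding pointed_le_def by blast

lemma pointed_le_wf: "wf {(K, K'). K \<subseteq> X - {v} \<and> K' \<subseteq> X - {v} \<and> pointed_le K K' \<and> \<not> pointed_le K' K}" (is "wf ?r")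
  unfolding wf_iff_no_infinite_down_chain
proof
  assume "\<exists>f. \<forall>i. (f (Suc i), f i) \<in> ?r"
  then obtain f where f: "\<forall>i. (f (Suc i), f i) \<in> ?r" by (rule exE)
  have down: "pointed_le (f j) (f i)" if "i \<le> j" for i j
    using that
  proof (induction rule: dec_induct)
    case base show ?case by (rule pointed_le_sub) simp
  next
    case (step j)
    have "pointed_le (f (Suc j)) (f j)" using f by blast
    then show ?case using pointed_le_trans step.IH by blast
  qed
  have "f i \<in> Pow (X - {v})" for i using f by blast
  then obtain i j where ij: "i < j" "pointed_le (f i) (f j)" using wqo_ple by blast
  have "pointed_le (f j) (f (Suc i))" using down ij by simp
  then have "pointed_le (f i) (f (Suc i))" using pointed_le_trans ij by blast
  then show False using f by blast
qed

text \<open>\<open>b\<close> selects the direction of the order, so that sums of type \<open>\<omega>\<close> and of type \<open>\<omega>*\<close> are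
  treated together.\<close>

lemma good_half:
  assumes L: "L \<subseteq> X - {v}"
    and g: "\<And>u Z. u \<in> L \<Longrightarrow> Z \<subseteq> {x\<in>L. if b then bl x u else bl u x} \<Longrightarrow> good Z"
  shows "good L"
proof -
  define q where "q = (\<lambda>x y. if b then bl x y else bl y x)"
  have LX: "x \<in> X - {v}" if "x \<in> L" for x using that L by blast
  have qcases: "q x y \<Longrightarrow> q x z \<or> q z y" if "x \<in> L" "y \<in> L" "z \<in> L" for x y z
    using bl_cases[of x y z] bl_cases[of y x z] that LX unfolding q_def by auto
  have qtrans: "q x y \<Longrightarrow> q y z \<Longrightarrow> q x z" if "x \<in> L" "y \<in> L" "z \<in> L" for x y z
    using bl_trans[of x y z] bl_trans[of z y x] that LX unfolding q_def by auto
  have qasym: "q x y \<Longrightarrow> \<not> q y x" if "x \<in> L" "y \<in> L" for x y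
    using bl_asym[of x y] bl_asym[of y x] that LX unfolding q_def by auto
  have gq: "good Z" if "u \<in> L" "Z \<subseteq> {x\<in>L. q x u}" for u Z using g[OF that(1)] that(2) unfolding q_def by blast
  have sq: "if b then st K1 K2 else st K2 K1" if "K1 \<subseteq> L" "K2 \<subseteq> L" "\<And>x y. x \<in> K1 \<Longrightarrow> y \<in> K2 \<Longrightarrow> q x y" for K1 K2
    using bl_stk[of K1 K2] bl_stk[of K2 K1] that L unfolding q_def by (auto split: if_splits)
  \<comment> \<open>What is not beyond \<open>u\<close> splits into a part strictly before
    \<open>u\<close>, good by assumption, and vertices of the single node of
    \<open>u\<close>.\<close>
  have gle: "good Z" if u: "u \<in> L" and Z: "Z \<subseteq> {x\<in>L. \<not> q u x}" for u Z
  proof -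
    define Z1 where "Z1 = {x\<in>Z. q x u}"
    define Z2 where "Z2 = {x\<in>Z. \<not> q x u}"
    have "good Z1" by (rule gq[OF u]) (use Z in \<open>auto simp: Z1_def\<close>)
    moreover have "good Z2"
    proof (rule good_node[of _ "E v u"])
      fix w assume "w \<in> Z2"
      then have "same_node X v w u" using Z unfolding Z2_def same_node_def q_def by (auto split: if_splits)
      then show "E v w = E v u" by (rule same_node_E)
    qed
    moreover have "if b then st Z1 Z2 else st Z2 Z1"
    proof (rule sq)
      show "Z1 \<subseteq> L" "Z2 \<subseteq> L" using Z unfolding Z1_def Z2_def by auto
      show "q x y" if "x \<in> Z1" "y \<in> Z2" for x y
        using qcases[of x u y] that Z u unfolding Z1_def Z2_def by blast
    qed
    ultimately have "good (Z1 \<union> Z2)" using good_Un[of Z1 Z2] good_Un[of Z2 Z1] by (auto simp: Un_commute split: if_splits)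
    moreover have "Z1 \<union> Z2 = Z" unfolding Z1_def Z2_def by blast
    ultimately show ?thesis by simp
  qed
  show ?thesis
  proof (cases "\<exists>u\<in>L. \<forall>w\<in>L. \<not> q u w")
    case True
    then show ?thesis using gle by blast
  next
    case False
    show ?thesis
    proof (cases "L = {}")
      case nonempty: False
      then obtain a where a: "a \<in> L" by blast
      have "L \<subseteq> V" using L XV by blast
      then have cL: "countable L" by (rule countable_subset[OF _ cntV])
      have "\<exists>u::nat \<Rightarrow> 'a. (\<forall>n. u n \<in> L \<and> q (u n) (u (Suc n)) \<and> True) \<and> (\<forall>x\<in>L. \<exists>n. q x (u n))"
      proof (rule cofinal_seq[OF cL a, where Q="\<lambda>_ _. True"])
        show "q x z" if "x \<in> L" "y \<in> L" "z \<in> L" "q x y" "q y z" for x y z using qtrans that by blast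
        show "q x z \<or> q z y" if "x \<in> L" "y \<in> L" "z \<in> L" "q x y" for x y z using qcases that by blast
        show "\<exists>w\<in>L. q p w \<and> True" if "p \<in> L" for p using False that by blast
      qed simp
      then obtain u where u0: "\<forall>n. u n \<in> L \<and> q (u n) (u (Suc n)) \<and> True" and u1: "\<forall>x\<in>L. \<exists>n. q x (u n)"
        by (elim exE conjE)
      have u: "u n \<in> L" "q (u n) (u (Suc n))" "x \<in> L \<Longrightarrow> \<exists>n. q x (u n)" for n x
        using u0 u1 by simp_all
      have umono: "q (u i) (u j)" if "i < j" for i j
        using that
      proof (induction j)
        case (Suc j)
        then show ?case using u(2)[of j] qtrans[OF u(1)[of i] u(1)[of j] u(1)[of "Suc j"]] by (cases "i = j") auto
      qed simp
      \<comment> \<open>Successive intervals of a cofinal sequence. From some index \<open>N\<close>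
        on each of them recurs by the well-quasi-order, and all that is not beyond
        \<open>u N\<close> is collected in \<open>Z\<close>.\<close>
      define Y where "Y = (\<lambda>n. {x\<in>L. q (u n) x \<and> \<not> q (u (Suc n)) x})"
      have YX: "Y n \<in> Pow (X - {v})" for n using L unfolding Y_def by blast
      have "\<exists>N. \<forall>n\<ge>N. \<forall>l. \<exists>m>l. pointed_le (Y n) (Y m)"
        by (rule wqo_tail[of "Pow (X - {v})" pointed_le Y, OF wqo_ple pointed_le_trans YX])
      then obtain N where "\<forall>n\<ge>N. \<forall>l. \<exists>m>l. pointed_le (Y n) (Y m)" by (rule exE)
      then have N: "\<exists>m>l. pointed_le (Y n) (Y m)" if "n \<ge> N" for n l using that by blast
      define Y' where "Y' = (\<lambda>n. Y (N + n))"
      have Yord: "q x y" if "x \<in> Y i" "y \<in> Y j" "i < j" for x y i j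
      proof -
        have xy: "x \<in> L" "y \<in> L" "\<not> q (u (Suc i)) x" "q (u j) y" using that unfolding Y_def by auto
        have "\<not> q (u j) x"
        proof
          assume a: "q (u j) x"
          show False
          proof (cases "Suc i = j")
            case False
            then have "q (u (Suc i)) (u j)" using umono that(3) by simp
            then show False using qtrans[OF u(1) u(1) xy(1)] a xy(3) by blast
          qed (use a xy in simp)
        qed
        then show ?thesis using qcases[OF u(1) xy(2) xy(1) xy(4)] by blast
      qed
      have "good (\<Union>n. Y' n)"
      proof (rule good_blocks[of Y' b])
        show "good (Y' n)" for n unfolding Y'_def
          by (rule gle[OF u(1)[of "Suc (N + n)"]]) (auto simp: Y_def)
        show "\<exists>m>l. pointed_le (Y' n) (Y' m)" for n l
        proof -
          obtain m where "m > N + l" "pointed_le (Y (N + n)) (Y m)" using N[of "N + n" "N + l"] by auto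
          then show ?thesis unfolding Y'_def by (intro exI[of _ "m - N"]) auto
        qed
        show "if b then st (Y' i) (Y' j) else st (Y' j) (Y' i)" if "i < j" for i j
        proof (rule sq)
          show "Y' i \<subseteq> L" "Y' j \<subseteq> L" unfolding Y'_def Y_def by auto
          show "q x y" if "x \<in> Y' i" "y \<in> Y' j" for x y
            using Yord[of x "N + i" y "N + j"] that \<open>i < j\<close> unfolding Y'_def by simp
        qed
      qed
      moreover define Z where "Z = {x\<in>L. \<not> q (u N) x}"
      have "good Z" by (rule gle[OF u(1)[of N]]) (simp add: Z_def)
      moreover have "if b then st Z (\<Union>n. Y' n) else st (\<Union>n. Y' n) Z"
      proof (rule sq)
        show "Z \<subseteq> L" "(\<Union>n. Y' n) \<subseteq> L" unfolding Z_def Y'_def Y_def by auto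
        fix x y assume xy: "x \<in> Z" "y \<in> (\<Union>n. Y' n)"
        then obtain n where n: "y \<in> L" "q (u (N + n)) y" unfolding Y'_def Y_def by auto
        have "q (u N) y"
        proof (cases "n = 0")
          case False
          then show ?thesis using umono[of N "N + n"] qtrans[OF u(1) u(1) n(1)] n(2) by auto
        qed (use n in simp)
        then show "q x y" using qcases[OF u(1)[of N] n(1), of x] xy(1) unfolding Z_def by blast
      qed
      ultimately have "good (Z \<union> (\<Union>n. Y' n))"
        using good_Un[of Z "\<Union>n. Y' n"] good_Un[of "\<Union>n. Y' n" Z] by (auto simp: Un_commute split: if_splits)
      moreover have "Z \<union> (\<Union>n. Y' n) = L"
      proof (intro equalityI subsetI)
        fix x assume x: "x \<in> L"
        show "x \<in> Z \<union> (\<Union>n. Y' n)"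
        proof (cases "q (u N) x")
          case True
          obtain m where m: "q x (u m)" using u(3)[OF x] by blast
          have "\<exists>n. \<not> q (u (N + n)) x"
          proof -
            have "q x (u (N + Suc m))" using umono[of m "N + Suc m"] qtrans[OF x u(1) u(1) m] by simp
            then show ?thesis using qasym[OF x u(1)] by blast
          qed
          then obtain n where n: "\<not> q (u (N + n)) x" "\<And>k. k < n \<Longrightarrow> q (u (N + k)) x"
            using exists_least_iff[of "\<lambda>n. \<not> q (u (N + n)) x"] by blast
          then obtain k where k: "n = Suc k" using True by (cases n) auto
          have "x \<in> Y' k" using n x unfolding Y'_def Y_def k by simp
          then show ?thesis by blast
        qed (use x in \<open>simp add: Z_def\<close>)
      qed (auto simp: Z_def Y'_def Y_def)
      ultimately show ?thesis by simp
    qed (simp add: good_empty)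
  qed
qed

text \<open>Two stacked copies of \<open>K\<close> inside \<open>K\<close> yield four: at each cut
  the lowest serves the part below, the highest the part above, and the two in the middle make room
  for a thick version of the node. The hosts offered to both parts again contain \<open>K\<close>,
  so \<open>host\<close> never runs out of space.\<close>

lemma good_selfsum:
  assumes K: "K \<subseteq> X - {v}" and c: "pointed_le K T1" "pointed_le K T2" "T1 \<subseteq> K" "T2 \<subseteq> K" "st T1 T2"
  shows "good K"
proof -
  have dup: "\<exists>L1 L2. L1 \<subseteq> L \<and> L2 \<subseteq> L \<and> st L1 L2 \<and> pointed_le K L1 \<and> pointed_le K L2" if L: "pointed_le K L" for L
  proof -
    obtain f where f: "pemb v v K L f" using L unfolding pointed_le_def by blast
    note i1 = pemb_image[OF f c(3)] and i2 = pemb_image[OF f c(4)]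
    have "pointed_le K (f ` T1)" "pointed_le K (f ` T2)"
      using pointed_le_trans[OF c(1) conjunct1[OF i1]] pointed_le_trans[OF c(2) conjunct1[OF i2]] by simp_all
    then show ?thesis using pemb_stk[OF f c(3,4,5)] i1 i2
      by (intro exI[of _ "f ` T1"] exI[of _ "f ` T2"]) simp
  qed
  have main: "\<exists>F\<subseteq>K'. pointed_le K F \<and> thick F" if K': "pointed_le K K'" for K'
  proof -
    define R where "R = (\<lambda>N A. pointed_le N A \<and> thick A)"
    have "\<exists>h. (\<forall>u\<in>K. h u \<subseteq> K' \<and> (\<forall>w\<in>h u. E v w = E v u) \<and> R (node X v K u) (h u)) \<and>
       (\<forall>u\<in>K. \<forall>w\<in>K. (below X v u w \<longrightarrow> stacked E v (h u) (h w)) \<and> (same_node X v u w \<longrightarrow> h u = h w))"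
    proof (rule host[OF vV XV K, where T="\<lambda>L L'. L \<subseteq> K \<and> pointed_le K L'"])
      show "K \<subseteq> K \<and> pointed_le K K'" using K' by blast
      fix L L' u assume L: "L \<subseteq> K \<and> pointed_le K L'" "u \<in> L"
      obtain P Q where P: "P \<subseteq> L'" "Q \<subseteq> L'" "st P Q" "pointed_le K P" "pointed_le K Q" using dup[of L'] L(1) by blast
      obtain P1 P2 where P': "P1 \<subseteq> P" "P2 \<subseteq> P" "st P1 P2" "pointed_le K P1" "pointed_le K P2" using dup[OF P(4)] by blast
      obtain Q1 Q2 where Q': "Q1 \<subseteq> Q" "Q2 \<subseteq> Q" "st Q1 Q2" "pointed_le K Q1" "pointed_le K Q2" using dup[OF P(5)] by blast
      have n: "u \<in> node X v L u" "node X v L u \<subseteq> K" using L same_node_refl unfolding node_def by auto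
      have lab: "E v w = E v u" if "w \<in> node X v L u" for w using that same_node_E unfolding node_def by blast
      have "st P2 Q1" using stacked_mono[OF P(3) P'(2) Q'(1)] .
      moreover have "pointed_le (node X v L u) P2" "pointed_le (node X v L u) Q1"
        using pointed_le_trans[OF pointed_le_sub[OF n(2)] P'(5)] pointed_le_trans[OF pointed_le_sub[OF n(2)] Q'(4)] by simp_all
      ultimately obtain A' where A': "A' \<subseteq> P2 \<union> Q1" "pointed_le (node X v L u) A'" "thick A'" "\<forall>w\<in>A'. E v w = E v u"
        using node_thick[OF n(1) lab, of P2 Q1] by blast
      have "st P1 (P2 \<union> Q1)" using P'(3) stacked_mono[OF P(3) P'(1) Q'(1)] unfolding stacked_def by blast
      then have a1: "st P1 A'" by (rule stacked_mono[OF _ order_refl A'(1)])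
      have "st (P2 \<union> Q1) Q2" using Q'(3) stacked_mono[OF P(3) P'(2) Q'(2)] unfolding stacked_def by blast
      then have a2: "st A' Q2" by (rule stacked_mono[OF _ A'(1) order_refl])
      have a3: "st P1 Q2" by (rule stacked_mono[OF P(3) P'(1) Q'(2)])
      have a4: "A' \<subseteq> L'" "P1 \<subseteq> L'" "Q2 \<subseteq> L'" using A'(1) P(1,2) P'(1,2) Q'(1,2) by blast+
      have a5: "lower X v L u \<subseteq> K" "upper X v L u \<subseteq> K" using L unfolding lower_def upper_def by auto
      show "\<exists>A' K1' K2'. A' \<subseteq> L' \<and> K1' \<subseteq> L' \<and> K2' \<subseteq> L' \<and> (\<forall>w\<in>A'. E v w = E v u) \<and>
        stacked E v K1' A' \<and> stacked E v A' K2' \<and> stacked E v K1' K2' \<and>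
        R (node X v L u) A' \<and> (lower X v L u \<subseteq> K \<and> pointed_le K K1') \<and> (upper X v L u \<subseteq> K \<and> pointed_le K K2')"
        using A' P'(4) Q'(5) a1 a2 a3 a4 a5 unfolding R_def
        by (intro exI[of _ A'] exI[of _ P1] exI[of _ Q2]) simp
    qed
    then obtain h where h1: "\<forall>u\<in>K. h u \<subseteq> K' \<and> (\<forall>w\<in>h u. E v w = E v u) \<and> R (node X v K u) (h u)" and
      h2: "\<forall>u\<in>K. \<forall>w\<in>K. (bl u w \<longrightarrow> st (h u) (h w)) \<and> (same_node X v u w \<longrightarrow> h u = h w)"
      by (elim exE conjE)
    define I where "I = (\<lambda>u. node X v K u) ` K"
    define rp where "rp = (\<lambda>N. SOME u. u \<in> K \<and> node X v K u = N)"
    have rp: "rp N \<in> K \<and> node X v K (rp N) = N" if "N \<in> I" for N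
      unfolding rp_def by (rule someI_ex) (use that in \<open>auto simp: I_def\<close>)
    have KX: "x \<in> X - {v}" if "x \<in> K" for x using that K by blast
    have sk: "st N M \<and> st (h (rp N)) (h (rp M)) \<or> st M N \<and> st (h (rp M)) (h (rp N))"
      if NM: "N \<in> I" "M \<in> I" "N \<noteq> M" for N M
    proof -
      define x where "x = rp N" define y where "y = rp M"
      have xy: "x \<in> K" "y \<in> K" "node X v K x = N" "node X v K y = M" using rp NM unfolding x_def y_def by auto
      have ns: "st (node X v K p) (node X v K r)" if pr: "p \<in> K" "r \<in> K" "bl p r" for p r
      proof (rule bl_stk)
        show "node X v K p \<subseteq> X - {v}" "node X v K r \<subseteq> X - {v}" using K unfolding node_def by auto
        fix a c assume "a \<in> node X v K p" "c \<in> node X v K r"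
        then have ac: "a \<in> K" "same_node X v a p" "c \<in> K" "same_node X v c r" unfolding node_def by auto
        have "bl a r" by (rule same_node_blw(1)[OF XV vV KX[OF ac(1)] KX[OF pr(1)] KX[OF pr(2)] ac(2) pr(3)])
        then show "bl a c" by (rule same_node_blw(2)[OF XV vV KX[OF ac(3)] KX[OF pr(2)] KX[OF ac(1)] ac(4)])
      qed
      have "\<not> same_node X v x y"
      proof
        assume e: "same_node X v x y"
        have "same_node X v z x \<longleftrightarrow> same_node X v z y" if z: "z \<in> K" for z
          using same_node_trans[OF XV vV KX[OF z] KX[OF xy(1)] KX[OF xy(2)]]
            same_node_trans[OF XV vV KX[OF z] KX[OF xy(2)] KX[OF xy(1)]] e same_node_sym by blast
        then have "N = M" using xy unfolding node_def by blast
        then show False using NM by blast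
      qed
      then have "bl x y \<or> bl y x" unfolding same_node_def by blast
      then show ?thesis using ns[of x y] ns[of y x] h2 xy unfolding x_def y_def by auto
    qed
    have hI: "h (rp N) \<subseteq> K' \<and> pointed_le N (h (rp N)) \<and> thick (h (rp N))" if "N \<in> I" for N
      using h1 rp[OF that] unfolding R_def by metis
    have "pointed_le K (\<Union>N\<in>I. h (rp N))"
    proof (rule glue[where Y="\<lambda>N. N"])
      show "K \<subseteq> (\<Union>N\<in>I. N)" unfolding I_def node_def using same_node_refl by blast
    qed (use hI sk in auto)
    moreover have "thick (\<Union>N\<in>I. h (rp N))" by (rule thick_UN) (use hI sk in blast)+
    moreover have "(\<Union>N\<in>I. h (rp N)) \<subseteq> K'" using hI by blast
    ultimately show ?thesis by blast
  qed
  have "\<exists>F\<subseteq>K'. pointed_le K F \<and> thick F" if K': "stacked_copies 1 K K'" for K'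
  proof -
    obtain T where "T \<subseteq> K'" "pointed_le K T" using K' unfolding One_nat_def stacked_copies.simps by blast
    then show ?thesis using main[of T] by blast
  qed
  then show ?thesis unfolding good_def by blast
qed

text \<open>Every context, repeated finitely often, contains a thick copy of itself.  At a node both of whose
  sides are strictly smaller one uses induction; if both sides are equivalent to the whole, the context
  absorbs itself; otherwise it splits into two halves that are sums of type \<open>\<omega>\<close> and \<open>\<omega>*\<close>.\<close>

theorem good_all: "K \<subseteq> X - {v} \<Longrightarrow> good K"
proof (induction K rule: wf_induct_rule[OF pointed_le_wf])
  case (1 K)
  have IH: "good Z" if "Z \<subseteq> K" "\<not> pointed_le K Z" for Z using 1 that pointed_le_sub[OF that(1)] by blast
  note K = 1(2)
  have KX: "x \<in> X - {v}" if "x \<in> K" for x using that K by blast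
  have sub: "lower X v K u \<subseteq> K" "upper X v K u \<subseteq> K" "node X v K u \<subseteq> K" for u unfolding lower_def upper_def node_def by auto
  consider (small) u where "u \<in> K" "\<not> pointed_le K (lower X v K u)" "\<not> pointed_le K (upper X v K u)"
    | (both) u where "u \<in> K" "pointed_le K (lower X v K u)" "pointed_le K (upper X v K u)"
    | (cut) "\<And>u. u \<in> K \<Longrightarrow> pointed_le K (lower X v K u) \<longleftrightarrow> \<not> pointed_le K (upper X v K u)" by blast
  then show ?case
  proof cases
    case small
    note d = node_dec[OF XV vV K small(1)]
    have "good (node X v K u)" by (rule good_node) (use d(1) in blast)
    then have "good (lower X v K u \<union> node X v K u)" using good_Un IH[OF sub(1) small(2)] d(2) by blast
    moreover have "st (lower X v K u \<union> node X v K u) (upper X v K u)" using d(3,4) unfolding stacked_def by blast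
    ultimately have "good ((lower X v K u \<union> node X v K u) \<union> upper X v K u)" using good_Un IH[OF sub(2) small(3)] by blast
    then show ?thesis using d(5) by simp
  next
    case both
    show ?thesis by (rule good_selfsum[OF K both(2,3) sub(1,2) node_dec(4)[OF XV vV K both(1)]])
  next
    case cut
    define L where "L = {u\<in>K. pointed_le K (upper X v K u)}"
    define R where "R = {u\<in>K. pointed_le K (lower X v K u)}"
    have LR: "K = L \<union> R" unfolding L_def R_def using cut by blast
    have "good L"
    proof (rule good_half[where b=True])
      show "L \<subseteq> X - {v}" using K unfolding L_def by blast
      fix u Z assume u: "u \<in> L" and Z: "Z \<subseteq> {x\<in>L. if True then bl x u else bl u x}"
      then have ZK: "Z \<subseteq> lower X v K u" "Z \<subseteq> K" unfolding L_def lower_def by auto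
      have "\<not> pointed_le K (lower X v K u)" using cut u unfolding L_def by blast
      then have "\<not> pointed_le K Z" using pointed_le_trans[OF _ pointed_le_sub[OF ZK(1)]] by blast
      then show "good Z" using IH ZK by blast
    qed
    moreover have "good R"
    proof (rule good_half[where b=False])
      show "R \<subseteq> X - {v}" using K unfolding R_def by blast
      fix u Z assume u: "u \<in> R" and Z: "Z \<subseteq> {x\<in>R. if False then bl x u else bl u x}"
      then have ZK: "Z \<subseteq> upper X v K u" "Z \<subseteq> K" unfolding R_def upper_def by auto
      have "\<not> pointed_le K (upper X v K u)" using cut u unfolding R_def by blast
      then have "\<not> pointed_le K Z" using pointed_le_trans[OF _ pointed_le_sub[OF ZK(1)]] by blast
      then show "good Z" using IH ZK by blast
    qed
    moreover have "st L R"
    proof (rule bl_stk)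
      show "L \<subseteq> X - {v}" "R \<subseteq> X - {v}" using K unfolding L_def R_def by auto
      fix x y assume xy: "x \<in> L" "y \<in> R"
      then have xyK: "x \<in> K" "y \<in> K" unfolding L_def R_def by auto
      show "bl x y"
      proof (rule ccontr)
        assume n: "\<not> bl x y"
        \<comment> \<open>If \<open>y\<close> is not above \<open>x\<close>, then \<open>K\<close>
          embeds into the part below \<open>x\<close> because it embeds into the part below
          \<open>y\<close>. But \<open>x\<close> is in \<open>L\<close>, so \<open>K\<close> also
          embeds into the part above \<open>x\<close>, which the case \<open>cut\<close>
          forbids.\<close>
        have "lower X v K y \<subseteq> lower X v K x"
        proof
          fix z assume "z \<in> lower X v K y"
          then have z: "z \<in> K" "bl z y" unfolding lower_def by auto
          then show "z \<in> lower X v K x"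
            using bl_cases[OF KX[OF z(1)] KX[OF xyK(2)] KX[OF xyK(1)] z(2)] n unfolding lower_def by blast
        qed
        then have "pointed_le K (lower X v K x)" using pointed_le_trans[OF _ pointed_le_sub] xy(2) unfolding R_def by blast
        then show False using cut[OF xyK(1)] xy(1) unfolding L_def by blast
      qed
    qed
    ultimately show ?thesis using good_Un LR by metis
  qed
qed

end

section \<open>Rigid graphs\<close>

context p4_free begin

definition embeddable :: "'a set \<Rightarrow> 'a set \<Rightarrow> bool" where "embeddable A B \<longleftrightarrow> (\<exists>f. emb A B f)"

definition iso :: "'a set \<Rightarrow> 'a set \<Rightarrow> bool" where "iso A B \<longleftrightarrow> (\<exists>f. emb A B f \<and> f ` A = B)"

text \<open>The value \<open>b = False\<close> gives the complement, so statements on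
  \<open>conn b\<close> and \<open>comp b\<close> serve a graph and its complement at once.\<close>

definition step :: "bool \<Rightarrow> 'a set \<Rightarrow> 'a \<Rightarrow> 'a \<Rightarrow> bool" where
  "step b X x y \<longleftrightarrow> x \<in> X \<and> y \<in> X \<and> x \<noteq> y \<and> E x y = b"

definition conn :: "bool \<Rightarrow> 'a set \<Rightarrow> bool" where
  "conn b X \<longleftrightarrow> (\<forall>x\<in>X. \<forall>y\<in>X. (step b X)\<^sup>*\<^sup>* x y)"

definition comp :: "bool \<Rightarrow> 'a set \<Rightarrow> 'a \<Rightarrow> 'a set" where
  "comp b X x = {y\<in>X. (step b X)\<^sup>*\<^sup>* x y}"

definition twin :: "'a set \<Rightarrow> 'a \<Rightarrow> 'a \<Rightarrow> bool" where
  "twin X x y \<longleftrightarrow> (\<forall>z\<in>X. z \<noteq> x \<longrightarrow> z \<noteq> y \<longrightarrow> E x z = E y z)"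

text \<open>Finiteness of the number of twin classes, expressed by a colouring that may be finer
  than the partition into twins.\<close>

definition fin :: "'a set \<Rightarrow> bool" where
  "fin X \<longleftrightarrow> (\<exists>f :: 'a \<Rightarrow> nat. finite (f ` X) \<and> (\<forall>x\<in>X. \<forall>y\<in>X. f x = f y \<longrightarrow> twin X x y))"

definition rigid :: "bool \<Rightarrow> 'a set \<Rightarrow> bool" where
  "rigid b X \<longleftrightarrow> conn b X \<and> (\<forall>Y\<subseteq>X. embeddable X Y \<longrightarrow> conn b Y \<longrightarrow> iso X Y)"

lemma embD:
  assumes "emb A B f"
  shows "inj_on f A" "f ` A \<subseteq> B" "x \<in> A \<Longrightarrow> f x \<in> B" "x \<in> A \<Longrightarrow> y \<in> A \<Longrightarrow> E (f x) (f y) = E x y"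
    "x \<in> A \<Longrightarrow> y \<in> A \<Longrightarrow> f x = f y \<Longrightarrow> x = y"
  using assms unfolding emb_def inj_on_def by blast+

lemma embI:
  assumes "\<And>x. x \<in> A \<Longrightarrow> f x \<in> B"
    and "\<And>x y. x \<in> A \<Longrightarrow> y \<in> A \<Longrightarrow> x \<noteq> y \<Longrightarrow> f x \<noteq> f y \<and> E (f x) (f y) = E x y"
  shows "emb A B f"
  unfolding emb_def
proof (intro conjI ballI)
  show "inj_on f A" using assms(2) by (meson inj_onI)
  show "f ` A \<subseteq> B" using assms(1) by blast
  show "E (f x) (f y) = E x y" if "x \<in> A" "y \<in> A" for x y using assms(2) that irr by (cases "x = y") auto
qed

lemma emb_mono: "emb A B f \<Longrightarrow> A' \<subseteq> A \<Longrightarrow> B \<subseteq> B' \<Longrightarrow> emb A' B' f"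
  unfolding emb_def by (auto simp: subset_iff intro: inj_on_subset)

lemma emb_comp: "emb A B f \<Longrightarrow> emb B C g \<Longrightarrow> emb A C (g \<circ> f)"
  by (rule embI) (auto dest: embD(3-5))

lemma emb_id: "A \<subseteq> B \<Longrightarrow> emb A B id"
  by (rule embI) auto

lemma embeddable_sub: "A \<subseteq> B \<Longrightarrow> embeddable A B" unfolding embeddable_def using emb_id by blast

lemma embeddable_trans: "embeddable A B \<Longrightarrow> embeddable B C \<Longrightarrow> embeddable A C" unfolding embeddable_def using emb_comp by blast

lemma iso_inv:
  assumes "emb A B f" "f ` A = B" shows "emb B A (inv_into A f)" "inv_into A f ` B = A"
proof -
  have i: "inv_into A f y \<in> A" "f (inv_into A f y) = y" if "y \<in> B" for y
    using that assms(2) by (auto intro: inv_into_into f_inv_into_f)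
  have l: "inv_into A f (f x) = x" if "x \<in> A" for x using that embD(1)[OF assms(1)] by simp
  show "emb B A (inv_into A f)"
  proof (rule embI)
    fix x y assume xy: "x \<in> B" "y \<in> B" "x \<noteq> y"
    show "inv_into A f x \<noteq> inv_into A f y \<and> E (inv_into A f x) (inv_into A f y) = E x y"
      using i[OF xy(1)] i[OF xy(2)] xy(3) embD(4)[OF assms(1) i(1)[OF xy(1)] i(1)[OF xy(2)]] by metis
  qed (rule i)
  show "inv_into A f ` B = A" using i l assms(2) by force
qed

lemma iso_sym: "iso A B \<Longrightarrow> iso B A"
  unfolding iso_def using iso_inv by blast

lemma iso_trans:
  assumes "iso A B" "iso B C" shows "iso A C"
proof -
  obtain f g where f: "emb A B f" "f ` A = B" and g: "emb B C g" "g ` B = C" using assms unfolding iso_def by blast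
  have "(g \<circ> f) ` A = C" using f g by (metis image_comp)
  then show ?thesis unfolding iso_def using emb_comp[OF f(1) g(1)] by blast
qed

lemma iso_ble: "iso A B \<Longrightarrow> embeddable A B" unfolding iso_def embeddable_def by blast

lemma emb_image: "emb A B f \<Longrightarrow> S \<subseteq> A \<Longrightarrow> emb S (f ` S) f"
  unfolding emb_def by (auto simp: subset_iff intro: inj_on_subset)

lemma iso_image: "emb A B f \<Longrightarrow> S \<subseteq> A \<Longrightarrow> iso S (f ` S)"
  unfolding iso_def using emb_image by blast

lemma step_emb: "emb X Y f \<Longrightarrow> step b X x y \<Longrightarrow> step b Y (f x) (f y)"
  unfolding step_def using embD(3-5) by metis

lemma steps_emb:
  assumes "emb X Y f" "(step b X)\<^sup>*\<^sup>* x y" shows "(step b Y)\<^sup>*\<^sup>* (f x) (f y)"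
  using assms(2)
proof (induction rule: rtranclp_induct)
  case (step y z)
  have "step b Y (f y) (f z)" by (rule step_emb[OF assms(1) step.hyps(2)])
  then show ?case using step.IH by (meson rtranclp.rtrancl_into_rtrancl)
qed simp

lemma steps_mono: "X \<subseteq> Y \<Longrightarrow> (step b X)\<^sup>*\<^sup>* x y \<Longrightarrow> (step b Y)\<^sup>*\<^sup>* x y"
  using steps_emb[OF emb_id, of X Y b x y] by simp

lemma steps_sym: "(step b X)\<^sup>*\<^sup>* x y \<Longrightarrow> (step b X)\<^sup>*\<^sup>* y x"
proof (induction rule: rtranclp_induct)
  case (step y z)
  have "step b X z y" using step.hyps(2) symE unfolding step_def by metis
  then show ?case using step.IH by (meson converse_rtranclp_into_rtranclp)
qed simp

lemma conn_iso:
  assumes "iso X Y" "conn b X" shows "conn b Y"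
proof -
  obtain f where f: "emb X Y f" "f ` X = Y" using assms unfolding iso_def by blast
  show ?thesis unfolding conn_def
  proof (intro ballI)
    fix x y assume "x \<in> Y" "y \<in> Y"
    then obtain x' y' where "x' \<in> X" "y' \<in> X" "x = f x'" "y = f y'" using f(2) by blast
    then show "(step b Y)\<^sup>*\<^sup>* x y" using assms(2) steps_emb[OF f(1)] unfolding conn_def by blast
  qed
qed

lemma conn_cut:
  assumes "U \<subseteq> X" "x \<in> U" "y \<in> X - U" "\<And>u w. u \<in> U \<Longrightarrow> w \<in> X - U \<Longrightarrow> E u w = (\<not> b)"
  shows "\<not> conn b X"
proof
  assume "conn b X"
  then have "(step b X)\<^sup>*\<^sup>* x y" using assms unfolding conn_def by blast
  then have "y \<in> U"
  proof (induction rule: rtranclp_induct)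
    case (step y z) then show ?case using assms(4)[of y z] unfolding step_def by auto
  qed (rule assms(2))
  then show False using assms(3) by blast
qed

lemma conn_common:
  assumes "\<And>x y. x \<in> F \<Longrightarrow> y \<in> F \<Longrightarrow> \<exists>t\<in>F. t \<noteq> x \<and> t \<noteq> y \<and> E x t = b \<and> E y t = b"
  shows "conn b F"
  unfolding conn_def
proof (intro ballI)
  fix x y assume xy: "x \<in> F" "y \<in> F"
  then obtain t where "t \<in> F" "t \<noteq> x" "t \<noteq> y" "E x t = b" "E y t = b" using assms by blast
  then have "step b F x t" "step b F t y" using xy symE[of t y] unfolding step_def by auto
  then show "(step b F)\<^sup>*\<^sup>* x y" by (meson r_into_rtranclp rtranclp_trans)
qed

lemma comp_self: "x \<in> X \<Longrightarrow> x \<in> comp b X x" unfolding comp_def by simp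

lemma comp_sub: "comp b X x \<subseteq> X" unfolding comp_def by blast

lemma comp_eq: "y \<in> comp b X x \<Longrightarrow> comp b X y = comp b X x"
  unfolding comp_def using steps_sym rtranclp_trans by (metis (no_types, lifting) mem_Collect_eq)

lemma comp_cross:
  assumes "x \<in> X" "y \<in> X" "comp b X x \<noteq> comp b X y" shows "x \<noteq> y" "E x y = (\<not> b)"
proof -
  show ne: "x \<noteq> y" using assms by blast
  show "E x y = (\<not> b)"
  proof (rule ccontr)
    assume "E x y \<noteq> (\<not> b)"
    then have "step b X x y" using assms ne unfolding step_def by auto
    then have "y \<in> comp b X x" using assms unfolding comp_def by blast
    then show False using comp_eq assms by metis
  qed
qed

lemma comp_conn: "x \<in> X \<Longrightarrow> conn b (comp b X x)"
proof -
  assume x: "x \<in> X"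
  have reach: "(step b (comp b X x))\<^sup>*\<^sup>* x y" if "(step b X)\<^sup>*\<^sup>* x y" for y
    using that
  proof (induction rule: rtranclp_induct)
    case (step y z)
    have "y \<in> X" "z \<in> X" using step.hyps(2) unfolding step_def by auto
    moreover have "(step b X)\<^sup>*\<^sup>* x z" using step.hyps by (meson rtranclp.rtrancl_into_rtrancl)
    ultimately have "step b (comp b X x) y z" using step.hyps unfolding step_def comp_def by blast
    then show ?case using step.IH by (meson rtranclp.rtrancl_into_rtrancl)
  qed simp
  show ?thesis unfolding conn_def
  proof (intro ballI)
    fix y z assume "y \<in> comp b X x" "z \<in> comp b X x"
    then have "(step b (comp b X x))\<^sup>*\<^sup>* x y" "(step b (comp b X x))\<^sup>*\<^sup>* x z" using reach unfolding comp_def by auto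
    then show "(step b (comp b X x))\<^sup>*\<^sup>* y z" using steps_sym rtranclp_trans by metis
  qed
qed

lemma conn_in_comp: "conn b S \<Longrightarrow> S \<subseteq> X \<Longrightarrow> x \<in> S \<Longrightarrow> S \<subseteq> comp b X x"
  unfolding conn_def comp_def using steps_mono by blast

lemma not_conn_comp: "\<not> conn b X \<Longrightarrow> x \<in> X \<Longrightarrow> \<exists>y\<in>X. y \<notin> comp b X x"
  using comp_conn[of x X b] comp_sub[of b X x] by (metis subsetI subset_antisym)

text \<open>Two vertices from different components are joined directly in the opposite sense, two
  from the same component through a vertex of another one.\<close>

lemma conn_two_comps:
  assumes Y: "Y \<subseteq> X" and uw: "u \<in> Y" "w \<in> Y" "comp (\<not> b) X u \<noteq> comp (\<not> b) X w" shows "conn b Y"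
  unfolding conn_def
proof (intro ballI)
  fix x y assume xy: "x \<in> Y" "y \<in> Y"
  have st: "step b Y p q" if "p \<in> Y" "q \<in> Y" "comp (\<not> b) X p \<noteq> comp (\<not> b) X q" for p q
    using comp_cross[of p X q "\<not> b"] that Y unfolding step_def by auto
  show "(step b Y)\<^sup>*\<^sup>* x y"
  proof (cases "comp (\<not> b) X x = comp (\<not> b) X y")
    case False then show ?thesis using st xy by blast
  next
    case True
    obtain z where z: "z \<in> Y" "comp (\<not> b) X z \<noteq> comp (\<not> b) X x" using uw by metis
    then have "step b Y x z" "step b Y z y" using st xy True by metis+
    then show ?thesis by (meson r_into_rtranclp rtranclp_trans)
  qed
qed

lemma emb_by_comps:
  assumes FX: "\<And>x. x \<in> X \<Longrightarrow> F x \<in> W" "W \<subseteq> X"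
    and same: "\<And>x y. x \<in> X \<Longrightarrow> y \<in> X \<Longrightarrow> x \<noteq> y \<Longrightarrow> comp b X x = comp b X y \<Longrightarrow> F x \<noteq> F y \<and> E (F x) (F y) = E x y"
    and diff: "\<And>x y. x \<in> X \<Longrightarrow> y \<in> X \<Longrightarrow> comp b X x \<noteq> comp b X y \<Longrightarrow> comp b X (F x) \<noteq> comp b X (F y)"
  shows "emb X W F"
proof (rule embI)
  fix x y assume xy: "x \<in> X" "y \<in> X" "x \<noteq> y"
  show "F x \<noteq> F y \<and> E (F x) (F y) = E x y"
  proof (cases "comp b X x = comp b X y")
    case False
    then show ?thesis using comp_cross[of x X y b] comp_cross[of "F x" X "F y" b] diff[OF xy(1,2)] FX xy by (metis subsetD)
  qed (use same xy in blast)
qed (rule FX)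

lemma embeddable_wf: "wf {(A, B). A \<subseteq> V \<and> B \<subseteq> V \<and> embeddable A B \<and> \<not> embeddable B A}" (is "wf ?r")
  unfolding wf_iff_no_infinite_down_chain
proof
  assume "\<exists>f. \<forall>i. (f (Suc i), f i) \<in> ?r"
  then obtain f where f: "\<forall>i. (f (Suc i), f i) \<in> ?r" by (rule exE)
  have down: "embeddable (f j) (f i)" if "i \<le> j" for i j
    using that
  proof (induction rule: dec_induct)
    case base show ?case by (rule embeddable_sub) simp
  next
    case (step j)
    have "embeddable (f (Suc j)) (f j)" using f by blast
    then show ?case using embeddable_trans step.IH by blast
  qed
  have "f i \<subseteq> V" for i using f by blast
  then obtain i j where ij: "i < j" "embeddable (f i) (f j)" using wqo_emb[of f] unfolding embeddable_def by blast
  have "embeddable (f j) (f (Suc i))" using down ij by simp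
  then have "embeddable (f i) (f (Suc i))" using embeddable_trans ij by blast
  then show False using f by blast
qed

text \<open>Otherwise all copies of the component in \<open>X\<close> could be replaced by a different sibling.\<close>

lemma rigid_comp:
  assumes R: "rigid b X" and nc: "\<not> conn (\<not> b) X" and x0: "x0 \<in> X"
  shows "rigid (\<not> b) (comp (\<not> b) X x0)"
  unfolding rigid_def
proof (intro conjI allI impI)
  let ?c = "\<lambda>x. comp (\<not> b) X x"
  define S where "S = ?c x0"
  show "conn (\<not> b) (?c x0)" by (rule comp_conn[OF x0])
  fix S' assume S': "S' \<subseteq> ?c x0" "embeddable (?c x0) S'" "conn (\<not> b) S'"
  define eq where "eq = (\<lambda>D. embeddable D S \<and> embeddable S D)"
  have "\<forall>D. \<exists>g. eq D \<longrightarrow> emb S D g" unfolding eq_def embeddable_def by blast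
  then obtain g where g: "\<And>D. eq D \<Longrightarrow> emb S D (g D)" by metis
  define Z where "Z = (\<lambda>D. if eq D then g D ` S' else D)"
  have S'S: "S' \<subseteq> S" "embeddable S S'" using S' unfolding S_def by auto
  have bS: "embeddable D (g D ` S')" if "eq D" for D
  proof -
    have "embeddable S' (g D ` S')" using iso_ble iso_image[OF g[OF that] S'S(1)] by blast
    then show ?thesis using that S'S(2) embeddable_trans unfolding eq_def by blast
  qed
  have ZD: "Z D \<subseteq> D" for D using embD(2)[OF g] S'S(1) unfolding Z_def by auto
  have "\<forall>D. \<exists>h. emb D (Z D) h" using bS emb_id unfolding Z_def embeddable_def by auto
  then obtain h where h: "\<And>D. emb D (Z D) (h D)" by metis
  define Y where "Y = (\<Union>x\<in>X. Z (?c x))"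
  have YX: "Y \<subseteq> X" unfolding Y_def using ZD comp_sub by blast
  define F where "F = (\<lambda>x. h (?c x) x)"
  have FZ: "F x \<in> Z (?c x)" if "x \<in> X" for x unfolding F_def by (rule embD(3)[OF h comp_self[OF that]])
  have cF: "?c (F x) = ?c x" if "x \<in> X" for x using FZ[OF that] ZD comp_eq by (metis subsetD)
  have embF: "emb X Y F"
  proof (rule emb_by_comps[where b="\<not> b"])
    show "F x \<in> Y" if "x \<in> X" for x using FZ that unfolding Y_def by blast
    show "Y \<subseteq> X" by fact
    show "F x \<noteq> F y \<and> E (F x) (F y) = E x y" if xy: "x \<in> X" "y \<in> X" "x \<noteq> y" "?c x = ?c y" for x y
    proof -
      have "x \<in> ?c y" "y \<in> ?c y" using comp_self[OF xy(1), of "\<not> b"] comp_self[OF xy(2), of "\<not> b"] xy(4) by auto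
      then show ?thesis using embD(4)[OF h, of x "?c y" y] embD(5)[OF h, of x "?c y" y] xy(3,4) unfolding F_def by auto
    qed
    show "?c (F x) \<noteq> ?c (F y)" if "x \<in> X" "y \<in> X" "?c x \<noteq> ?c y" for x y using cF that by simp
  qed
  obtain y0 where y0: "y0 \<in> X" "y0 \<notin> ?c x0" using not_conn_comp[OF nc x0] by blast
  then have "?c x0 \<noteq> ?c y0" using comp_self by blast
  then have "conn b Y" using conn_two_comps[OF YX embD(3)[OF embF x0] embD(3)[OF embF y0(1)]] cF x0 y0 by simp
  then have "iso X Y" using R YX embF unfolding rigid_def embeddable_def by blast
  then obtain f where f: "emb X Y f" "f ` X = Y" unfolding iso_def by blast
  have connZ: "conn (\<not> b) (Z (?c x))" if "x \<in> X" for x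
    using conn_iso[OF iso_image[OF g S'S(1)] S'(3)] comp_conn[OF that] unfolding Z_def by auto
  have fx0: "f x0 \<in> Y" by (rule embD(3)[OF f(1) x0])
  then obtain y where y: "y \<in> X" "f x0 \<in> Z (?c y)" unfolding Y_def by blast
  have yc: "comp (\<not> b) Y z = Z (?c x)" if x: "x \<in> X" "z \<in> Z (?c x)" for x z
  proof
    show "Z (?c x) \<subseteq> comp (\<not> b) Y z" by (rule conn_in_comp[OF connZ[OF x(1)] _ x(2)]) (use x in \<open>auto simp: Y_def\<close>)
    have "w \<in> Z (?c x)" if "(step (\<not> b) Y)\<^sup>*\<^sup>* z w" for w
      using that
    proof (induction rule: rtranclp_induct)
      case (step p q)
      then have "p \<in> Z (?c x)" "q \<in> Y" "step (\<not> b) Y p q" unfolding step_def by auto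
      moreover obtain x' where x': "x' \<in> X" "q \<in> Z (?c x')" using \<open>q \<in> Y\<close> unfolding Y_def by blast
      ultimately have "?c p = ?c x" "?c q = ?c x'" using ZD comp_eq by (meson subsetD)+
      moreover have "?c p = ?c q"
      proof (rule ccontr)
        assume ne: "?c p \<noteq> ?c q"
        have "p \<in> X" "q \<in> X" using \<open>step (\<not> b) Y p q\<close> YX unfolding step_def by auto
        then show False using comp_cross(2)[OF _ _ ne] \<open>step (\<not> b) Y p q\<close> unfolding step_def by simp
      qed
      ultimately show ?case using x' by simp
    qed (rule x(2))
    then show "comp (\<not> b) Y z \<subseteq> Z (?c x)" unfolding comp_def by blast
  qed
  have "f ` S = comp (\<not> b) Y (f x0)"
  proof
    show "f ` S \<subseteq> comp (\<not> b) Y (f x0)"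
      unfolding S_def comp_def using steps_emb[OF f(1)] embD(3)[OF f(1)] by blast
    show "comp (\<not> b) Y (f x0) \<subseteq> f ` S"
    proof
      fix w assume "w \<in> comp (\<not> b) Y (f x0)"
      then have w: "w \<in> Y" "(step (\<not> b) Y)\<^sup>*\<^sup>* (f x0) w" unfolding comp_def by auto
      have "(step (\<not> b) X)\<^sup>*\<^sup>* (inv_into X f (f x0)) (inv_into X f w)" by (rule steps_emb[OF iso_inv(1)[OF f] w(2)])
      moreover have "inv_into X f (f x0) = x0" using embD(1)[OF f(1)] x0 by simp
      moreover have "inv_into X f w \<in> X" "f (inv_into X f w) = w" using w(1) f(2) by (auto intro: inv_into_into f_inv_into_f)
      ultimately show "w \<in> f ` S" unfolding S_def comp_def by (metis (no_types, lifting) image_eqI mem_Collect_eq)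
    qed
  qed
  then have fS: "f ` S = Z (?c y)" using yc[OF y] by simp
  have isoS: "iso S (Z (?c y))" using iso_image[OF f(1), of S] comp_sub unfolding fS[symmetric] S_def by blast
  \<comment> \<open>A component left unchanged and isomorphic to \<open>S\<close> would be
    equivalent to \<open>S\<close>, hence would have been replaced. So the image of \<open>S\<close>
    is one of the inserted copies of \<open>S'\<close>.\<close>
  have "eq (?c y)"
  proof (rule ccontr)
    assume n: "\<not> eq (?c y)"
    then have "iso S (?c y)" using isoS unfolding Z_def by simp
    then show False using n iso_ble iso_sym unfolding eq_def by blast
  qed
  then have "iso S (g (?c y) ` S')" using isoS unfolding Z_def by simp
  moreover have "iso S' (g (?c y) ` S')" using iso_image[OF g[OF \<open>eq (?c y)\<close>] S'S(1)] .
  ultimately show "iso (?c x0) S'" using iso_trans iso_sym unfolding S_def by blast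
qed

section \<open>Components of rigid graphs\<close>

definition universals :: "bool \<Rightarrow> 'a set \<Rightarrow> 'a set" where
  "universals b Y = {y\<in>Y. \<forall>w\<in>Y. w \<noteq> y \<longrightarrow> E y w = b}"

lemma universals_iso:
  assumes "emb A B f" "f ` A = B" shows "f ` universals b A = universals b B"
proof
  show "f ` universals b A \<subseteq> universals b B"
  proof
    fix y assume "y \<in> f ` universals b A"
    then obtain x where x: "x \<in> A" "y = f x" "\<And>w. w \<in> A \<Longrightarrow> w \<noteq> x \<Longrightarrow> E x w = b" unfolding universals_def by blast
    have "E y w = b" if w: "w \<in> B" "w \<noteq> y" for w
    proof -
      obtain w' where "w' \<in> A" "w = f w'" using w(1) assms(2) by blast
      then show ?thesis using x w embD(4)[OF assms(1), of x w'] by auto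
    qed
    then show "y \<in> universals b B" unfolding universals_def using x embD(3)[OF assms(1)] by blast
  qed
  show "universals b B \<subseteq> f ` universals b A"
  proof
    fix y assume y: "y \<in> universals b B"
    then obtain x where x: "x \<in> A" "y = f x" using assms(2) unfolding universals_def by blast
    have "E x w = b" if "w \<in> A" "w \<noteq> x" for w
      using y embD(3)[OF assms(1) that(1)] embD(4)[OF assms(1) x(1) that(1)] embD(5)[OF assms(1) x(1) that(1)] that(2)
      unfolding universals_def x(2) by auto
    then show "y \<in> f ` universals b A" using x unfolding universals_def by blast
  qed
qed

text \<open>An embedding \<open>f\<close> into the component \<open>C\<close> gives two siblings
  with different numbers of universal vertices. A vertex \<open>z\<close> outside \<open>C\<close>
  is joined, in the sense \<open>b\<close>, to all of \<open>C\<close>. In \<open>Y1\<close> the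
  vertex \<open>z2\<close> prevents any universal vertex besides \<open>z\<close>, whereas in
  \<open>Y2\<close> both \<open>z\<close> and \<open>f z\<close> are universal.\<close>

lemma rigid_not_in_comp:
  assumes R: "rigid b X" and nc: "\<not> conn (\<not> b) X" and x0: "x0 \<in> X"
  shows "\<not> embeddable X (comp (\<not> b) X x0)"
proof
  define C where "C = comp (\<not> b) X x0"
  assume "embeddable X (comp (\<not> b) X x0)"
  then obtain f where f: "emb X C f" unfolding C_def embeddable_def by blast
  have CX: "C \<subseteq> X" unfolding C_def by (rule comp_sub)
  have cC: "conn (\<not> b) C" unfolding C_def by (rule comp_conn[OF x0])
  have nbC: "\<not> conn b C"
  proof
    assume "conn b C"
    then have "iso X C" using R CX f unfolding rigid_def embeddable_def by blast
    then show False using conn_iso[OF iso_sym cC] nc by blast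
  qed
  obtain z where z: "z \<in> X" "z \<notin> C" using not_conn_comp[OF nc x0] unfolding C_def by blast
  define D where "D = comp b C (f x0)"
  have fxC: "f x0 \<in> C" by (rule embD(3)[OF f x0])
  have conX: "conn b X" using R unfolding rigid_def by blast
  have "conn b (f ` X)" by (rule conn_iso[OF iso_image[OF f order_refl] conX])
  then have fD: "f ` X \<subseteq> D" unfolding D_def by (rule conn_in_comp[OF _ embD(2)[OF f]]) (use x0 in blast)
  obtain z2 where z2: "z2 \<in> C" "z2 \<notin> D" using not_conn_comp[OF nbC fxC] unfolding D_def by blast
  have DC: "D \<subseteq> C" unfolding D_def by (rule comp_sub)
  have zC: "E z w = b" "z \<noteq> w" if "w \<in> C" for w
  proof -
    have "comp (\<not> b) X w = C" using comp_eq that unfolding C_def by blast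
    moreover have "comp (\<not> b) X z \<noteq> C" using z comp_self by blast
    ultimately show "E z w = b" "z \<noteq> w" using comp_cross[of z X w "\<not> b"] z that CX by auto
  qed
  have z2D: "E z2 w = (\<not> b)" "z2 \<noteq> w" if "w \<in> D" for w
  proof -
    have "comp b C w = D" using comp_eq that unfolding D_def by blast
    moreover have "comp b C z2 \<noteq> D" using z2 comp_self by blast
    ultimately show "E z2 w = (\<not> b)" "z2 \<noteq> w" using comp_cross[of z2 C w b] z2 that DC by auto
  qed
  define Y1 where "Y1 = insert z (insert z2 (f ` X))"
  define Y2 where "Y2 = insert z (f ` Y1)"
  have Y1C: "w \<in> Y1 \<Longrightarrow> w = z \<or> w \<in> C" for w unfolding Y1_def using z2 embD(2)[OF f] by blast
  have Y1X: "Y1 \<subseteq> X" using Y1C z CX by blast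
  have fY1: "f ` Y1 \<subseteq> C" using embD(3)[OF f] Y1X by blast
  have Y2X: "Y2 \<subseteq> X" unfolding Y2_def using fY1 z CX by blast
  have cz: "conn b Y" if Y: "z \<in> Y" "\<And>w. w \<in> Y \<Longrightarrow> w = z \<or> w \<in> C" for Y
  proof -
    have "(step b Y)\<^sup>*\<^sup>* z w \<and> (step b Y)\<^sup>*\<^sup>* w z" if "w \<in> Y" for w
    proof (cases "w = z")
      case False
      then have "step b Y z w" "step b Y w z" using Y that zC symE[of w z] unfolding step_def by auto
      then show ?thesis by blast
    qed simp
    then show ?thesis unfolding conn_def using rtranclp_trans by metis
  qed
  have "embeddable X Y1" unfolding embeddable_def using emb_mono[OF emb_image[OF f order_refl] order_refl, of Y1] unfolding Y1_def by blast
  moreover have "conn b Y1" by (rule cz) (use Y1C in \<open>auto simp: Y1_def\<close>)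
  ultimately have i1: "iso X Y1" using R Y1X unfolding rigid_def by blast
  have "embeddable Y1 Y2" unfolding embeddable_def Y2_def using emb_mono[OF emb_image[OF f Y1X] order_refl] by blast
  then have "embeddable X Y2" using \<open>embeddable X Y1\<close> embeddable_trans by blast
  moreover have "conn b Y2" by (rule cz) (use fY1 in \<open>auto simp: Y2_def\<close>)
  ultimately have i2: "iso X Y2" using R Y2X unfolding rigid_def by blast
  obtain p where p: "emb Y1 Y2 p" "p ` Y1 = Y2" using iso_trans[OF iso_sym[OF i1] i2] unfolding iso_def by blast
  have u1: "universals b Y1 \<subseteq> {z}"
  proof
    fix w assume w: "w \<in> universals b Y1"
    have "w \<in> Y1" and wu: "\<And>q. q \<in> Y1 \<Longrightarrow> q \<noteq> w \<Longrightarrow> E w q = b" using w unfolding universals_def by auto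
    then consider "w = z" | "w = z2" | "w \<in> f ` X" unfolding Y1_def by blast
    then show "w \<in> {z}"
    proof cases
      case 2
      have "f x0 \<in> D" using fD x0 by blast
      then show ?thesis using wu[of "f x0"] z2D 2 x0 unfolding Y1_def by auto
    next
      case 3
      then have "w \<in> D" using fD by blast
      then show ?thesis using wu[of z2] z2D symE[of w z2] unfolding Y1_def by auto
    qed simp
  qed
  have "z \<in> universals b Y2" unfolding universals_def Y2_def using zC fY1 by auto
  moreover have "f z \<in> universals b Y2"
  proof -
    have zY: "z \<in> Y1" unfolding Y1_def by blast
    have fzC: "f z \<in> C" using embD(3)[OF f z(1)] .
    have "E (f z) w = b" if w: "w \<in> Y2" "w \<noteq> f z" for w
    proof (cases "w = z")
      case True then show ?thesis using zC[OF fzC] symE[of z "f z"] by simp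
    next
      case False
      then obtain q where q: "q \<in> Y1" "w = f q" using w unfolding Y2_def by blast
      then have "q \<in> C" using Y1C[OF q(1)] w(2) by blast
      then show ?thesis using zC[of q] q embD(4)[OF f z(1), of q] Y1X by auto
    qed
    then show ?thesis unfolding universals_def Y2_def using zY by blast
  qed
  moreover have "f z \<noteq> z" using zC(2)[OF embD(3)[OF f z(1)]] by simp
  ultimately show False using universals_iso[OF p, of b] u1 by (metis (no_types, lifting) image_iff singletonD subsetD)
qed

lemma fin_by_comps:
  assumes fc: "\<And>x. x \<in> X \<Longrightarrow> fin (comp c X x)"
    and nt: "finite {C. \<exists>x\<in>X. C = comp c X x \<and> C \<noteq> {x}}" (is "finite ?N")
  shows "fin X"
proof -
  have "\<forall>C. \<exists>f :: 'a \<Rightarrow> nat. fin C \<longrightarrow> finite (f ` C) \<and> (\<forall>x\<in>C. \<forall>y\<in>C. f x = f y \<longrightarrow> twin C x y)"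
    unfolding fin_def by blast
  then obtain k :: "'a set \<Rightarrow> 'a \<Rightarrow> nat" where
    k: "\<And>C. fin C \<Longrightarrow> finite (k C ` C) \<and> (\<forall>x\<in>C. \<forall>y\<in>C. k C x = k C y \<longrightarrow> twin C x y)" by metis
  obtain e :: "'a set \<Rightarrow> nat" where e: "inj_on e ?N" using finite_imp_inj_to_nat_seg[OF nt] by blast
  \<comment> \<open>The vertices forming a component on their own are mutual twins and share the
    colour 0; \<open>Suc\<close> separates it from the codes of pairs of a component and an inner
    colour.\<close>
  define f where "f = (\<lambda>x. if comp c X x = {x} then 0 else Suc (prod_encode (e (comp c X x), k (comp c X x) x)))"
  have "f ` X \<subseteq> insert 0 (\<Union>C\<in>?N. (\<lambda>i. Suc (prod_encode (e C, i))) ` (k C ` C))"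
  proof
    fix y assume "y \<in> f ` X"
    then obtain x where x: "x \<in> X" "y = f x" by blast
    show "y \<in> insert 0 (\<Union>C\<in>?N. (\<lambda>i. Suc (prod_encode (e C, i))) ` (k C ` C))"
    proof (cases "comp c X x = {x}")
      case False
      have "comp c X x \<in> ?N" using x False by blast
      moreover have "y = Suc (prod_encode (e (comp c X x), k (comp c X x) x))" using x False unfolding f_def by simp
      moreover have "x \<in> comp c X x" by (rule comp_self[OF x(1)])
      ultimately show ?thesis by blast
    qed (use x in \<open>simp add: f_def\<close>)
  qed
  moreover have "finite (\<Union>C\<in>?N. (\<lambda>i. Suc (prod_encode (e C, i))) ` (k C ` C))"
  proof (rule finite_UN_I[OF nt])
    fix C assume "C \<in> ?N"
    then have "fin C" using fc by blast
    then show "finite ((\<lambda>i. Suc (prod_encode (e C, i))) ` (k C ` C))" using k by blast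
  qed
  ultimately have "finite (f ` X)" by (meson finite_insert finite_subset)
  moreover have "twin X x y" if xy: "x \<in> X" "y \<in> X" "f x = f y" for x y
    unfolding twin_def
  proof (intro ballI impI)
    fix z assume z: "z \<in> X" "z \<noteq> x" "z \<noteq> y"
    have far: "E w z = (\<not> c)" if w: "w \<in> X" "z \<notin> comp c X w" for w
    proof -
      have "comp c X w \<noteq> comp c X z" using w comp_self[OF z(1), of c] by blast
      then show ?thesis using comp_cross(2)[OF w(1) z(1)] by blast
    qed
    show "E x z = E y z"
    proof (cases "comp c X x = {x}")
      case True
      then have "comp c X y = {y}" using xy(3) unfolding f_def by (auto split: if_splits)
      then show ?thesis using far[OF xy(1)] far[OF xy(2)] True z by simp
    next
      case False
      then have ny: "comp c X y \<noteq> {y}" using xy(3) unfolding f_def by (auto split: if_splits)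
      have ek: "e (comp c X x) = e (comp c X y)" "k (comp c X x) x = k (comp c X y) y"
        using xy(3) False ny unfolding f_def by auto
      have "comp c X x \<in> ?N" "comp c X y \<in> ?N" using xy False ny by blast+
      then have cc: "comp c X x = comp c X y" using ek(1) inj_onD[OF e] by blast
      have tw: "twin (comp c X x) x y"
        using k[OF fc[OF xy(1)]] comp_self[OF xy(1), of c] comp_self[OF xy(2), of c] ek(2) unfolding cc by blast
      show ?thesis
      proof (cases "z \<in> comp c X x")
        case True then show ?thesis using tw z unfolding twin_def by blast
      next
        case F: False then show ?thesis using far[OF xy(1)] far[OF xy(2)] cc by simp
      qed
    qed
  qed
  ultimately show ?thesis unfolding fin_def by blast
qed

text \<open>By the well-quasi-order, infinitely many nontrivial components contain a sequence
  \<open>D\<close> increasing under embeddability. Shifting along it frees \<open>D 0\<close> and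
  makes room for absorbing all one-vertex components. This gives a sibling \<open>Y1\<close> without
  one-vertex components and a sibling \<open>Y2\<close> in which \<open>d 0\<close> forms
  one.\<close>

lemma rigid_finite_comps:
  assumes XV: "X \<subseteq> V" and R: "rigid b X"
  shows "finite {C. \<exists>x\<in>X. C = comp (\<not> b) X x \<and> C \<noteq> {x}}" (is "finite ?N")
proof (rule ccontr)
  let ?c = "\<lambda>x. comp (\<not> b) X x"
  assume "infinite ?N"
  then obtain q :: "nat \<Rightarrow> 'a set" where q: "inj q" "range q \<subseteq> ?N" using infinite_countable_subset by blast
  have qN: "q i \<in> ?N" for i by (rule subsetD[OF q(2) rangeI])
  have qV: "q i \<in> Pow V" for i
  proof -
    obtain x where "q i = ?c x" using qN[of i] by blast
    then show ?thesis using comp_sub[of "\<not> b" X x] XV by auto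
  qed
  have "\<exists>N. \<forall>n\<ge>N. \<forall>l. \<exists>m>l. embeddable (q n) (q m)"
  proof (rule wqo_tail[of "Pow V" embeddable q, OF _ embeddable_trans qV])
    show "\<exists>i j. i < j \<and> embeddable (t i) (t j)" if "\<And>i. t i \<in> Pow V" for t :: "nat \<Rightarrow> 'a set"
      using wqo_emb[of t] that unfolding embeddable_def by blast
  qed
  then obtain N where N: "\<forall>n\<ge>N. \<forall>l. \<exists>m>l. embeddable (q n) (q m)" by (rule exE)
  have "\<exists>p. \<forall>k. N \<le> p k \<and> (p k < p (Suc k) \<and> embeddable (q (p k)) (q (p (Suc k))))"
  proof (rule dependent_nat_choice)
    show "\<exists>x. N \<le> x" by blast
    show "\<exists>y. N \<le> y \<and> x < y \<and> embeddable (q x) (q y)" if Nx: "N \<le> x" for x and n :: nat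
    proof -
      obtain y where "y > x" "embeddable (q x) (q y)" using N Nx by blast
      then show ?thesis using Nx by (intro exI[of _ y]) simp
    qed
  qed
  then obtain p where p: "\<forall>k. N \<le> p k \<and> (p k < p (Suc k) \<and> embeddable (q (p k)) (q (p (Suc k))))" by (rule exE)
  define D where "D = (\<lambda>k. q (p k))"
  have pm: "i < j \<Longrightarrow> p i < p j" for i j by (rule lift_Suc_mono_less[of p]) (use p in blast)
  have Dne: "D i \<noteq> D j" if "i \<noteq> j" for i j
  proof -
    have "p i \<noteq> p j" using pm[of i j] pm[of j i] that by (cases "i < j") auto
    then show ?thesis using q(1) unfolding D_def inj_def by blast
  qed
  have DN: "D k \<in> ?N" for k unfolding D_def by (rule qN)
  have Dle: "embeddable (D i) (D j)" if "i \<le> j" for i j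
    using that
  proof (induction rule: dec_induct)
    case base show ?case by (rule embeddable_sub) simp
  next
    case (step j)
    have "embeddable (D j) (D (Suc j))" using p unfolding D_def by blast
    then show ?case using embeddable_trans step.IH by blast
  qed
  have DX: "D k \<subseteq> X" "x \<in> D k \<Longrightarrow> ?c x = D k" "\<exists>x. x \<in> D k" for k x
  proof -
    obtain y where y: "y \<in> X" "D k = ?c y" using DN[of k] by blast
    show "D k \<subseteq> X" using y comp_sub by simp
    show "x \<in> D k \<Longrightarrow> ?c x = D k" using y comp_eq by simp
    show "\<exists>x. x \<in> D k" using y comp_self by blast
  qed
  define d where "d = (\<lambda>k. SOME x. x \<in> D k)"
  have d: "d k \<in> D k" for k unfolding d_def using someI_ex[OF DX(3)] .
  have "\<forall>k. \<exists>g. emb (D k) (D (2 * k + 1)) g" using Dle unfolding embeddable_def by simp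
  then obtain g where g: "\<And>k. emb (D k) (D (2 * k + 1)) (g k)" by metis
  define X0 where "X0 = {x\<in>X. ?c x = {x}}"
  have DX0: "x \<notin> X0" if "x \<in> D k" for x k
  proof
    assume x0: "x \<in> X0"
    obtain y where y: "y \<in> X" "D k = ?c y" "D k \<noteq> {y}" using DN[of k] by blast
    have "D k = {x}" using DX(2)[OF that] x0 unfolding X0_def by simp
    then show False using y comp_self[OF y(1), of "\<not> b"] by simp
  qed
  define ixD where "ixD = (\<lambda>x. THE k. x \<in> D k)"
  have ixD: "ixD x = k" if "x \<in> D k" for x k
    unfolding ixD_def
  proof (rule the_equality)
    show "x \<in> D k" by (rule that)
    fix j assume "x \<in> D j"
    then have "D j = D k" using DX(2)[of x j] DX(2)[OF that] by simp
    then show "j = k" using Dne by blast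
  qed
  \<comment> \<open>The component \<open>D k\<close> goes to the odd index \<open>2 * k + 1\<close>;
    the one-vertex components go to distinct even indices from 2 on, given by the enumeration of
    \<open>V\<close>. Index 0 stays free.\<close>
  define F where "F = (\<lambda>x. if x \<in> X0 then d (2 * ix x + 2) else if \<exists>k. x \<in> D k then g (ixD x) x else x)"
  have F0: "F x = d (2 * ix x + 2)" if "x \<in> X0" for x using that unfolding F_def by simp
  have F1: "F x = g k x" if "x \<in> D k" for x k using that DX0 ixD unfolding F_def by auto
  have F2: "F x = x" if "x \<notin> X0" "\<And>k. x \<notin> D k" for x using that unfolding F_def by simp
  have C0: "?c (F x) = D (2 * ix x + 2)" if "x \<in> X0" for x using F0[OF that] DX(2)[OF d] by simp
  have C1: "?c (F x) = D (2 * k + 1)" if "x \<in> D k" for x k using F1[OF that] DX(2)[OF embD(3)[OF g that]] by simp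
  have C2: "?c (F x) \<noteq> D j" if "x \<in> X" "x \<notin> X0" "\<And>k. x \<notin> D k" for x j
    using F2[OF that(2,3)] comp_self[OF that(1), of "\<not> b"] that(3)[of j] by auto
  define Y1 where "Y1 = X - X0"
  define Y2 where "Y2 = insert (d 0) (Y1 - D 0)"
  define W where "W = Y1 - D 0"
  have DW: "y \<in> W" if "y \<in> D k" "D k \<noteq> D 0" for y k
  proof -
    have "y \<notin> D 0" using DX(2)[OF that(1)] DX(2)[of y 0] that(2) by auto
    then show ?thesis using DX(1)[of k] DX0[OF that(1)] that(1) unfolding W_def Y1_def by blast
  qed
  have inW: "F x \<in> W" if x: "x \<in> X" for x
  proof -
    consider "x \<in> X0" | k where "x \<in> D k" | "x \<notin> X0" "\<And>k. x \<notin> D k" by blast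
    then show ?thesis
    proof cases
      case 1
      have "F x \<in> D (2 * ix x + 2)" using F0[OF 1] d by simp
      moreover have "D (2 * ix x + 2) \<noteq> D 0" by (rule Dne) simp
      ultimately show ?thesis using DW by blast
    next
      case 2
      have "F x \<in> D (2 * k + 1)" using F1[OF 2] embD(3)[OF g 2] by simp
      moreover have "D (2 * k + 1) \<noteq> D 0" by (rule Dne) simp
      ultimately show ?thesis using DW by blast
    next
      case 3 then show ?thesis using F2 x unfolding W_def Y1_def by simp
    qed
  qed
  have WX: "W \<subseteq> X" unfolding W_def Y1_def by blast
  have ixinj: "x = y" if "x \<in> X" "y \<in> X" "ix x = ix y" for x y
    using inj_onD[OF inj_on_to_nat_on[OF cntV], of x y] that XV unfolding ix_def by blast
  have "emb X W F"
  proof (rule emb_by_comps[OF inW WX, where b="\<not> b"])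
    fix x y assume xy: "x \<in> X" "y \<in> X" "x \<noteq> y" "?c x = ?c y"
    have yx: "y \<in> ?c x" "x \<in> ?c x" using comp_self[OF xy(2), of "\<not> b"] comp_self[OF xy(1), of "\<not> b"] xy(4) by auto
    have x0: "x \<notin> X0" "y \<notin> X0" using yx xy unfolding X0_def by auto
    show "F x \<noteq> F y \<and> E (F x) (F y) = E x y"
    proof (cases "\<exists>k. x \<in> D k")
      case True
      then obtain k where k: "x \<in> D k" by blast
      then have "y \<in> D k" using DX(2)[OF k] yx by simp
      then show ?thesis using F1 k embD(4)[OF g k, of y] embD(5)[OF g k, of y] xy(3) by auto
    next
      case False
      have ny: "y \<notin> D k" for k
      proof
        assume "y \<in> D k"
        then have "x \<in> D k" using DX(2)[of y k] yx xy(4) by simp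
        then show False using False by blast
      qed
      have "F x = x" "F y = y" by (rule F2[OF x0(1)], use False in blast) (rule F2[OF x0(2) ny])
      then show ?thesis using xy(3) by simp
    qed
  next
    fix x y assume xy: "x \<in> X" "y \<in> X" "?c x \<noteq> ?c y"
    then have ne: "x \<noteq> y" by blast
    have sym: "?c (F x) \<noteq> ?c (F y)" if xy: "x \<in> X" "y \<in> X" "?c x \<noteq> ?c y" and x: "x \<in> X0" for x y
    proof -
      have ne: "x \<noteq> y" using xy by blast
      consider "y \<in> X0" | k where "y \<in> D k" | "y \<notin> X0" "\<And>k. y \<notin> D k" by blast
      then show ?thesis
      proof cases
        case 1
        have "2 * ix x + 2 \<noteq> 2 * ix y + 2" using ixinj[OF xy(1,2)] ne by auto
        then show ?thesis using C0[OF x] C0[OF 1] Dne[of "2 * ix x + 2" "2 * ix y + 2"] by simp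
      next
        case 2
        have "2 * ix x + 2 \<noteq> 2 * k + 1" by presburger
        then show ?thesis using C0[OF x] C1[OF 2] Dne[of "2 * ix x + 2" "2 * k + 1"] by simp
      next
        case 3 then show ?thesis using C0[OF x] C2[OF xy(2) 3, of "2 * ix x + 2"] by simp
      qed
    qed
    have sym2: "?c (F x) \<noteq> ?c (F y)" if xy: "x \<in> X" "y \<in> X" "?c x \<noteq> ?c y" and x: "x \<in> D k" "y \<notin> X0" for x y k
    proof (cases "\<exists>j. y \<in> D j")
      case True
      then obtain j where j: "y \<in> D j" by blast
      have "k \<noteq> j" using xy(3) DX(2)[OF x(1)] DX(2)[OF j] by auto
      then have "2 * k + 1 \<noteq> 2 * j + 1" by simp
      then show ?thesis using C1[OF x(1)] C1[OF j] Dne[of "2 * k + 1" "2 * j + 1"] by simp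
    next
      case False
      then have "\<And>j. y \<notin> D j" by blast
      then show ?thesis using C1[OF x(1)] C2[OF xy(2) x(2), of "2 * k + 1"] by simp
    qed
    show "?c (F x) \<noteq> ?c (F y)"
    proof (cases "x \<in> X0 \<or> y \<in> X0")
      case True then show ?thesis using sym[OF xy] sym[OF xy(2,1)] xy(3) by auto
    next
      case n0: False
      show ?thesis
      proof (cases "(\<exists>k. x \<in> D k) \<or> (\<exists>k. y \<in> D k)")
        case True then show ?thesis using sym2[OF xy] sym2[OF xy(2,1)] xy(3) n0 by auto
      next
        case False then show ?thesis using F2[of x] F2[of y] n0 xy(3) by auto
      qed
    qed
  qed
  then have bW: "embeddable X W" unfolding embeddable_def by blast
  have Y12: "Y1 \<subseteq> X" "Y2 \<subseteq> X" "W \<subseteq> Y1" "W \<subseteq> Y2"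
    unfolding Y1_def Y2_def W_def using DX(1) d by auto
  have dW: "d k \<in> W" if "k \<noteq> 0" for k
    by (rule DW[OF d Dne[OF that]])
  have "?c (d 1) \<noteq> ?c (d 2)" using DX(2)[OF d[of 1]] DX(2)[OF d[of 2]] Dne[of 1 2] by simp
  then have cY: "conn b Y" if "W \<subseteq> Y" "Y \<subseteq> X" for Y
    using conn_two_comps[OF that(2), of "d 1" "d 2"] that(1) dW[of 1] dW[of 2] by auto
  have i: "iso X Y" if "W \<subseteq> Y" "Y \<subseteq> X" for Y
    using R cY[OF that] embeddable_trans[OF bW embeddable_sub[OF that(1)]] that(2) unfolding rigid_def by blast
  have "iso Y1 Y2" using iso_trans[OF iso_sym[OF i] i] Y12 by blast
  then obtain f where f: "emb Y1 Y2 f" "f ` Y1 = Y2" unfolding iso_def by blast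
  have "d 0 \<in> universals b Y2"
    unfolding universals_def
  proof (intro CollectI conjI ballI impI)
    show "d 0 \<in> Y2" unfolding Y2_def by simp
    fix w assume w: "w \<in> Y2" "w \<noteq> d 0"
    then have w': "w \<in> X" "w \<notin> D 0" unfolding Y2_def Y1_def by auto
    have "?c (d 0) \<noteq> ?c w" using DX(2)[OF d[of 0]] comp_self[OF w'(1), of "\<not> b"] w'(2) by auto
    moreover have "d 0 \<in> X" using d DX(1) by blast
    ultimately show "E (d 0) w = b" using comp_cross(2)[of "d 0" X w "\<not> b"] w'(1) by simp
  qed
  then obtain y where y: "y \<in> universals b Y1" using universals_iso[OF f, of b] by blast
  then have yX: "y \<in> X" "?c y \<noteq> {y}" "y \<in> Y1" unfolding universals_def Y1_def X0_def by auto
  have "conn (\<not> b) (?c y)" by (rule comp_conn[OF yX(1)])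
  moreover have "y \<in> ?c y" by (rule comp_self[OF yX(1)])
  moreover obtain w where w: "w \<in> ?c y" "w \<noteq> y" using yX(2) \<open>y \<in> ?c y\<close> by blast
  have "\<not> conn (\<not> b) (?c y)"
  proof (rule conn_cut[of "{y}"])
    show "{y} \<subseteq> ?c y" "y \<in> {y}" using \<open>y \<in> ?c y\<close> by auto
    show "w \<in> ?c y - {y}" using w by blast
    fix u z assume uz: "u \<in> {y}" "z \<in> ?c y - {y}"
    have "z \<in> Y1"
    proof -
      have z: "z \<in> X" "?c z = ?c y" using uz comp_sub comp_eq by blast+
      then have "z \<notin> X0" using uz \<open>y \<in> ?c y\<close> unfolding X0_def by auto
      then show ?thesis using z unfolding Y1_def by blast
    qed
    then show "E u z = (\<not> \<not> b)" using y uz unfolding universals_def by auto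
  qed
  ultimately show False by blast
qed

text \<open>A first-order property, hence invariant under isomorphism: seen from any vertex \<open>x\<close>, there are
  arbitrarily high nodes consisting of a single vertex that is not adjacent to \<open>x\<close>.\<close>

definition thin :: "'a set \<Rightarrow> bool" where
  "thin F \<longleftrightarrow> (\<forall>x\<in>F. \<forall>z\<in>F. z \<noteq> x \<longrightarrow> (\<exists>y\<in>F. y \<noteq> x \<and> \<not> E x y \<and> below F x z y \<and>
     (\<forall>w\<in>F. w \<noteq> x \<longrightarrow> w \<noteq> y \<longrightarrow> \<not> E x w \<longrightarrow> (\<exists>t\<in>F. t \<noteq> x \<and> E x t \<and> E t w \<noteq> E t y))))"

lemma thin_iso:
  assumes "iso A B" "thin A" shows "thin B"
proof -
  obtain f where f: "emb A B f" "f ` A = B" using assms unfolding iso_def by blast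
  note e = embD(4)[OF f(1)] and inj = embD(5)[OF f(1)] and fB = embD(3)[OF f(1)]
  show ?thesis unfolding thin_def
  proof (intro ballI impI)
    fix x z assume "x \<in> B" "z \<in> B" "z \<noteq> x"
    then obtain x' z' where xz: "x' \<in> A" "x = f x'" "z' \<in> A" "z = f z'" "z' \<noteq> x'" using f(2) by blast
    from assms(2)[unfolded thin_def, THEN bspec, OF xz(1), THEN bspec, OF xz(3), THEN mp, OF xz(5)]
    obtain y' where y0: "y' \<in> A" "y' \<noteq> x' \<and> \<not> E x' y' \<and> below A x' z' y' \<and>
      (\<forall>w\<in>A. w \<noteq> x' \<longrightarrow> w \<noteq> y' \<longrightarrow> \<not> E x' w \<longrightarrow> (\<exists>t\<in>A. t \<noteq> x' \<and> E x' t \<and> E t w \<noteq> E t y'))"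
      by (rule bexE)
    then have y': "y' \<in> A" "y' \<noteq> x'" "\<not> E x' y'" "below A x' z' y'"
      and sep: "w \<in> A \<Longrightarrow> w \<noteq> x' \<Longrightarrow> w \<noteq> y' \<Longrightarrow> \<not> E x' w \<Longrightarrow> (\<exists>t\<in>A. t \<noteq> x' \<and> E x' t \<and> E t w \<noteq> E t y')" for w
      by simp_all
    show "\<exists>y\<in>B. y \<noteq> x \<and> \<not> E x y \<and> below B x z y \<and>
     (\<forall>w\<in>B. w \<noteq> x \<longrightarrow> w \<noteq> y \<longrightarrow> \<not> E x w \<longrightarrow> (\<exists>t\<in>B. t \<noteq> x \<and> E x t \<and> E t w \<noteq> E t y))"
    proof (rule bexI[of _ "f y'"], intro conjI ballI impI)
      show "f y' \<noteq> x" using inj[OF y'(1) xz(1)] y'(2) xz(2) by blast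
      show "\<not> E x (f y')" using e[OF xz(1) y'(1)] y'(3) xz(2) by simp
      show "below B x z (f y')"
      proof (cases "E x' z' = E x' y'")
        case True
        then obtain t where t: "t \<in> A" "t \<noteq> x'" "E x' t \<noteq> E x' z'" "E z' t = E x' t" "E t y' = E x' y'"
          using y'(4) unfolding below_def by auto
        have "f t \<in> B - {x}" using fB[OF t(1)] inj[OF t(1) xz(1)] t(2) xz(2) by blast
        then show ?thesis using t True e[OF xz(1) t(1)] e[OF xz(1) xz(3)] e[OF xz(3) t(1)] e[OF t(1) y'(1)] e[OF xz(1) y'(1)]
          unfolding below_def xz(2,4) by auto
      next
        case False
        then show ?thesis using y'(4) e[OF xz(1,3)] e[OF xz(1) y'(1)] e[OF xz(3) y'(1)] unfolding below_def xz(2,4) by auto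
      qed
      fix w assume w: "w \<in> B" "w \<noteq> x" "w \<noteq> f y'" "\<not> E x w"
      then obtain w' where w': "w' \<in> A" "w = f w'" using f(2) by blast
      have "\<not> E x' w'" using w(4) e[OF xz(1) w'(1)] w'(2) xz(2) by simp
      then obtain t where t: "t \<in> A" "t \<noteq> x'" "E x' t" "E t w' \<noteq> E t y'" using sep[OF w'(1)] w w' xz(2) by blast
      have "f t \<in> B" "f t \<noteq> x" "E x (f t)" "E (f t) w \<noteq> E (f t) (f y')"
        using fB[OF t(1)] inj[OF t(1) xz(1)] t xz(2) w'(2) e[OF xz(1) t(1)] e[OF t(1) w'(1)] e[OF t(1) y'(1)] by auto
      then show "\<exists>t\<in>B. t \<noteq> x \<and> E x t \<and> E t w \<noteq> E t (f y')" by blast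
    qed (rule fB[OF y'(1)])
  qed
qed

lemma pemb_insert:
  assumes f: "pemb v v K K' f" and v: "v \<notin> K" "v \<notin> K'"
  shows "emb (insert v K) (insert v K') (f(v := v))"
proof (rule embI)
  note k = f[unfolded pemb_def]
  show "(f(v := v)) x \<in> insert v K'" if "x \<in> insert v K" for x using that embD(3)[OF conjunct1[OF k]] by auto
  fix x y assume xy: "x \<in> insert v K" "y \<in> insert v K" "x \<noteq> y"
  show "(f(v := v)) x \<noteq> (f(v := v)) y \<and> E ((f(v := v)) x) ((f(v := v)) y) = E x y"
  proof (cases "x = v \<or> y = v")
    case True
    then show ?thesis using xy k v embD(3)[OF conjunct1[OF k]] symE by (metis fun_upd_apply insertE)
  next
    case False
    then have "x \<in> K" "y \<in> K" using xy by auto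
    then show ?thesis using False embD(4)[OF conjunct1[OF k]] embD(5)[OF conjunct1[OF k]] xy(3) by auto
  qed
qed

end

section \<open>Graphs connected in both senses\<close>

context base begin

lemma blE: "bl x w \<Longrightarrow> x \<in> X \<Longrightarrow> w \<in> X \<Longrightarrow> E x w = E v w"
  using below_E[OF XV vV] by blast

text \<open>If no vertex of colour \<open>e\<close> branched off above \<open>u\<close>, cutting the
  chain at or around the node of \<open>u\<close> would leave two parts joined uniformly, against
  connectedness in one of the two senses.\<close>

lemma above_ex:
  assumes c: "\<And>b. conn b X" and u: "u \<in> X - {v}"
  shows "\<exists>w\<in>X - {v}. bl u w \<and> E v w = e"
proof (rule ccontr)
  assume neg: "\<not> ?thesis"
  show False
  proof (cases "E v u = e")
    case False
    define U where "U = insert v {w\<in>X - {v}. bl w u}"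
    have cr: "E x w = (\<not> e)" if xw: "x \<in> U" "w \<in> X - U" for x w
    proof -
      have w: "w \<in> X - {v}" "\<not> bl w u" using xw(2) unfolding U_def by auto
      have "E v w = (\<not> e)"
      proof (cases "bl u w")
        case F: False
        then have "same_node X v w u" using w unfolding same_node_def by blast
        then show ?thesis using same_node_E False by blast
      qed (use neg w in blast)
      moreover have "E x w = E v w"
      proof (cases "x = v")
        case F: False
        then have x: "x \<in> X - {v}" "bl x u" using xw(1) unfolding U_def by auto
        then have "bl x w" using bl_cases[OF x(1) u w(1) x(2)] w(2) by blast
        then show ?thesis using blE x w by blast
      qed simp
      ultimately show ?thesis by simp
    qed
    have "\<not> conn e X"
    proof (rule conn_cut[of U])
      show "U \<subseteq> X" "v \<in> U" unfolding U_def using vX by auto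
      show "u \<in> X - U" using u below_neq unfolding U_def by blast
    qed (rule cr)
    then show False using c by blast
  next
    case True
    define U where "U = insert v {w\<in>X - {v}. \<not> bl u w}"
    show False
    proof (cases "\<exists>w\<in>X - {v}. bl u w")
      case T: True
      then obtain w0 where w0: "w0 \<in> X - {v}" "bl u w0" by blast
      have cr: "E x w = (\<not> e)" if xw: "x \<in> U" "w \<in> X - U" for x w
      proof -
        have w: "w \<in> X - {v}" "bl u w" using xw(2) unfolding U_def by auto
        have "E x w = E v w"
        proof (cases "x = v")
          case F: False
          then have x: "x \<in> X - {v}" "\<not> bl u x" using xw(1) unfolding U_def by auto
          then have "bl x w" using bl_cases[OF u w(1) x(1) w(2)] by blast
          then show ?thesis using blE x w by blast
        qed simp
        then show ?thesis using neg w by blast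
      qed
      have "\<not> conn e X"
      proof (rule conn_cut[of U])
        show "U \<subseteq> X" "v \<in> U" unfolding U_def using vX by auto
        show "w0 \<in> X - U" using w0 unfolding U_def by blast
      qed (rule cr)
      then show False using c by blast
    next
      case F: False
      \<comment> \<open>Here nothing lies above \<open>u\<close>, so everything outside
        \<open>U'\<close> belongs to the node of \<open>u\<close> and has colour \<open>e\<close>;
        the connectedness violated is the one for \<open>\<not> e\<close>.\<close>
      define U' where "U' = insert v {w\<in>X - {v}. bl w u}"
      have cr: "E x w = (\<not> (\<not> e))" if xw: "x \<in> U'" "w \<in> X - U'" for x w
      proof -
        have w: "w \<in> X - {v}" "\<not> bl w u" using xw(2) unfolding U'_def by auto
        then have "same_node X v w u" using F unfolding same_node_def by blast
        then have "E v w = e" using same_node_E True by blast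
        moreover have "E x w = E v w"
        proof (cases "x = v")
          case F: False
          then have x: "x \<in> X - {v}" "bl x u" using xw(1) unfolding U'_def by auto
          then have "bl x w" using bl_cases[OF x(1) u w(1) x(2)] w(2) by blast
          then show ?thesis using blE x w by blast
        qed simp
        ultimately show ?thesis by simp
      qed
      have "\<not> conn (\<not> e) X"
      proof (rule conn_cut[of U'])
        show "U' \<subseteq> X" "v \<in> U'" unfolding U'_def using vX by auto
        show "u \<in> X - U'" using u below_neq unfolding U'_def by blast
      qed (rule cr)
      then show False using c by blast
    qed
  qed
qed

text \<open>Above \<open>v\<close> the chain is cut into intervals \<open>Y n\<close> that recur up
  to embedding, so it embeds into itself with room to spare. The first sibling uses the room to
  double singleton nodes, the second to insert new ones.\<close>

theorem thick_and_thin: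
  assumes c: "\<And>b. conn b X" and a: "a \<in> X" "a \<noteq> v"
  shows "\<exists>F. F \<subseteq> X \<and> embeddable X F \<and> (\<forall>b. conn b F) \<and> \<not> thin F"
    and "\<exists>F. F \<subseteq> X \<and> embeddable X F \<and> (\<forall>b. conn b F) \<and> thin F"
proof -
  define T where "T = X - {v}"
  \<comment> \<open>Every gap must contain both colours. This keeps the siblings connected in both
    senses and supplies the vertices from which singleton nodes are made.\<close>
  define Q where "Q = (\<lambda>p w. \<forall>e. \<exists>x\<in>T. E v x = e \<and> bl p x \<and> \<not> bl w x)"
  have "T \<subseteq> V" using XV unfolding T_def by blast
  then have cT: "countable T" by (rule countable_subset[OF _ cntV])
  have aT: "a \<in> T" using a unfolding T_def by blast
  have "\<exists>u::nat \<Rightarrow> 'a. (\<forall>n. u n \<in> T \<and> bl (u n) (u (Suc n)) \<and> Q (u n) (u (Suc n))) \<and> (\<forall>x\<in>T. \<exists>n. bl x (u n))"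
  proof (rule cofinal_seq[OF cT aT])
    show "bl x z" if "x \<in> T" "y \<in> T" "z \<in> T" "bl x y" "bl y z" for x y z
      using bl_trans that unfolding T_def by blast
    show "bl x z \<or> bl z y" if "x \<in> T" "y \<in> T" "z \<in> T" "bl x y" for x y z
      using bl_cases that unfolding T_def by blast
    show "\<exists>w\<in>T. bl p w \<and> Q p w" if p: "p \<in> T" for p
    proof -
      obtain x1 where x1: "x1 \<in> T" "bl p x1" "E v x1 = True" using above_ex[OF c, of p True] p unfolding T_def by blast
      obtain x2 where x2: "x2 \<in> T" "bl x1 x2" "E v x2 = False" using above_ex[OF c, of x1 False] x1 unfolding T_def by blast
      have px: "bl p x2" using bl_trans x1 x2 p unfolding T_def by blast
      have "\<not> bl x2 x1" using bl_asym x1 x2 unfolding T_def by blast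
      moreover have "\<not> bl x2 x2" using below_neq by blast
      ultimately have "\<exists>x\<in>T. E v x = e \<and> bl p x \<and> \<not> bl x2 x" for e
        using x1 x2 px by (cases e) auto
      then show ?thesis using x2 px unfolding Q_def by blast
    qed
    show "Q p w'" if "p \<in> T" "w \<in> T" "w' \<in> T" "Q p w" "bl w w'" for p w w'
      unfolding Q_def
    proof
      fix e
      obtain x where x: "x \<in> T" "E v x = e" "bl p x" "\<not> bl w x" using \<open>Q p w\<close> unfolding Q_def by blast
      have "\<not> bl w' x" using bl_trans[of w w' x] that x unfolding T_def by blast
      then show "\<exists>x\<in>T. E v x = e \<and> bl p x \<and> \<not> bl w' x" using x by blast
    qed
  qed
  then obtain u where u0: "\<forall>n. u n \<in> T \<and> bl (u n) (u (Suc n)) \<and> Q (u n) (u (Suc n))" and u1: "\<forall>x\<in>T. \<exists>n. bl x (u n)"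
    by (elim exE conjE)
  have u: "u n \<in> T" "bl (u n) (u (Suc n))" "Q (u n) (u (Suc n))" "x \<in> T \<Longrightarrow> \<exists>n. bl x (u n)" for n x
    using u0 u1 by simp_all
  have TX: "x \<in> X - {v}" if "x \<in> T" for x using that unfolding T_def .
  have umono: "bl (u i) (u j)" if "i < j" for i j
    using that
  proof (induction j)
    case (Suc j)
    then show ?case using u(2)[of j] bl_trans[OF TX[OF u(1)[of i]] TX[OF u(1)[of j]] TX[OF u(1)[of "Suc j"]]]
      by (cases "i = j") auto
  qed simp
  define Z where "Z = (\<lambda>n. {x\<in>T. bl (u n) x \<and> \<not> bl (u (Suc n)) x})"
  have ZP: "Z n \<in> Pow (X - {v})" for n unfolding Z_def T_def by blast
  have "\<exists>N. \<forall>n\<ge>N. \<forall>l. \<exists>m>l. pointed_le (Z n) (Z m)"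
    by (rule wqo_tail[of "Pow (X - {v})" pointed_le Z, OF wqo_ple pointed_le_trans ZP])
  then obtain N where N: "\<forall>n\<ge>N. \<forall>l. \<exists>m>l. pointed_le (Z n) (Z m)" by (rule exE)
  define Y where "Y = (\<lambda>n. Z (N + n))"
  define P where "P = {x\<in>T. \<not> bl (u N) x}"
  have YT: "Y n \<subseteq> T" for n unfolding Y_def Z_def by blast
  have YX: "Y n \<subseteq> X - {v}" for n using YT unfolding T_def .
  have PX: "P \<subseteq> X - {v}" unfolding P_def T_def by blast
  have lab: "\<exists>x\<in>Y n. E v x = e" for n e
    using u(3)[of "N + n"] unfolding Q_def Y_def Z_def by auto
  have rec: "\<exists>m>l. pointed_le (Y n) (Y m)" for n l
  proof -
    obtain m where "m > N + l" "pointed_le (Z (N + n)) (Z m)" using N by (metis le_add1)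
    then show ?thesis unfolding Y_def by (intro exI[of _ "m - N"]) auto
  qed
  have uY: "bl (u (N + n)) x" if "x \<in> Y n" for x n using that unfolding Y_def Z_def by simp
  have Yord: "bl x y" if "x \<in> Y i" "y \<in> Y j" "i < j" for x y i j
  proof -
    have xy: "x \<in> T" "y \<in> T" "\<not> bl (u (Suc (N + i))) x" using that unfolding Y_def Z_def by auto
    have "\<not> bl (u (N + j)) x"
    proof
      assume a: "bl (u (N + j)) x"
      show False
      proof (cases "Suc i = j")
        case False
        then have "bl (u (Suc (N + i))) (u (N + j))" using umono that(3) by simp
        then show False using bl_trans[OF TX[OF u(1)] TX[OF u(1)] TX[OF xy(1)]] a xy(3) by blast
      qed (use a xy in auto)
    qed
    then show ?thesis using bl_cases[OF TX[OF u(1)] TX[OF xy(2)] TX[OF xy(1)] uY[OF that(2)]] by blast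
  qed
  have stY: "st (Y i) (Y j)" if "i < j" for i j by (rule bl_stk[OF YX YX]) (rule Yord[OF _ _ that])
  have uNY: "bl (u N) x" if "x \<in> Y n" for x n
  proof (cases "n = 0")
    case False
    then have "bl (u N) (u (N + n))" using umono by simp
    then show ?thesis using bl_trans[OF TX[OF u(1)] TX[OF u(1)]] uY[OF that] TX YT that by blast
  qed (use uY[OF that] in simp)
  have Pord: "bl x y" if "x \<in> P" "y \<in> Y n" for x y n
    using bl_cases[OF TX[OF u(1)], of y x N] uNY[OF that(2)] that TX YT unfolding P_def by blast
  have stP: "st P (Y n)" for n by (rule bl_stk[OF PX YX]) (rule Pord)
  have Xdec: "X = insert v (P \<union> (\<Union>n. Y n))"
  proof (intro equalityI subsetI)
    fix x assume x: "x \<in> X"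
    show "x \<in> insert v (P \<union> (\<Union>n. Y n))"
    proof (cases "x = v \<or> \<not> bl (u N) x")
      case True then show ?thesis using x unfolding P_def T_def by blast
    next
      case False
      then have xT: "x \<in> T" using x unfolding T_def by blast
      obtain m where m: "bl x (u m)" using u(4)[OF xT] by blast
      have "bl x (u (N + Suc m))" using umono[of m "N + Suc m"] bl_trans[OF TX[OF xT] TX[OF u(1)] TX[OF u(1)] m] by simp
      then have "\<exists>n. \<not> bl (u (N + n)) x" using bl_asym[OF TX[OF xT] TX[OF u(1)]] by blast
      then obtain n where n: "\<not> bl (u (N + n)) x" "\<And>k. k < n \<Longrightarrow> bl (u (N + k)) x"
        using exists_least_iff[of "\<lambda>n. \<not> bl (u (N + n)) x"] by blast
      then obtain k where k: "n = Suc k" using False by (cases n) auto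
      have "x \<in> Y k" using n xT unfolding Y_def Z_def k by simp
      then show ?thesis by blast
    qed
  qed (use vX PX YX in auto)
  \<comment> \<open>Far enough up, every vertex sees the chain exactly as \<open>v\<close> does. So
    the choice of \<open>v\<close> does not matter for connectedness and for
    \<open>thin\<close>.\<close>
  have late: "\<exists>n0. \<forall>k\<ge>n0. \<forall>t\<in>Y k. t \<noteq> x \<and> E x t = E v t" if x: "x \<in> X" for x
  proof (cases "x = v")
    case True then show ?thesis using YX by blast
  next
    case False
    then have xT: "x \<in> T" using x unfolding T_def by blast
    obtain n where n: "bl x (u n)" using u(4)[OF xT] by blast
    have "t \<noteq> x \<and> E x t = E v t" if k: "n \<le> k" "t \<in> Y k" for k t
    proof -
      have tT: "t \<in> T" using YT k by blast
      have "bl x (u (N + k))"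
      proof (cases "n = N + k")
        case F: False
        then have "bl (u n) (u (N + k))" using umono k by simp
        then show ?thesis using bl_trans[OF TX[OF xT] TX[OF u(1)] TX[OF u(1)] n] by blast
      qed (use n in simp)
      then have "bl x t" using bl_trans[OF TX[OF xT] TX[OF u(1)] TX[OF tT]] uY[OF k(2)] by blast
      then show ?thesis using blE[of x t] below_neq[of X v x t] x TX[OF tT] by blast
    qed
    then show ?thesis by blast
  qed
  have connF: "conn b F" if F: "F \<subseteq> X" "\<And>n. \<exists>k\<ge>n. \<exists>t\<in>F \<inter> Y k. E v t = b" for F b
  proof (rule conn_common)
    fix x y assume xy: "x \<in> F" "y \<in> F"
    obtain n1 where n1: "\<forall>k\<ge>n1. \<forall>t\<in>Y k. t \<noteq> x \<and> E x t = E v t" using late[of x] xy F(1) by blast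
    obtain n2 where n2: "\<forall>k\<ge>n2. \<forall>t\<in>Y k. t \<noteq> y \<and> E y t = E v t" using late[of y] xy F(1) by blast
    obtain k t where k: "k \<ge> max n1 n2" "t \<in> F" "t \<in> Y k" "E v t = b" using F(2)[of "max n1 n2"] by blast
    then show "\<exists>t\<in>F. t \<noteq> x \<and> t \<noteq> y \<and> E x t = b \<and> E y t = b" using n1 n2 by (intro bexI[of _ t]) auto
  qed
  have bleX: "embeddable X (insert v (P \<union> (\<Union>n. F n)))"
    if F: "\<And>n. pointed_le (Y n) (F n)" "\<And>n. F n \<subseteq> X - {v}" "\<And>n. st P (F n)" "\<And>i j. i < j \<Longrightarrow> st (F i) (F j)" for F
  proof -
    define Y' where "Y' = (\<lambda>n. case n of 0 \<Rightarrow> P | Suc k \<Rightarrow> Y k)"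
    define F' where "F' = (\<lambda>n. case n of 0 \<Rightarrow> P | Suc k \<Rightarrow> F k)"
    have lt: "st (Y' i) (Y' j) \<and> st (F' i) (F' j)" if ij: "i < j" for i j
    proof -
      obtain j' where j': "j = Suc j'" using ij by (cases j) auto
      show ?thesis using ij stP stY F unfolding Y'_def F'_def j' by (cases i) auto
    qed
    have p1: "pointed_le (P \<union> (\<Union>n. Y n)) (\<Union>n\<in>UNIV. F' n)"
    proof (rule glue[where I=UNIV and Y=Y'])
      show "P \<union> (\<Union>n. Y n) \<subseteq> (\<Union>n. Y' n)"
      proof
        fix x assume "x \<in> P \<union> (\<Union>n. Y n)"
        then have "x \<in> Y' 0 \<or> (\<exists>n. x \<in> Y' (Suc n))" unfolding Y'_def by auto
        then show "x \<in> (\<Union>n. Y' n)" by blast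
      qed
      show "pointed_le (Y' i) (F' i)" for i using F(1) pointed_le_sub unfolding Y'_def F'_def by (cases i) auto
      show "st (Y' i) (Y' j) \<and> st (F' i) (F' j) \<or> st (Y' j) (Y' i) \<and> st (F' j) (F' i)" if "i \<noteq> j" for i j
        using lt[of i j] lt[of j i] that by (cases "i < j") auto
    qed
    have p2: "(\<Union>n. F' n) \<subseteq> P \<union> (\<Union>n. F n)"
    proof
      fix x assume "x \<in> (\<Union>n. F' n)"
      then obtain n where "x \<in> F' n" by blast
      then show "x \<in> P \<union> (\<Union>n. F n)" unfolding F'_def by (cases n) auto
    qed
    have "pointed_le (P \<union> (\<Union>n. Y n)) (P \<union> (\<Union>n. F n))" by (rule pointed_le_trans[OF p1 pointed_le_sub[OF p2]])
    then obtain f where f: "pemb v v (P \<union> (\<Union>n. Y n)) (P \<union> (\<Union>n. F n)) f" unfolding pointed_le_def by blast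
    have "v \<notin> P \<union> (\<Union>n. Y n)" "v \<notin> P \<union> (\<Union>n. F n)" using PX YX F(2) by blast+
    from pemb_insert[OF f this] show ?thesis unfolding embeddable_def Xdec[symmetric] by blast
  qed
  show "\<exists>F. F \<subseteq> X \<and> embeddable X F \<and> (\<forall>b. conn b F) \<and> \<not> thin F"
  proof -
    have gY: "good (Y n)" for n by (rule good_all[OF YX])
    have "\<exists>F l. (\<forall>n. F n \<subseteq> (\<Union>m\<in>{l n<..l (Suc n)}. Y m) \<and> pointed_le (Y n) (F n) \<and> thick (F n)) \<and>
       (\<forall>n. n \<le> l n \<and> l n < l (Suc n)) \<and>
       (\<forall>i j. i < j \<longrightarrow> (if True then st (F i) (F j) else st (F j) (F i)))"
      by (rule blocks[OF gY rec]) (use stY in simp)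
    then obtain F l where F0: "\<forall>n. F n \<subseteq> (\<Union>m\<in>{l n<..l (Suc n)}. Y m) \<and> pointed_le (Y n) (F n) \<and> thick (F n)"
       and l0: "\<forall>n. n \<le> l n \<and> l n < l (Suc n)"
       and Fs0: "\<forall>i j. i < j \<longrightarrow> (if True then st (F i) (F j) else st (F j) (F i))"
      by (elim exE conjE)
    have F: "F n \<subseteq> (\<Union>m\<in>{l n<..l (Suc n)}. Y m)" "pointed_le (Y n) (F n)" "thick (F n)" for n using F0 by simp_all
    have Fs: "st (F i) (F j)" if "i < j" for i j using Fs0 that by simp
    have FX: "F n \<subseteq> X - {v}" for n using F(1)[of n] YX by blast
    have PF: "st P (F n)" for n
      by (rule stacked_mono[OF _ order_refl F(1)]) (rule stacked_UN2, rule stP)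
    define G where "G = (\<Union>n. F n)"
    define Fa where "Fa = insert v (P \<union> G)"
    have FaX: "Fa \<subseteq> X" using vX PX FX unfolding Fa_def G_def by blast
    have "thick G" unfolding G_def
    proof (rule thick_UN)
      show "st (F i) (F j) \<or> st (F j) (F i)" if "i \<noteq> j" for i j using Fs[of i j] Fs[of j i] that by (cases "i < j") auto
    qed (rule F(3))
    have PG: "st P G" unfolding G_def by (rule stacked_UN2) (rule PF)
    have "conn b Fa" for b
    proof (rule connF[OF FaX])
      fix n
      obtain x where x: "x \<in> Y n" "E v x = b" using lab by blast
      obtain f where f: "pemb v v (Y n) (F n) f" using F(2) unfolding pointed_le_def by blast
      have "f x \<in> F n" "E v (f x) = b" using f x unfolding pemb_def emb_def by auto
      moreover obtain m where "l n < m" "f x \<in> Y m" using F(1)[of n] \<open>f x \<in> F n\<close> by fastforce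
      moreover have "n \<le> m" using l0 \<open>l n < m\<close> by (meson le_trans less_imp_le)
      ultimately show "\<exists>k\<ge>n. \<exists>t\<in>Fa \<inter> Y k. E v t = b" unfolding Fa_def G_def by blast
    qed
    moreover have "embeddable X Fa" unfolding Fa_def G_def by (rule bleX[OF F(2) FX PF Fs])
    \<comment> \<open>The property is refuted at \<open>v\<close> and \<open>u N\<close>. Any
      candidate above \<open>u N\<close> lies in the thick part \<open>G\<close>, which provides a
      companion inseparable within \<open>G\<close>; vertices of \<open>P\<close> lie below both and
      see two vertices not adjacent to \<open>v\<close> in the same way.\<close>
    moreover have "\<not> thin Fa"
    proof
      assume th: "thin Fa"
      have z: "u N \<in> Fa" "u N \<noteq> v" using u(1)[of N] below_neq[of X v "u N" "u N"] unfolding Fa_def P_def T_def by auto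
      have v: "v \<in> Fa" unfolding Fa_def by simp
      from th[unfolded thin_def, THEN bspec, OF v, THEN bspec, OF z(1), THEN mp, OF z(2)]
      obtain y where y0: "y \<in> Fa" "y \<noteq> v \<and> \<not> E v y \<and> below Fa v (u N) y \<and>
        (\<forall>w\<in>Fa. w \<noteq> v \<longrightarrow> w \<noteq> y \<longrightarrow> \<not> E v w \<longrightarrow> (\<exists>t\<in>Fa. t \<noteq> v \<and> E v t \<and> E t w \<noteq> E t y))"
        by (rule bexE)
      then have y: "y \<in> Fa" "y \<noteq> v" "\<not> E v y" "below Fa v (u N) y" and
        sep: "w \<in> Fa \<Longrightarrow> w \<noteq> v \<Longrightarrow> w \<noteq> y \<Longrightarrow> \<not> E v w \<Longrightarrow> (\<exists>t\<in>Fa. t \<noteq> v \<and> E v t \<and> E t w \<noteq> E t y)" for w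
        by simp_all
      have "bl (u N) y" using y(4) FaX unfolding below_def by (auto split: if_splits)
      then have yG: "y \<in> G" using y(1,2) unfolding Fa_def P_def by blast
      from \<open>thick G\<close>[unfolded thick_def, THEN bspec, OF yG, THEN mp, OF y(3)]
      obtain w where w0: "w \<in> G" "w \<noteq> y \<and> \<not> E v w \<and> (\<forall>t\<in>G. E v t \<longrightarrow> E t w = E t y)" by (rule bexE)
      have wF: "w \<in> Fa" "w \<noteq> v" using w0(1) FX unfolding Fa_def G_def by auto
      obtain t where t: "t \<in> Fa" "t \<noteq> v" "E v t" "E t w \<noteq> E t y" using sep[OF wF] w0(2) by blast
      show False
      proof (cases "t \<in> G")
        case True then show False using w0(2) t by blast
      next
        case False
        then have "t \<in> P" using t unfolding Fa_def by blast
        then have "E t w = E v w" "E t y = E v y" using PG w0(1) yG unfolding stacked_def by blast+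
        then show False using t(4) w0(2) y(3) by blast
      qed
    qed
    ultimately show ?thesis using FaX by blast
  qed
  show "\<exists>F. F \<subseteq> X \<and> embeddable X F \<and> (\<forall>b. conn b F) \<and> thin F"
  proof -
    \<comment> \<open>The gap 4 leaves the levels \<open>m n + 1\<close>, \<open>m n + 2\<close> and
      \<open>m n + 3\<close> free for single vertices \<open>b n\<close>, \<open>c n\<close>,
      \<open>d n\<close>. Lying between \<open>b n\<close> and \<open>d n\<close>, which are
      adjacent to \<open>v\<close>, the non-adjacent \<open>c n\<close> becomes a node by
      itself.\<close>
    have "\<exists>m. \<forall>n. pointed_le (Y n) (Y (m n)) \<and> m n + 4 \<le> m (Suc n)"
    proof -
      have "\<exists>m. \<forall>n. pointed_le (Y n) (Y (m n)) \<and> m n + 4 \<le> m (Suc n)"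
      proof (rule dependent_nat_choice)
        show "\<exists>x. pointed_le (Y 0) (Y x)" using rec[of 0 0] by blast
        show "\<exists>y. pointed_le (Y (Suc n)) (Y y) \<and> x + 4 \<le> y" for x n
        proof -
          obtain y where "y > x + 4" "pointed_le (Y (Suc n)) (Y y)" using rec by blast
          then show ?thesis by (intro exI[of _ y]) simp
        qed
      qed
      then show ?thesis .
    qed
    then obtain m where m: "\<forall>n. pointed_le (Y n) (Y (m n)) \<and> m n + 4 \<le> m (Suc n)" by (rule exE)
    have mS: "m i + 4 \<le> m j" if "i < j" for i j
      using that
    proof (induction j)
      case (Suc j)
      have "m j + 4 \<le> m (Suc j)" using m by blast
      then show ?case using Suc by (cases "i = j") auto
    qed simp
    have least: "n \<le> m n" for n
    proof (induction n)
      case (Suc n)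
      have "m n + 4 \<le> m (Suc n)" using m by blast
      then show ?case using Suc by simp
    qed simp
    define r where "r = (\<lambda>e k. SOME x. x \<in> Y k \<and> E v x = e)"
    have r: "r e k \<in> Y k" "E v (r e k) = e" for e k
    proof -
      have "\<exists>x. x \<in> Y k \<and> E v x = e" using lab by blast
      from someI_ex[OF this] show "r e k \<in> Y k" "E v (r e k) = e" unfolding r_def by auto
    qed
    define b where "b = (\<lambda>n. r True (m n + 1))"
    define c where "c = (\<lambda>n. r False (m n + 2))"
    define d where "d = (\<lambda>n. r True (m n + 3))"
    have bcd: "b n \<in> Y (m n + 1)" "E v (b n)" "c n \<in> Y (m n + 2)" "\<not> E v (c n)" "d n \<in> Y (m n + 3)" "E v (d n)" for n
      using r unfolding b_def c_def d_def by (metis (full_types))+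
    define Fb where "Fb = insert v (P \<union> (\<Union>n. Y (m n))) \<union> (\<Union>n. {b n, c n, d n})"
    have FbX: "Fb \<subseteq> X"
    proof
      fix x assume "x \<in> Fb"
      then have "x = v \<or> x \<in> P \<or> (\<exists>k. x \<in> Y k)" using bcd(1,3,5) unfolding Fb_def by blast
      then show "x \<in> X" using vX PX YX by blast
    qed
    have inFb: "b n \<in> Fb" "c n \<in> Fb" "d n \<in> Fb" for n unfolding Fb_def by auto
    have "conn e Fb" for e
    proof (rule connF[OF FbX])
      fix n
      show "\<exists>k\<ge>n. \<exists>t\<in>Fb \<inter> Y k. E v t = e"
      proof (cases e)
        case True
        then show ?thesis using bcd(1,2)[of n] inFb(1)[of n] least[of n] by (intro exI[of _ "m n + 1"]) auto
      next
        case False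
        then show ?thesis using bcd(3,4)[of n] inFb(2)[of n] least[of n] by (intro exI[of _ "m n + 2"]) auto
      qed
    qed
    moreover have "embeddable X Fb"
    proof -
      have "embeddable X (insert v (P \<union> (\<Union>n. Y (m n))))"
      proof (rule bleX)
        show "pointed_le (Y n) (Y (m n))" for n using m by blast
        show "Y (m n) \<subseteq> X - {v}" for n by (rule YX)
        show "st P (Y (m n))" for n by (rule stP)
        show "st (Y (m i)) (Y (m j))" if "i < j" for i j by (rule stY) (use mS[OF that] in simp)
      qed
      moreover have "insert v (P \<union> (\<Union>n. Y (m n))) \<subseteq> Fb" unfolding Fb_def by blast
      ultimately show ?thesis using embeddable_trans[OF _ embeddable_sub] by blast
    qed
    moreover have "thin Fb"
      unfolding thin_def
    proof (intro ballI impI)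
      fix x z assume xz: "x \<in> Fb" "z \<in> Fb" "z \<noteq> x"
      obtain n1 where n1: "\<forall>k\<ge>n1. \<forall>t\<in>Y k. t \<noteq> x \<and> E x t = E v t" using late[of x] xz FbX by blast
      obtain n2 where n2: "\<forall>k\<ge>n2. \<forall>t\<in>Y k. t \<noteq> z \<and> E z t = E v t" using late[of z] xz FbX by blast
      define n where "n = max n1 n2"
      have x': "t \<noteq> x \<and> E x t = E v t" if "t \<in> Y k" "m n \<le> k" for t k
      proof -
        have "n1 \<le> k" using that(2) least[of n] unfolding n_def by simp
        then show ?thesis using n1 that(1) by blast
      qed
      have z': "t \<noteq> z \<and> E z t = E v t" if "t \<in> Y k" "m n \<le> k" for t k
      proof -
        have "n2 \<le> k" using that(2) least[of n] unfolding n_def by simp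
        then show ?thesis using n2 that(1) by blast
      qed
      have xb: "b n \<noteq> x" "E x (b n)" using x'[OF bcd(1)[of n]] bcd(2)[of n] by simp_all
      have xc: "c n \<noteq> x" "\<not> E x (c n)" using x'[OF bcd(3)[of n]] bcd(4)[of n] by simp_all
      have xd: "d n \<noteq> x" "E x (d n)" using x'[OF bcd(5)[of n]] bcd(6)[of n] by simp_all
      have zb: "E z (b n)" using z'[OF bcd(1)[of n]] bcd(2)[of n] by simp
      have zc: "\<not> E z (c n)" using z'[OF bcd(3)[of n]] bcd(4)[of n] by simp
      have upper: "E s t = E v t" if "s \<in> Y i" "t \<in> Y j" "i < j" for s t i j
        using stY[OF that(3)] that unfolding stacked_def by blast
      have bc: "\<not> E (b n) (c n)" using upper[OF bcd(1)[of n] bcd(3)[of n]] bcd(4)[of n] by simp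
      have cd: "E (d n) (c n)" using upper[OF bcd(3)[of n] bcd(5)[of n]] bcd(6)[of n] symE[of "c n" "d n"] by simp
      show "\<exists>y\<in>Fb. y \<noteq> x \<and> \<not> E x y \<and> below Fb x z y \<and>
         (\<forall>w\<in>Fb. w \<noteq> x \<longrightarrow> w \<noteq> y \<longrightarrow> \<not> E x w \<longrightarrow> (\<exists>t\<in>Fb. t \<noteq> x \<and> E x t \<and> E t w \<noteq> E t y))"
      proof (rule bexI[OF _ inFb(2)[of n]], intro conjI ballI impI)
        show "c n \<noteq> x" "\<not> E x (c n)" by (fact xc)+
        show "below Fb x z (c n)"
        proof (cases "E x z")
          case True then show ?thesis using xc zc unfolding below_def by simp
        next
          case False
          have "b n \<in> Fb - {x}" using inFb(1)[of n] xb by blast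
          then show ?thesis using False xb xc zb bc unfolding below_def by auto
        qed
        fix w assume w: "w \<in> Fb" "w \<noteq> x" "w \<noteq> c n" "\<not> E x w"
        \<comment> \<open>Lower vertices not adjacent to \<open>x\<close> are told apart from
          \<open>c n\<close> by \<open>b n\<close>, higher ones by \<open>d n\<close>; on the levels
          strictly between \<open>m n\<close> and \<open>m n + 4\<close> the set \<open>Fb\<close>
          contains nothing but \<open>b n\<close>, \<open>c n\<close>, \<open>d n\<close>.\<close>
        have viab: "\<exists>t\<in>Fb. t \<noteq> x \<and> E x t \<and> E t w \<noteq> E t (c n)" if "E w (b n)"
          using that xb bc inFb(1)[of n] symE[of w "b n"] by (intro bexI[of _ "b n"]) auto
        have viad: "\<exists>t\<in>Fb. t \<noteq> x \<and> E x t \<and> E t w \<noteq> E t (c n)" if "w \<in> Y k" "m n + 4 \<le> k" for k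
        proof -
          have "E (d n) w = E v w" by (rule upper[OF bcd(5)[of n] that(1)]) (use that(2) in simp)
          moreover have "E x w = E v w" using x'[OF that(1)] that(2) by simp
          ultimately have "\<not> E (d n) w" using w(4) by simp
          then show ?thesis using xd cd inFb(3)[of n] by (intro bexI[of _ "d n"]) auto
        qed
        have lowb: "E w (b n)" if "w \<in> Y k" "k \<le> m n" for k
          using upper[OF that(1) bcd(1)[of n]] bcd(2)[of n] that(2) by simp
        have mid: "\<exists>t\<in>Fb. t \<noteq> x \<and> E x t \<and> E t w \<noteq> E t (c n)" if j: "w \<in> Y (m j + i)" "i \<le> 3" "j \<noteq> n \<or> i = 0" for j i
        proof -
          consider "j < n" | "n < j" | "j = n" "i = 0" using j(3) by linarith
          then show ?thesis
          proof cases
            case 1 then show ?thesis using viab[OF lowb[OF j(1)]] mS[OF 1] j(2) by simp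
          next
            case 2 then show ?thesis using viad[OF j(1)] mS[OF 2] by simp
          next
            case 3 then show ?thesis using viab[OF lowb[OF j(1)]] by simp
          qed
        qed
        from w(1) consider "w = v" | "w \<in> P" | j where "w \<in> Y (m j)" | j where "w = b j" | j where "w = c j" | j where "w = d j"
          unfolding Fb_def by blast
        then show "\<exists>t\<in>Fb. t \<noteq> x \<and> E x t \<and> E t w \<noteq> E t (c n)"
        proof cases
          case 1 then show ?thesis using viab bcd(2) by blast
        next
          case 2
          then have "E w (b n) = E v (b n)" using stP[of "m n + 1"] bcd(1)[of n] unfolding stacked_def by blast
          then show ?thesis using viab bcd(2) by blast
        next
          case 3 then show ?thesis using mid[of j 0] by simp
        next
          case 4
          have "j \<noteq> n" using 4 xb w by blast
          then show ?thesis using mid[of j 1] bcd(1)[of j] 4 by simp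
        next
          case 5
          have "j \<noteq> n" using 5 w by blast
          then show ?thesis using mid[of j 2] bcd(3)[of j] 5 by simp
        next
          case 6
          have "j \<noteq> n" using 6 xd w by blast
          then show ?thesis using mid[of j 3] bcd(5)[of j] 6 by simp
        qed
      qed
    qed
    ultimately show ?thesis using FbX by blast
  qed
qed

end

context p4_free begin

theorem rigid_fin:
  assumes "X \<subseteq> V" "rigid b X" shows "fin X"
  using assms
proof (induction X arbitrary: b rule: wf_induct_rule[OF embeddable_wf])
  case (1 X)
  note XV = 1(2) and R = 1(3)
  show ?case
  proof (cases "conn (\<not> b) X")
    case False
    show ?thesis
    proof (rule fin_by_comps[where c="\<not> b"])
      fix x assume x: "x \<in> X"
      have "comp (\<not> b) X x \<subseteq> V" using comp_sub XV by blast
      moreover have "embeddable (comp (\<not> b) X x) X" by (rule embeddable_sub[OF comp_sub])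
      ultimately show "fin (comp (\<not> b) X x)"
        using 1(1)[of "comp (\<not> b) X x" "\<not> b"] rigid_not_in_comp[OF R False x] rigid_comp[OF R False x] XV by blast
    qed (rule rigid_finite_comps[OF XV R])
  next
    case True
    then have c: "conn e X" for e using R unfolding rigid_def by (cases "e = b") auto
    show ?thesis
    proof (cases "\<exists>v a. v \<in> X \<and> a \<in> X \<and> a \<noteq> v")
      case False
      then have "twin X x y" if "x \<in> X" "y \<in> X" for x y unfolding twin_def using that by blast
      moreover have "finite ((\<lambda>_. 0 :: nat) ` X)" by (rule finite_subset[of _ "{0}"]) auto
      ultimately show ?thesis unfolding fin_def by blast
    next
      case True
      then obtain v a where va: "v \<in> X" "a \<in> X" "a \<noteq> v" by blast
      interpret base V E X v by unfold_locales (use XV va in auto)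
      obtain F where F: "F \<subseteq> X" "embeddable X F" "\<forall>b. conn b F" "\<not> thin F" using thick_and_thin(1)[OF c va(2,3)] by blast
      obtain G where G: "G \<subseteq> X" "embeddable X G" "\<forall>b. conn b G" "thin G" using thick_and_thin(2)[OF c va(2,3)] by blast
      have "iso X F" "iso X G" using R F G unfolding rigid_def by blast+
      then have "iso G F" using iso_sym iso_trans by blast
      then show ?thesis using thin_iso G(4) F(4) by blast
    qed
  qed
qed

section \<open>Classes of twins\<close>

lemma twin_sym: "twin X x y \<Longrightarrow> twin X y x"
  unfolding twin_def by simp

lemma twin_trans:
  assumes "x \<in> X" "y \<in> X" "z \<in> X" "twin X x y" "twin X y z" shows "twin X x z"
  unfolding twin_def
proof (intro ballI impI)
  fix w assume w: "w \<in> X" "w \<noteq> x" "w \<noteq> z"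
  show "E x w = E z w"
  proof (cases "w = y")
    case False then show ?thesis using assms w unfolding twin_def by metis
  next
    case True
    show ?thesis
    proof (cases "x = z")
      case F: False
      have "E y x = E z x" "E x z = E y z" using assms w F True unfolding twin_def by metis+
      then show ?thesis using True symE[of x y] symE[of x z] symE[of y z] by auto
    qed simp
  qed
qed

text \<open>Replacing the two endpoints of a pair one after the other by twins keeps adjacency; so a
  class of mutual twins is a clique or an independent set.\<close>

lemma twin_uniform:
  assumes C: "\<And>x y. x \<in> C \<Longrightarrow> y \<in> C \<Longrightarrow> twin X x y" "C \<subseteq> X"
    and ab: "a \<in> C" "b \<in> C" "a \<noteq> b" and xy: "x \<in> C" "y \<in> C" "x \<noteq> y"
  shows "E x y = E a b"
proof (cases "x = b")
  case False
  have "b \<in> X" "x \<in> X" using ab xy C(2) by auto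
  then have "E a b = E x b" "E b x = E y x"
    using C(1)[OF ab(1) xy(1)] C(1)[OF ab(2) xy(2)] ab(3) xy(3) False unfolding twin_def by auto
  then show ?thesis using symE[of x b] symE[of x y] by simp
next
  case True
  have "b \<in> X" using ab C(2) by auto
  then have "E a b = E y b" using C(1)[OF ab(1) xy(2)] ab(3) xy(3) True unfolding twin_def by auto
  then show ?thesis using True symE[of y b] by simp
qed

text \<open>The permutation \<open>p\<close> induced on the classes maps infinite ones to infinite
  ones, so these still meet \<open>S\<close> in infinite sets, while the union of the finite ones is
  mapped onto itself and lies in \<open>S\<close>. By countability each class \<open>q\<close> is
  then equinumerous with \<open>q \<inter> S\<close>, and any bijections between them preserve
  adjacency, because they replace vertices by twins.\<close>

lemma fin_iso:
  assumes fin: "fin V" and S: "S \<subseteq> V" and f: "emb V S f" shows "iso V S"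
proof -
  define cl where "cl = (\<lambda>x. {y\<in>V. twin V x y})"
  obtain k :: "'a \<Rightarrow> nat" where k: "finite (k ` V)" "\<And>x y. x \<in> V \<Longrightarrow> y \<in> V \<Longrightarrow> k x = k y \<Longrightarrow> twin V x y"
    using fin unfolding fin_def by blast
  have self: "x \<in> cl x" if "x \<in> V" for x using that unfolding cl_def twin_def by blast
  have cleq: "cl x = cl y" if "x \<in> V" "y \<in> V" "twin V x y" for x y
    using that twin_trans twin_sym unfolding cl_def by blast
  have cltw: "twin V x y" if "x \<in> V" "y \<in> V" "cl x = cl y" for x y
    using self[OF that(2)] that(3) unfolding cl_def by blast
  define Q where "Q = cl ` V"
  have "finite Q"
  proof -
    have "cl x = cl (inv_into V k (k x))" if x: "x \<in> V" for x
    proof -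
      have i: "inv_into V k (k x) \<in> V" "k (inv_into V k (k x)) = k x"
        using x by (auto intro: inv_into_into f_inv_into_f)
      show ?thesis by (rule cleq[OF x i(1) k(2)[OF x i(1)]]) (simp add: i(2))
    qed
    then have "Q \<subseteq> (\<lambda>n. cl (inv_into V k n)) ` (k ` V)" unfolding Q_def by blast
    then show ?thesis using k(1) finite_subset by blast
  qed
  have fV: "f x \<in> V" "f x \<in> S" if "x \<in> V" for x using embD(3)[OF f that] S by auto
  \<comment> \<open>The image of a vertex separating \<open>x\<close> from \<open>y\<close>
    separates their images, even though twins are taken in all of \<open>V\<close> and not just in
    the image of \<open>f\<close>.\<close>
  have ntw: "\<not> twin V (f x) (f y)" if xy: "x \<in> V" "y \<in> V" "\<not> twin V x y" for x y
  proof -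
    obtain z where z: "z \<in> V" "z \<noteq> x" "z \<noteq> y" "E x z \<noteq> E y z" using xy(3) unfolding twin_def by blast
    have "E (f x) (f z) \<noteq> E (f y) (f z)" using embD(4)[OF f] xy z by metis
    moreover have "f z \<noteq> f x" "f z \<noteq> f y" using embD(5)[OF f z(1)] xy z by blast+
    ultimately show ?thesis using fV(1)[OF z(1)] unfolding twin_def by blast
  qed
  define rp where "rp = (\<lambda>q. SOME x. x \<in> V \<and> cl x = q)"
  have rp: "rp q \<in> V" "cl (rp q) = q" if "q \<in> Q" for q
  proof -
    have "\<exists>x. x \<in> V \<and> cl x = q" using that unfolding Q_def by blast
    from someI_ex[OF this] show "rp q \<in> V" "cl (rp q) = q" unfolding rp_def by auto
  qed
  define p where "p = (\<lambda>q. cl (f (rp q)))"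
  have pQ: "p q \<in> Q" if "q \<in> Q" for q using fV(1)[OF rp(1)[OF that]] unfolding p_def Q_def by blast
  have pinj: "inj_on p Q"
  proof (rule inj_onI, rule ccontr)
    fix q q' assume q: "q \<in> Q" "q' \<in> Q" "p q = p q'" "q \<noteq> q'"
    have "\<not> twin V (rp q) (rp q')" using cleq[OF rp(1)[OF q(1)] rp(1)[OF q(2)]] rp(2)[OF q(1)] rp(2)[OF q(2)] q(4) by metis
    then have "\<not> twin V (f (rp q)) (f (rp q'))" using ntw rp(1) q by blast
    then show False using cltw[OF fV(1)[OF rp(1)[OF q(1)]] fV(1)[OF rp(1)[OF q(2)]]] q(3) unfolding p_def by blast
  qed
  have psurj: "p ` Q = Q" by (rule endo_inj_surj[OF \<open>finite Q\<close> _ pinj]) (use pQ in blast)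
  have fp: "f x \<in> p (cl x)" if x: "x \<in> V" for x
  proof -
    have cx: "cl x \<in> Q" "cl (f x) \<in> Q" using x fV unfolding Q_def by auto
    then obtain q where q: "q \<in> Q" "cl (f x) = p q" using psurj by blast
    have "twin V x (rp q)"
    proof (rule ccontr)
      assume "\<not> twin V x (rp q)"
      then have "\<not> twin V (f x) (f (rp q))" using ntw x rp(1)[OF q(1)] by blast
      then show False using cltw[OF fV(1)[OF x] fV(1)[OF rp(1)[OF q(1)]]] q(2) unfolding p_def by blast
    qed
    then have "cl x = q" using cleq[OF x rp(1)[OF q(1)]] rp(2)[OF q(1)] by simp
    then show ?thesis using q(2) self[OF fV(1)[OF x]] by simp
  qed
  have fim: "f ` q \<subseteq> p q \<inter> S" if q: "q \<in> Q" for q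
  proof
    fix y assume "y \<in> f ` q"
    then obtain x where x: "x \<in> q" "y = f x" by blast
    have xV: "x \<in> V" using x(1) q unfolding Q_def cl_def by blast
    obtain z where z: "z \<in> V" "q = cl z" using q unfolding Q_def by blast
    have "twin V z x" using x(1) z(2) unfolding cl_def by simp
    then have "cl x = q" using cleq[OF z(1) xV] z(2) by simp
    then show "y \<in> p q \<inter> S" using fp[OF xV] fV(2)[OF xV] x(2) by blast
  qed
  have qV: "q \<subseteq> V" if "q \<in> Q" for q using that unfolding Q_def cl_def by blast
  define I where "I = {q\<in>Q. infinite q}"
  have inj: "inj_on f V" by (rule embD(1)[OF f])
  have infim: "infinite (f ` q)" if q: "q \<in> I" for q
  proof -
    have q: "q \<in> Q" "infinite q" using q unfolding I_def by auto
    show ?thesis using q(2) finite_imageD[OF _ inj_on_subset[OF inj qV[OF q(1)]]] by auto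
  qed
  have pI: "p q \<in> I" if q: "q \<in> I" for q
  proof -
    have Q: "q \<in> Q" using q unfolding I_def by simp
    have "f ` q \<subseteq> p q" using fim[OF Q] by blast
    then have "infinite (p q)" using infim[OF q] infinite_super by metis
    then show ?thesis using pQ[OF Q] unfolding I_def by simp
  qed
  have "finite I" using \<open>finite Q\<close> unfolding I_def by simp
  moreover have "inj_on p I" by (rule inj_on_subset[OF pinj]) (auto simp: I_def)
  moreover have "p ` I \<subseteq> I" using pI by (rule image_subsetI)
  ultimately have pIs: "p ` I = I" using endo_inj_surj[of I p] by simp
  have infS: "infinite (q \<inter> S)" if qI: "q \<in> I" for q
  proof -
    obtain q' where q': "q' \<in> I" "q = p q'" using qI pIs by blast
    then have "f ` q' \<subseteq> q \<inter> S" using fim[of q'] unfolding I_def by simp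
    then show ?thesis using infim[OF q'(1)] infinite_super by metis
  qed
  define W where "W = \<Union> (Q - I)"
  have "finite W" unfolding W_def using \<open>finite Q\<close> by (intro finite_Union) (auto simp: I_def)
  moreover have "f ` W \<subseteq> W"
  proof
    fix y assume "y \<in> f ` W"
    then obtain x q where x: "x \<in> q" "q \<in> Q" "q \<notin> I" "y = f x" unfolding W_def by blast
    have "p q \<notin> I"
    proof
      assume "p q \<in> I"
      then obtain q' where q': "q' \<in> I" "p q = p q'" using pIs by blast
      then have "q = q'" using inj_onD[OF pinj] x(2) unfolding I_def by blast
      then show False using q' x(3) by blast
    qed
    then show "y \<in> W" using fim[OF x(2)] x pQ[OF x(2)] unfolding W_def by blast
  qed
  moreover have WV: "W \<subseteq> V" using qV unfolding W_def by blast
  ultimately have "f ` W = W" using endo_inj_surj[of W f] inj_on_subset[OF inj WV] by simp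
  moreover have "f ` W \<subseteq> S" using embD(2)[OF f] WV by (metis image_mono order_trans)
  ultimately have WS: "W \<subseteq> S" by simp
  have "\<exists>h. bij_betw h q (q \<inter> S)" if q: "q \<in> Q" for q
  proof (cases "q \<in> I")
    case True
    have "countable q" "countable (q \<inter> S)" by (rule countable_subset[OF _ cntV], use qV[OF q] in blast)+
    then have b1: "bij_betw (to_nat_on q) q UNIV" and b2: "bij_betw (to_nat_on (q \<inter> S)) (q \<inter> S) UNIV"
      using True infS[OF True] to_nat_on_infinite unfolding I_def by auto
    then show ?thesis using bij_betw_trans[OF b1 bij_betw_inv_into[OF b2]] by blast
  next
    case False
    then have "q \<inter> S = q" using q WS unfolding W_def by blast
    then show ?thesis using bij_betw_id by metis
  qed
  then have "\<forall>q. \<exists>h. q \<in> Q \<longrightarrow> bij_betw h q (q \<inter> S)" by blast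
  then obtain h where h: "\<And>q. q \<in> Q \<Longrightarrow> bij_betw (h q) q (q \<inter> S)" by metis
  define g where "g = (\<lambda>x. h (cl x) x)"
  have clQ: "cl x \<in> Q" if "x \<in> V" for x using that unfolding Q_def by blast
  have g: "g x \<in> cl x" "g x \<in> S" "g x \<in> V" "twin V x (g x)" "cl (g x) = cl x" if x: "x \<in> V" for x
  proof -
    have "g x \<in> cl x \<inter> S" using bij_betw_apply[OF h[OF clQ[OF x]] self[OF x]] unfolding g_def .
    then show 1: "g x \<in> cl x" "g x \<in> S" "g x \<in> V" "twin V x (g x)" using S unfolding cl_def by auto
    show "cl (g x) = cl x" using cleq[OF x 1(3,4)] by simp
  qed
  have ginj: "g x \<noteq> g y" if "x \<in> V" "y \<in> V" "x \<noteq> y" "cl x = cl y" for x y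
  proof
    assume "g x = g y"
    then have "h (cl x) x = h (cl x) y" using that(4) unfolding g_def by simp
    then show False using bij_betw_imp_inj_on[OF h[OF clQ[OF that(1)]]] self that unfolding inj_on_def by metis
  qed
  have "emb V S g"
  proof (rule embI)
    fix x y assume xy: "x \<in> V" "y \<in> V" "x \<noteq> y"
    show "g x \<noteq> g y \<and> E (g x) (g y) = E x y"
    proof (cases "cl x = cl y")
      case True
      have "E (g x) (g y) = E x y"
      proof (rule twin_uniform[of "cl x" V])
        show "twin V a b" if "a \<in> cl x" "b \<in> cl x" for a b
          using that twin_trans[of a V x b] twin_sym xy(1) unfolding cl_def by blast
        show "cl x \<subseteq> V" unfolding cl_def by blast
        show "x \<in> cl x" "y \<in> cl x" "x \<noteq> y" using self xy True by auto
        show "g x \<in> cl x" "g y \<in> cl x" using g(1)[OF xy(1)] g(1)[OF xy(2)] True by auto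
        show "g x \<noteq> g y" by (rule ginj[OF xy True])
      qed
      then show ?thesis using ginj[OF xy True] by simp
    next
      case False
      have n: "g x \<noteq> g y" "y \<noteq> g x" "g x \<noteq> y" using g(5)[OF xy(1)] g(5)[OF xy(2)] False by auto
      have "E x y = E (g x) y" using g(4)[OF xy(1)] xy n unfolding twin_def by auto
      moreover have "E y (g x) = E (g y) (g x)" using g(4)[OF xy(2)] g(3)[OF xy(1)] n unfolding twin_def by auto
      ultimately show ?thesis using n symE[of y "g x"] symE[of "g y" "g x"] by simp
    qed
  qed (rule g(2))
  moreover have "g ` V = S"
  proof
    show "S \<subseteq> g ` V"
    proof
      fix s assume s: "s \<in> S"
      then have sV: "s \<in> V" using S by blast
      have "s \<in> h (cl s) ` cl s" using bij_betw_imp_surj_on[OF h[OF clQ[OF sV]]] self[OF sV] s by blast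
      then obtain x where x: "x \<in> cl s" "s = h (cl s) x" by blast
      have "x \<in> V" "cl x = cl s" using x(1) cleq[OF sV] unfolding cl_def by auto
      then show "s \<in> g ` V" using x(2) unfolding g_def by (intro image_eqI[of _ _ x]) auto
    qed
  qed (use g(2) in blast)
  ultimately show ?thesis unfolding iso_def by blast
qed

end

section \<open>Passage to graphs and to the counting of isomorphism classes\<close>

lemma p4_free_of_cograph:
  assumes "cograph G" "countable (verts G)" shows "p4_free (verts G) (adj G)"
proof
  have g: "adj G x y \<Longrightarrow> adj G y x" "\<not> adj G x x" for x y using assms(1) unfolding cograph_def is_graph_def by blast+
  show "countable (verts G)" by fact
  show "adj G x y \<Longrightarrow> adj G y x" "\<not> adj G x x" for x y using g by blast+
  show False if p: "a \<in> verts G" "b \<in> verts G" "c \<in> verts G" "d \<in> verts G" "adj G a b" "adj G b c" "adj G c d"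
    "\<not> adj G a c" "\<not> adj G a d" "\<not> adj G b d" for a b c d
  proof -
    \<comment> \<open>Distinctness follows from the adjacency pattern: two equal vertices would be
      adjacent to themselves, or both adjacent and non-adjacent to a third.\<close>
    have "distinct [a, b, c, d]" using p g by auto
    then show False using assms(1) p unfolding cograph_def by blast
  qed
qed

lemma iso_refl: "isomorphic G G"
  unfolding isomorphic_def by (rule exI[of _ id]) auto

lemma isomorphic_sym: "isomorphic G H \<Longrightarrow> isomorphic H G"
proof -
  assume "isomorphic G H"
  then obtain f where f: "bij_betw f (verts G) (verts H)" "\<forall>x\<in>verts G. \<forall>y\<in>verts G. adj G x y \<longleftrightarrow> adj H (f x) (f y)"
    unfolding isomorphic_def by blast
  have i: "inv_into (verts G) f x \<in> verts G" "f (inv_into (verts G) f x) = x" if "x \<in> verts H" for x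
    using that bij_betw_imp_surj_on[OF f(1)] by (auto intro: inv_into_into f_inv_into_f)
  show ?thesis unfolding isomorphic_def
    using bij_betw_inv_into[OF f(1)] i f(2) by (intro exI[of _ "inv_into (verts G) f"]) auto
qed

lemma isomorphic_trans: "isomorphic G H \<Longrightarrow> isomorphic H K \<Longrightarrow> isomorphic G K"
proof -
  assume "isomorphic G H" "isomorphic H K"
  then obtain f g where f: "bij_betw f (verts G) (verts H)" "\<forall>x\<in>verts G. \<forall>y\<in>verts G. adj G x y \<longleftrightarrow> adj H (f x) (f y)"
    and g: "bij_betw g (verts H) (verts K)" "\<forall>x\<in>verts H. \<forall>y\<in>verts H. adj H x y \<longleftrightarrow> adj K (g x) (g y)"
    unfolding isomorphic_def by blast
  show ?thesis unfolding isomorphic_def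
    using bij_betw_trans[OF f(1) g(1)] f(2) g(2) bij_betw_apply[OF f(1)] by (intro exI[of _ "g \<circ> f"]) auto
qed

text \<open>Both an empty and an infinite quotient have \<open>card\<close> 0, so the value 1 really
  means that there is exactly one class.\<close>

lemma card_quotient_iso:
  "card (S // iso_rel) = 1 \<longleftrightarrow> S \<noteq> {} \<and> (\<forall>H\<in>S. \<forall>H'\<in>S. isomorphic H H')"
proof -
  have cl: "iso_rel `` {H} = iso_rel `` {H'} \<longleftrightarrow> isomorphic H H'" for H H' :: "'b graph"
    unfolding iso_rel_def using iso_refl isomorphic_sym isomorphic_trans by blast
  have q: "S // iso_rel = (\<lambda>H. iso_rel `` {H}) ` S" unfolding quotient_def by blast
  show ?thesis
  proof
    assume "card (S // iso_rel) = 1"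
    then obtain X where X: "(\<lambda>H. iso_rel `` {H}) ` S = {X}" unfolding q by (auto simp: card_1_singleton_iff)
    have eqX: "iso_rel `` {H} = X" if "H \<in> S" for H using X that by blast
    have "isomorphic H H'" if "H \<in> S" "H' \<in> S" for H H'
      using cl[of H H'] eqX[OF that(1)] eqX[OF that(2)] by simp
    moreover have "S \<noteq> {}" using X by auto
    ultimately show "S \<noteq> {} \<and> (\<forall>H\<in>S. \<forall>H'\<in>S. isomorphic H H')" by simp
  next
    assume a: "S \<noteq> {} \<and> (\<forall>H\<in>S. \<forall>H'\<in>S. isomorphic H H')"
    then obtain H0 where H0: "H0 \<in> S" by blast
    have "iso_rel `` {H} = iso_rel `` {H0}" if "H \<in> S" for H using cl[of H H0] a that H0 by simp
    then have "(\<lambda>H. iso_rel `` {H}) ` S = (\<lambda>H. iso_rel `` {H0}) ` S"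
      by (rule image_cong[OF refl])
    also have "\<dots> = {iso_rel `` {H0}}" using H0 by blast
    finally have "(\<lambda>H. iso_rel `` {H}) ` S = {iso_rel `` {H0}}" .
    then show "card (S // iso_rel) = 1" unfolding q by simp
  qed
qed

definition finite_twins :: "'a graph \<Rightarrow> bool" where
  "finite_twins G \<longleftrightarrow> (\<exists>f :: 'a \<Rightarrow> nat. finite (f ` verts G) \<and> (\<forall>x\<in>verts G. \<forall>y\<in>verts G. f x = f y \<longrightarrow>
     (\<forall>z\<in>verts G. z \<noteq> x \<longrightarrow> z \<noteq> y \<longrightarrow> adj G x z = adj G y z)))"

section \<open>Counting siblings\<close>

text \<open>Siblings are counted among graphs on sets of natural numbers; induced subgraphs of
  \<open>G\<close> are moved there along the enumeration of its vertices.\<close>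

definition copy :: "'a graph \<Rightarrow> 'a set \<Rightarrow> nat graph" where
  "copy G S = (to_nat_on (verts G) ` S,
     \<lambda>a b. \<exists>x\<in>S. \<exists>y\<in>S. a = to_nat_on (verts G) x \<and> b = to_nat_on (verts G) y \<and> adj G x y)"

locale countable_cograph =
  fixes G :: "'a graph"
  assumes cg: "cograph G" and cnt: "countable (verts G)"
begin

sublocale p4_free "verts G" "adj G" by (rule p4_free_of_cograph[OF cg cnt])

lemma fin_twins: "fin (verts G) \<longleftrightarrow> finite_twins G"
  unfolding fin_def finite_twins_def twin_def ..

lemma inj: "inj_on (to_nat_on (verts G)) (verts G)" by (rule inj_on_to_nat_on[OF cnt])

lemma conn_bij:
  assumes H: "is_graph H" and g: "bij_betw g (verts H) S" "\<And>x y. x \<in> verts H \<Longrightarrow> y \<in> verts H \<Longrightarrow> adj H x y \<longleftrightarrow> adj G (g x) (g y)"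
  shows "connected_graph H \<longleftrightarrow> conn True S"
proof -
  have gS: "g x \<in> S" if "x \<in> verts H" for x using bij_betw_apply[OF g(1) that] .
  have fw: "(step True S)\<^sup>*\<^sup>* (g x) (g y)" if "(adj H)\<^sup>*\<^sup>* x y" for x y
    using that
  proof (induction rule: rtranclp_induct)
    case (step y z)
    have yz: "y \<in> verts H" "z \<in> verts H" using H step.hyps(2) unfolding is_graph_def by blast+
    then have a: "adj G (g y) (g z)" using g(2) step.hyps(2) by blast
    then have "g y \<noteq> g z" using irr by metis
    then have "p4_free.step (adj G) True S (g y) (g z)" using a gS yz unfolding step_def by simp
    then show ?case using step.IH by (meson rtranclp.rtrancl_into_rtrancl)
  qed simp
  have bw: "y \<in> S \<and> (adj H)\<^sup>*\<^sup>* x (inv_into (verts H) g y)" if "(step True S)\<^sup>*\<^sup>* (g x) y" "x \<in> verts H" for x y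
    using that
  proof (induction rule: rtranclp_induct)
    case base
    then show ?case using gS bij_betw_imp_inj_on[OF g(1)] by simp
  next
    case (step y z)
    have yz: "y \<in> S" "z \<in> S" "adj G y z" using step.hyps(2) unfolding step_def by auto
    have i: "inv_into (verts H) g w \<in> verts H" "g (inv_into (verts H) g w) = w" if "w \<in> S" for w
      using that bij_betw_imp_surj_on[OF g(1)] by (auto intro: inv_into_into f_inv_into_f)
    have "adj H (inv_into (verts H) g y) (inv_into (verts H) g z)"
      using g(2)[OF i(1)[OF yz(1)] i(1)[OF yz(2)]] i(2) yz by simp
    then show ?case using step.IH[OF step.prems] yz(2) by (meson rtranclp.rtrancl_into_rtrancl)
  qed
  show ?thesis
  proof
    assume c: "connected_graph H"
    show "conn True S" unfolding conn_def
    proof (intro ballI)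
      fix x y assume "x \<in> S" "y \<in> S"
      then obtain x' y' where "x' \<in> verts H" "y' \<in> verts H" "x = g x'" "y = g y'"
        using bij_betw_imp_surj_on[OF g(1)] by blast
      then show "(step True S)\<^sup>*\<^sup>* x y" using c fw unfolding connected_graph_def by blast
    qed
  next
    assume c: "conn True S"
    show "connected_graph H" unfolding connected_graph_def
    proof (intro ballI)
      fix x y assume xy: "x \<in> verts H" "y \<in> verts H"
      then have "(step True S)\<^sup>*\<^sup>* (g x) (g y)" using c gS unfolding conn_def by blast
      then show "(adj H)\<^sup>*\<^sup>* x y" using bw[of x "g y"] xy bij_betw_imp_inj_on[OF g(1)] by simp
    qed
  qed
qed

lemma connected_conn: "connected_graph G \<longleftrightarrow> conn True (verts G)"
proof (rule conn_bij[where g=id])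
  show "is_graph G" using cg unfolding cograph_def by blast
qed auto

lemma copy:
  assumes S: "S \<subseteq> verts G"
  shows "is_graph (copy G S)" "bij_betw (to_nat_on (verts G)) S (verts (copy G S))"
    "x \<in> S \<Longrightarrow> y \<in> S \<Longrightarrow> adj (copy G S) (to_nat_on (verts G) x) (to_nat_on (verts G) y) \<longleftrightarrow> adj G x y"
proof -
  let ?e = "to_nat_on (verts G)"
  have injS: "inj_on ?e S" by (rule inj_on_subset[OF inj S])
  have v: "verts (copy G S) = ?e ` S" unfolding copy_def verts_def by simp
  have a: "adj (copy G S) p q \<longleftrightarrow> (\<exists>x\<in>S. \<exists>y\<in>S. p = ?e x \<and> q = ?e y \<and> adj G x y)" for p q
    unfolding copy_def adj_def by simp
  show b: "bij_betw ?e S (verts (copy G S))" unfolding v using injS by (rule inj_on_imp_bij_betw)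
  show aa: "adj (copy G S) (?e x) (?e y) \<longleftrightarrow> adj G x y" if "x \<in> S" "y \<in> S" for x y
    unfolding a using that inj_onD[OF injS] by blast
  show "is_graph (copy G S)"
    unfolding is_graph_def
  proof (intro conjI allI impI)
    show "adj (copy G S) q p" if "adj (copy G S) p q" for p q using that sym unfolding a by blast
    show "\<not> adj (copy G S) p p" for p
    proof
      assume "adj (copy G S) p p"
      then obtain x y where "x \<in> S" "y \<in> S" "p = ?e x" "p = ?e y" "adj G x y" unfolding a by blast
      then show False using inj_onD[OF injS, of x y] irr by auto
    qed
    show "p \<in> verts (copy G S)" "q \<in> verts (copy G S)" if "adj (copy G S) p q" for p q
      using that unfolding a v by blast+
  qed
qed

lemma copy_bij:
  assumes S: "S \<subseteq> verts G"
  obtains g where "bij_betw g (verts (copy G S)) S"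
    "\<And>x y. x \<in> verts (copy G S) \<Longrightarrow> y \<in> verts (copy G S) \<Longrightarrow> adj (copy G S) x y \<longleftrightarrow> adj G (g x) (g y)"
proof -
  let ?e = "to_nat_on (verts G)" let ?g = "inv_into S ?e"
  note b = copy(2)[OF S]
  have i: "?g x \<in> S" "?e (?g x) = x" if "x \<in> verts (copy G S)" for x
    using that bij_betw_imp_surj_on[OF b] by (auto intro: inv_into_into f_inv_into_f)
  show thesis
  proof (rule that[of ?g])
    show "bij_betw ?g (verts (copy G S)) S" by (rule bij_betw_inv_into[OF b])
    fix x y assume xy: "x \<in> verts (copy G S)" "y \<in> verts (copy G S)"
    show "adj (copy G S) x y \<longleftrightarrow> adj G (?g x) (?g y)"
      using copy(3)[OF S i(1)[OF xy(1)] i(1)[OF xy(2)]] i(2)[OF xy(1)] i(2)[OF xy(2)] by simp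
  qed
qed

lemma copy_equimorphic:
  assumes S: "S \<subseteq> verts G" and b: "embeddable (verts G) S" shows "equimorphic (copy G S) G"
proof -
  let ?e = "to_nat_on (verts G)"
  obtain g where g: "bij_betw g (verts (copy G S)) S"
    "\<And>x y. x \<in> verts (copy G S) \<Longrightarrow> y \<in> verts (copy G S) \<Longrightarrow> adj (copy G S) x y \<longleftrightarrow> adj G (g x) (g y)"
    by (rule copy_bij[OF S], rule that, assumption, simp)
  have "embeds (copy G S) G" unfolding embeds_def
    using bij_betw_imp_inj_on[OF g(1)] bij_betw_imp_surj_on[OF g(1)] g(2) S by (intro exI[of _ g]) auto
  moreover obtain f where f: "emb (verts G) S f" using b unfolding embeddable_def by blast
  have "embeds G (copy G S)" unfolding embeds_def
  proof (intro exI[of _ "?e \<circ> f"] conjI ballI)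
    show "inj_on (?e \<circ> f) (verts G)"
      by (rule comp_inj_on[OF embD(1)[OF f]]) (rule inj_on_subset[OF inj order_trans[OF embD(2)[OF f] S]])
    show "(?e \<circ> f) ` verts G \<subseteq> verts (copy G S)"
      using embD(3)[OF f] bij_betw_imp_surj_on[OF copy(2)[OF S]] by auto
    fix x y assume "x \<in> verts G" "y \<in> verts G"
    then show "adj G x y \<longleftrightarrow> adj (copy G S) ((?e \<circ> f) x) ((?e \<circ> f) y)"
      using copy(3)[OF S embD(3)[OF f] embD(3)[OF f]] embD(4)[OF f] by simp
  qed
  ultimately show ?thesis unfolding equimorphic_def by blast
qed

lemma copy_iso:
  assumes S: "S \<subseteq> verts G" "S' \<subseteq> verts G" and i: "isomorphic (copy G S) (copy G S')" shows "iso S S'"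
proof -
  let ?e = "to_nat_on (verts G)"
  obtain g where g: "bij_betw g (verts (copy G S')) S'"
    "\<And>x y. x \<in> verts (copy G S') \<Longrightarrow> y \<in> verts (copy G S') \<Longrightarrow> adj (copy G S') x y \<longleftrightarrow> adj G (g x) (g y)"
    by (rule copy_bij[OF S(2)], rule that, assumption, simp)
  obtain f where f: "bij_betw f (verts (copy G S)) (verts (copy G S'))"
    "\<And>x y. x \<in> verts (copy G S) \<Longrightarrow> y \<in> verts (copy G S) \<Longrightarrow> adj (copy G S) x y \<longleftrightarrow> adj (copy G S') (f x) (f y)"
    using i unfolding isomorphic_def by blast
  note b = copy(2)[OF S(1)]
  have B: "bij_betw (g \<circ> (f \<circ> ?e)) S S'" by (rule bij_betw_trans[OF bij_betw_trans[OF b f(1)] g(1)])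
  have "emb S S' (g \<circ> (f \<circ> ?e))"
    unfolding emb_def
  proof (intro conjI ballI)
    show "inj_on (g \<circ> (f \<circ> ?e)) S" by (rule bij_betw_imp_inj_on[OF B])
    show "(g \<circ> (f \<circ> ?e)) ` S \<subseteq> S'" using bij_betw_imp_surj_on[OF B] by simp
    fix x y assume xy: "x \<in> S" "y \<in> S"
    have e: "?e x \<in> verts (copy G S)" "?e y \<in> verts (copy G S)" using bij_betw_apply[OF b] xy by auto
    show "adj G ((g \<circ> (f \<circ> ?e)) x) ((g \<circ> (f \<circ> ?e)) y) = adj G x y"
      using g(2)[OF bij_betw_apply[OF f(1) e(1)] bij_betw_apply[OF f(1) e(2)]] f(2)[OF e] copy(3)[OF S(1) xy] by simp
  qed
  then show ?thesis unfolding iso_def using bij_betw_imp_surj_on[OF B] by blast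
qed

text \<open>The image of \<open>H\<close> in \<open>G\<close> is an induced subgraph into which
  \<open>G\<close> embeds by composing the two given embeddings, so \<open>fin_iso\<close> applies
  to it.\<close>

lemma sibling_iso:
  assumes fin: "finite_twins G" and H: "is_graph H" "equimorphic H G" shows "isomorphic H G"
proof -
  obtain g where g: "inj_on g (verts H)" "g ` verts H \<subseteq> verts G"
      "\<forall>x\<in>verts H. \<forall>y\<in>verts H. adj H x y \<longleftrightarrow> adj G (g x) (g y)"
    using H(2) unfolding equimorphic_def embeds_def by (elim exE conjE)
  obtain k where k: "inj_on k (verts G)" "k ` verts G \<subseteq> verts H"
      "\<forall>x\<in>verts G. \<forall>y\<in>verts G. adj G x y \<longleftrightarrow> adj H (k x) (k y)"
    using H(2) unfolding equimorphic_def embeds_def by (elim exE conjE)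
  define S where "S = g ` verts H"
  have kH: "k x \<in> verts H" if "x \<in> verts G" for x using k(2) that by blast
  have "emb (verts G) S (g \<circ> k)" unfolding emb_def
  proof (intro conjI ballI)
    show "inj_on (g \<circ> k) (verts G)" by (rule comp_inj_on[OF k(1) inj_on_subset[OF g(1) k(2)]])
    show "(g \<circ> k) ` verts G \<subseteq> S" using k(2) unfolding S_def by auto
    show "adj G ((g \<circ> k) x) ((g \<circ> k) y) = adj G x y" if "x \<in> verts G" "y \<in> verts G" for x y
      using k(3) g(3) that kH[OF that(1)] kH[OF that(2)] by simp
  qed
  then have "iso (verts G) S" by (rule fin_iso[OF iffD2[OF fin_twins fin] g(2)[folded S_def]])
  then have "iso S (verts G)" by (rule iso_sym)
  then obtain f where f: "emb S (verts G) f" "f ` S = verts G" unfolding iso_def by blast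
  have gS: "g x \<in> S" if "x \<in> verts H" for x using that unfolding S_def by blast
  have "bij_betw (f \<circ> g) (verts H) (verts G)"
    using g(1) embD(1)[OF f(1)] f(2) unfolding bij_betw_def S_def by (auto intro: comp_inj_on simp: image_comp)
  moreover have "adj H x y \<longleftrightarrow> adj G ((f \<circ> g) x) ((f \<circ> g) y)" if "x \<in> verts H" "y \<in> verts H" for x y
    using g(3) that embD(4)[OF f(1) gS[OF that(1)] gS[OF that(2)]] by simp
  ultimately show ?thesis unfolding isomorphic_def by blast
qed

lemma copy_self: "is_graph (copy G (verts G))" "equimorphic (copy G (verts G)) G"
  using copy(1)[OF order_refl] copy_equimorphic[OF order_refl embeddable_sub[OF order_refl]] .

lemma copy_connected: "S \<subseteq> verts G \<Longrightarrow> connected_graph (copy G S) \<longleftrightarrow> conn True S"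
proof -
  assume S: "S \<subseteq> verts G"
  obtain g where g: "bij_betw g (verts (copy G S)) S"
    "\<And>x y. x \<in> verts (copy G S) \<Longrightarrow> y \<in> verts (copy G S) \<Longrightarrow> adj (copy G S) x y \<longleftrightarrow> adj G (g x) (g y)"
    by (rule copy_bij[OF S], rule that, assumption, simp)
  show ?thesis by (rule conn_bij[OF copy(1)[OF S] g])
qed

lemma siblings_iso:
  assumes "finite_twins G" "is_graph H" "equimorphic H G" "is_graph H'" "equimorphic H' G"
  shows "isomorphic H H'"
  by (rule isomorphic_trans[OF sibling_iso[OF assms(1-3)] isomorphic_sym[OF sibling_iso[OF assms(1,4,5)]]])

lemma twins_sib:
  assumes "finite_twins G" shows "sib G = 1"
  unfolding sib_def card_quotient_iso
proof (intro conjI ballI)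
  show "{H :: nat graph. is_graph H \<and> equimorphic H G} \<noteq> {}" using copy_self by blast
qed (use siblings_iso[OF assms] in auto)

lemma twins_sib_conn:
  assumes "finite_twins G" "connected_graph G" shows "sib_conn G = 1"
proof -
  have "connected_graph (copy G (verts G))" using assms(2) copy_connected connected_conn by blast
  then show ?thesis
    unfolding sib_conn_def card_quotient_iso
  proof (intro conjI ballI)
    assume "connected_graph (copy G (verts G))"
    then show "{H :: nat graph. is_graph H \<and> connected_graph H \<and> equimorphic H G} \<noteq> {}" using copy_self by blast
  qed (use siblings_iso[OF assms(1)] in auto)
qed

lemma sib_twins:
  assumes "sib G = 1" shows "finite_twins G"
proof -
  have i: "iso (verts G) Y" if "Y \<subseteq> verts G" "embeddable (verts G) Y" for Y
  proof (rule copy_iso[OF order_refl that(1)])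
    show "isomorphic (copy G (verts G)) (copy G Y)"
      using assms copy_self copy(1)[OF that(1)] copy_equimorphic[OF that] unfolding sib_def card_quotient_iso by blast
  qed
  \<comment> \<open>A graph or its complement is connected; this chooses the sense \<open>b\<close>
    in which \<open>G\<close> is rigid.\<close>
  have "conn True (verts G) \<or> conn False (verts G)"
  proof (cases "conn True (verts G)")
    case False
    then obtain x where x: "x \<in> verts G" unfolding conn_def by blast
    obtain y where y: "y \<in> verts G" "y \<notin> comp True (verts G) x" using not_conn_comp[OF False x] by blast
    have "comp True (verts G) x \<noteq> comp True (verts G) y" using comp_self[OF y(1)] y(2) by blast
    then show ?thesis using conn_two_comps[OF order_refl x y(1), of False] by simp
  qed simp
  then obtain b where "conn b (verts G)" by blast
  then have "rigid b (verts G)" unfolding rigid_def using i by blast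
  then show ?thesis using rigid_fin[OF order_refl] fin_twins by blast
qed

lemma sib_conn_twins:
  assumes "connected_graph G" "sib_conn G = 1" shows "finite_twins G"
proof -
  have c: "conn True (verts G)" using assms(1) connected_conn by blast
  have "iso (verts G) Y" if Y: "Y \<subseteq> verts G" "embeddable (verts G) Y" "conn True Y" for Y
  proof (rule copy_iso[OF order_refl Y(1)])
    have "connected_graph (copy G (verts G))" "connected_graph (copy G Y)"
      using copy_connected[OF order_refl] copy_connected[OF Y(1)] c Y(3) by blast+
    then show "isomorphic (copy G (verts G)) (copy G Y)"
      using assms copy_self copy(1)[OF Y(1)] copy_equimorphic[OF Y(1,2)] unfolding sib_conn_def card_quotient_iso by blast
  qed
  then have "rigid True (verts G)" unfolding rigid_def using c by blast
  then show ?thesis using rigid_fin[OF order_refl] fin_twins by blast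
qed

end

section \<open>Complements and lexicographic sums\<close>

lemma complement_simps:
  "verts (complement G) = verts G"
  "adj (complement G) x y \<longleftrightarrow> x \<in> verts G \<and> y \<in> verts G \<and> x \<noteq> y \<and> \<not> adj G x y"
  unfolding complement_def verts_def adj_def by auto

lemma complement_cograph:
  assumes "cograph G" shows "cograph (complement G)"
proof -
  have g: "\<And>x y. adj G x y \<Longrightarrow> adj G y x" using assms unfolding cograph_def is_graph_def by blast
  show ?thesis
    unfolding cograph_def
  proof (intro conjI notI)
    show "is_graph (complement G)" unfolding is_graph_def complement_simps using g by blast
    assume "\<exists>a b c d. a \<in> verts (complement G) \<and> b \<in> verts (complement G) \<and> c \<in> verts (complement G) \<and>
      d \<in> verts (complement G) \<and> distinct [a, b, c, d] \<and> adj (complement G) a b \<and> adj (complement G) b c \<and>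
      adj (complement G) c d \<and> \<not> adj (complement G) a c \<and> \<not> adj (complement G) a d \<and> \<not> adj (complement G) b d"
    then obtain a b c d where p: "a \<in> verts G" "b \<in> verts G" "c \<in> verts G" "d \<in> verts G" "distinct [a, b, c, d]"
      "\<not> adj G a b" "\<not> adj G b c" "\<not> adj G c d" "adj G a c" "adj G a d" "adj G b d"
      unfolding complement_simps by auto
    \<comment> \<open>The path on four vertices is self-complementary; in this order the non-edges
      form a path again.\<close>
    have "distinct [c, a, d, b]" "adj G c a" "adj G a d" "adj G d b" "\<not> adj G c d" "\<not> adj G c b" "\<not> adj G a b"
      using p g by auto
    then show False using assms p(1-4) unfolding cograph_def by blast
  qed
qed

lemma complement_twins:
  assumes "is_graph G" shows "finite_twins (complement G) \<longleftrightarrow> finite_twins G"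
proof -
  have "(\<forall>z\<in>verts G. z \<noteq> x \<longrightarrow> z \<noteq> y \<longrightarrow> adj (complement G) x z = adj (complement G) y z) \<longleftrightarrow>
    (\<forall>z\<in>verts G. z \<noteq> x \<longrightarrow> z \<noteq> y \<longrightarrow> adj G x z = adj G y z)" if "x \<in> verts G" "y \<in> verts G" for x y
    using that unfolding complement_simps by blast
  then show ?thesis unfolding finite_twins_def complement_simps(1) by (simp cong: ball_cong)
qed

lemma (in countable_cograph) complement_connected:
  assumes "\<not> connected_graph G" shows "connected_graph (complement G)"
proof -
  have nc: "\<not> conn True (verts G)" using assms connected_conn by blast
  then obtain x where x: "x \<in> verts G" unfolding conn_def by blast
  obtain y where y: "y \<in> verts G" "y \<notin> comp True (verts G) x" using not_conn_comp[OF nc x] by blast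
  have "comp True (verts G) x \<noteq> comp True (verts G) y" using comp_self[OF y(1)] y(2) by blast
  then have c: "conn False (verts G)" using conn_two_comps[OF order_refl x y(1), of False] by simp
  have "step False (verts G) \<le> adj (complement G)"
    unfolding step_def complement_simps le_fun_def by auto
  then have "(step False (verts G))\<^sup>*\<^sup>* p q \<Longrightarrow> (adj (complement G))\<^sup>*\<^sup>* p q" for p q
    using rtranclp_mono by blast
  then show ?thesis using c unfolding connected_graph_def conn_def complement_simps(1) by blast
qed

text \<open>The colours of a twin colouring serve as vertices of the index graph. Adjacency between
  two colours does not depend on representatives, because equally coloured vertices are twins.
  Conversely, the index of the summand is a colouring of the required kind.\<close>

lemma lex_sum_twins:
  fixes G :: "'a graph"
  assumes "cograph G" "countable (verts G)"
  shows "finite_twins G \<longleftrightarrow> (\<exists>(H :: nat graph) (L :: nat \<Rightarrow> nat graph).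
               is_graph H \<and> finite (verts H) \<and>
               (\<forall>j\<in>verts H. is_graph (L j) \<and> (is_clique (L j) \<or> is_independent (L j))) \<and>
               isomorphic G (lex_sum H L))" (is "_ \<longleftrightarrow> ?R")
proof
  interpret countable_cograph G by unfold_locales (fact assms)+
  assume "finite_twins G"
  then obtain f :: "'a \<Rightarrow> nat" where f: "finite (f ` verts G)"
    and tw: "\<And>x y. x \<in> verts G \<Longrightarrow> y \<in> verts G \<Longrightarrow> f x = f y \<Longrightarrow> twin (verts G) x y"
    unfolding finite_twins_def twin_def by blast
  let ?e = "to_nat_on (verts G)"
  define C where "C = (\<lambda>j. {x\<in>verts G. f x = j})"
  define H where "H = (f ` verts G, \<lambda>i j. \<exists>x\<in>verts G. \<exists>y\<in>verts G. f x = i \<and> f y = j \<and> i \<noteq> j \<and> adj G x y)"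
  define L where "L = (\<lambda>j. copy G (C j))"
  have CV: "C j \<subseteq> verts G" for j unfolding C_def by blast
  have vH: "verts H = f ` verts G" unfolding H_def verts_def by simp
  have aH: "adj H i j \<longleftrightarrow> (\<exists>x\<in>verts G. \<exists>y\<in>verts G. f x = i \<and> f y = j \<and> i \<noteq> j \<and> adj G x y)" for i j
    unfolding H_def adj_def by simp
  have vL: "verts (L j) = ?e ` C j" for j unfolding L_def copy_def verts_def by simp
  have "adj H j i" "i \<in> verts H" "j \<in> verts H" if ij: "adj H i j" for i j
  proof -
    obtain x y where xy: "x \<in> verts G" "y \<in> verts G" "f x = i" "f y = j" "i \<noteq> j" "adj G x y"
      using ij unfolding aH by blast
    show "adj H j i" unfolding aH using xy symE[of x y]
      by (intro bexI[OF _ xy(2)] bexI[OF _ xy(1)]) simp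
    show "i \<in> verts H" "j \<in> verts H" unfolding vH using xy by blast+
  qed
  then have "is_graph H" unfolding is_graph_def using aH by simp
  moreover have "is_graph (L j)" for j unfolding L_def by (rule copy(1)[OF CV])
  moreover have "is_clique (L j) \<or> is_independent (L j)" for j
  proof (rule disjCI)
    assume "\<not> is_independent (L j)"
    then obtain a b where ab: "a \<in> C j" "b \<in> C j" "adj (L j) (?e a) (?e b)" unfolding is_independent_def vL by blast
    then have "adj G a b" using copy(3)[OF CV] unfolding L_def by blast
    then have "a \<noteq> b" using irr by metis
    have "adj G x y" if "x \<in> C j" "y \<in> C j" "x \<noteq> y" for x y
      using twin_uniform[of "C j" "verts G" a b x y] tw ab(1,2) \<open>a \<noteq> b\<close> that \<open>adj G a b\<close> CV unfolding C_def by auto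
    then show "is_clique (L j)" unfolding is_clique_def vL using copy(3)[OF CV] unfolding L_def by auto
  qed
  moreover have "isomorphic G (lex_sum H L)"
    unfolding isomorphic_def
  proof (intro exI[of _ "\<lambda>x. (f x, ?e x)"] conjI ballI)
    have vl: "verts (lex_sum H L) = {(j, x). j \<in> f ` verts G \<and> x \<in> ?e ` C j}"
      unfolding lex_sum_def verts_def[of "(_, _)"] vH vL by simp
    show "bij_betw (\<lambda>x. (f x, ?e x)) (verts G) (verts (lex_sum H L))"
      unfolding bij_betw_def vl
    proof
      show "inj_on (\<lambda>x. (f x, ?e x)) (verts G)" using inj unfolding inj_on_def by blast
      show "(\<lambda>x. (f x, ?e x)) ` verts G = {(j, x). j \<in> f ` verts G \<and> x \<in> ?e ` C j}" unfolding C_def by (auto simp: image_iff) metis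
    qed
    fix x y assume xy: "x \<in> verts G" "y \<in> verts G"
    have Cx: "x \<in> C (f x)" "y \<in> C (f y)" using xy unfolding C_def by auto
    have al: "adj (lex_sum H L) (f x, ?e x) (f y, ?e y) \<longleftrightarrow> (if f x = f y then adj (L (f x)) (?e x) (?e y) else adj H (f x) (f y))"
      unfolding lex_sum_def adj_def[of "(_, _)"] vH vL using xy Cx by simp
    show "adj G x y \<longleftrightarrow> adj (lex_sum H L) (f x, ?e x) (f y, ?e y)"
    proof (cases "f x = f y")
      case True
      have "y \<in> C (f x)" using Cx(2) True by simp
      then show ?thesis unfolding al using True copy(3)[OF CV Cx(1)] unfolding L_def by simp
    next
      case False
      have "adj G x y" if xy': "x' \<in> verts G" "y' \<in> verts G" "f x' = f x" "f y' = f y" "adj G x' y'" for x' y'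
      proof -
        have "adj G x' y' = adj G x y'" using tw[OF xy'(1) xy(1) xy'(3)] xy' False unfolding twin_def by metis
        moreover have "adj G y' x = adj G y x" using tw[OF xy'(2) xy(2) xy'(4)] xy xy' False unfolding twin_def by metis
        ultimately show ?thesis using xy'(5) symE by blast
      qed
      then show ?thesis unfolding al aH using False xy by auto
    qed
  qed
  ultimately show ?R using f vH by metis
next
  assume ?R
  then obtain H :: "nat graph" and L :: "nat \<Rightarrow> nat graph" where H: "finite (verts H)"
    "\<And>j. j \<in> verts H \<Longrightarrow> is_clique (L j) \<or> is_independent (L j)" "isomorphic G (lex_sum H L)" by blast
  obtain p where p: "bij_betw p (verts G) (verts (lex_sum H L))"
    "\<And>x y. x \<in> verts G \<Longrightarrow> y \<in> verts G \<Longrightarrow> adj G x y \<longleftrightarrow> adj (lex_sum H L) (p x) (p y)"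
    using H(3) unfolding isomorphic_def by blast
  have pv: "fst (p x) \<in> verts H" "snd (p x) \<in> verts (L (fst (p x)))" if "x \<in> verts G" for x
    using bij_betw_apply[OF p(1) that] unfolding lex_sum_def verts_def[of "(_, _)"] by auto
  have al: "adj G x y \<longleftrightarrow> (if fst (p x) = fst (p y) then adj (L (fst (p x))) (snd (p x)) (snd (p y)) else adj H (fst (p x)) (fst (p y)))"
    if "x \<in> verts G" "y \<in> verts G" for x y
    using p(2)[OF that] pv[OF that(1)] pv[OF that(2)] unfolding lex_sum_def adj_def[of "(_, _)"]
    by (simp add: case_prod_beta)
  have "adj G x z = adj G y z"
    if xyz: "x \<in> verts G" "y \<in> verts G" "fst (p x) = fst (p y)" "z \<in> verts G" "z \<noteq> x" "z \<noteq> y" for x y z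
  proof (cases "fst (p z) = fst (p x)")
    case True
    have "p z \<noteq> p x" "p z \<noteq> p y" using bij_betw_imp_inj_on[OF p(1)] xyz unfolding inj_on_def by blast+
    then have n: "snd (p z) \<noteq> snd (p x)" "snd (p z) \<noteq> snd (p y)" using True xyz(3) by (metis prod_eqI)+
    let ?L = "L (fst (p x))"
    have m: "snd (p x) \<in> verts ?L" "snd (p y) \<in> verts ?L" "snd (p z) \<in> verts ?L"
      using pv(2)[OF xyz(1)] pv(2)[OF xyz(2)] pv(2)[OF xyz(4)] True xyz(3) by auto
    have "adj ?L (snd (p x)) (snd (p z)) = adj ?L (snd (p y)) (snd (p z))"
      using H(2)[OF pv(1)[OF xyz(1)]] m n unfolding is_clique_def is_independent_def by metis
    then show ?thesis using al[OF xyz(1,4)] al[OF xyz(2,4)] True xyz(3) by simp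
  next
    case False
    then show ?thesis using al[OF xyz(1,4)] al[OF xyz(2,4)] xyz(3) by simp
  qed
  moreover have "finite ((\<lambda>x. fst (p x)) ` verts G)" by (rule finite_subset[OF _ H(1)]) (use pv(1) in blast)
  ultimately show "finite_twins G" unfolding finite_twins_def by (intro exI[of _ "\<lambda>x. fst (p x)"]) blast
qed

theorem theorem1p7:
  fixes G :: "'a graph"
  assumes "cograph G" and "countable (verts G)"
  shows "(sib G = 1 \<longleftrightarrow> sib_c G = 1) \<and>
         (sib_c G = 1 \<longleftrightarrow>
            (\<exists>(H :: nat graph) (L :: nat \<Rightarrow> nat graph).
               is_graph H \<and> finite (verts H) \<and>
               (\<forall>j\<in>verts H. is_graph (L j) \<and> (is_clique (L j) \<or> is_independent (L j))) \<and>
               isomorphic G (lex_sum H L)))"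
proof -
  interpret G: countable_cograph G by unfold_locales fact+
  interpret C: countable_cograph "complement G"
    by unfold_locales (simp_all only: complement_cograph complement_simps(1) assms)
  have ig: "is_graph G" using assms unfolding cograph_def by blast
  have "sib G = 1 \<longleftrightarrow> finite_twins G" using G.sib_twins G.twins_sib by blast
  moreover have "sib_c G = 1 \<longleftrightarrow> finite_twins G"
  proof (cases "connected_graph G")
    case True
    then show ?thesis unfolding sib_c_def using G.sib_conn_twins G.twins_sib_conn by auto
  next
    case False
    then have "sib_conn (complement G) = 1 \<longleftrightarrow> finite_twins (complement G)"
      using C.sib_conn_twins C.twins_sib_conn G.complement_connected by blast
    then show ?thesis using False complement_twins[OF ig] unfolding sib_c_def by simp
  qed
  ultimately show ?thesis using lex_sum_twins[OF assms] by simp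
qed

end
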